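(* Let $m\ge 1$, let $\mathcal{E}$ and $\mathcal{E}_*$ be Hilbert spaces, and let $\theta\in\mathcal{M}(\mathcal{E},\mathcal{E}_* )$ be a multiplier such that $\operatorname{ran} M_\theta$ is closed. Let $\mathcal{H}_\theta=(H^2_m\otimes\mathcal{E}_* )/\operatorname{ran}M_\theta$ be the quotient Hilbert module. If $\mathcal{H}_\theta$ is similar to $H^2_m\otimes\mathcal{F}$ for some Hilbert space $\mathcal{F}$, then there exists a multiplier $\psi\in\mathcal{M}(\mathcal{E}_*,\mathcal{E})$ satisfying $$\theta(z)\psi(z)\theta(z)=\theta(z)\quad\text{for all } z\in\mathbb{B}^m.$$
   Context: $\mathbb{B}^m$ is the open unit ball of $\mathbb{C}^m$. The Drury-Arveson (DA) module $H^2_m$ is the reproducing kernel Hilbert space on $\mathbb{B}^m$ with kernel $K(z,w)=(1-\sum_{i=1}^m z_i\bar w_i)^{-1}$. For a Hilbert space $\mathcal{E}$, $H^2_m\otimes\mathcal{E}$ is identified with the Hilbert space of $\mathcal{E}$-valued holomorphic functions $f(z)=\sum_{\bm{k}\in\mathbb{N}^m}a_{\bm{k}}z^{\bm{k}}$ on $\mathbb{B}^m$ ($a_{\bm k}\in\mathcal{E}$, $0\in\mathbb{N}$) with $\|f\|^2=\sum_{\bm{k}}\|a_{\bm{k}}\|^2/\gamma_{\bm{k}}<\infty$, where $\gamma_{\bm{k}}=\frac{(k_1+\cdots+k_m)!}{k_1!\cdots k_m!}$. It is a Hilbert module over $\mathbb{C}[z_1,\dots,z_m]$ (a Hilbert space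 with module multiplication given by a commuting $m$-tuple of bounded operators), with $z_i$ acting as multiplication $M_{z_i}$ by the coordinate function. A submodule is a norm-closed subspace invariant under the module action; the quotient by a submodule carries the quotient Hilbert space norm and the induced module action. A module map is a bounded linear operator commuting with the module actions. Two Hilbert modules are similar if there is an invertible (bounded, with bounded inverse) module map between them. A multiplier $\varphi\in\mathcal{M}(\mathcal{E},\mathcal{E}_* )$ is a holomorphic function $\varphi:\mathbb{B}^m\to\mathcal{L}(\mathcal{E},\mathcal{E}_* )$ (bounded operators) such that $\varphi f\in H^2_m\otimes\mathcal{E}_*$ for all $f\in H^2_m\otimes\mathcal{E}$; it defines the bounded module map $M_\varphi:H^2_m\otimes\mathcal{E}\to H^2_m\otimes\mathcal{E}_*$, $M_\varphi f=\varphi f$. *)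

theory Defs
  imports "HOL-Analysis.Analysis"
begin

text \<open>
  Complex scalars. A complex Hilbert space is a complete real inner product space whose
  real inner product is the real part of a complex sesquilinear form (linear in the first
  argument), so that its norm, completeness and topology are those of the library classes.
\<close>

class complex_normed_vector = real_normed_vector +
  fixes scaleC :: "complex \<Rightarrow> 'a \<Rightarrow> 'a"  (infixr "*\<^sub>C" 75)
  assumes scaleC_add_right: "c *\<^sub>C (x + y) = c *\<^sub>C x + c *\<^sub>C y"
    and scaleC_add_left: "(c + d) *\<^sub>C x = c *\<^sub>C x + d *\<^sub>C x"
    and scaleC_scaleC: "c *\<^sub>C d *\<^sub>C x = (c * d) *\<^sub>C x"
    and scaleC_of_real: "complex_of_real r *\<^sub>C x = r *\<^sub>R x"
    and norm_scaleC: "norm (c *\<^sub>C x) = cmod c * norm x"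

class complex_hilbert_space = complex_normed_vector + real_inner + complete_space +
  fixes cinner :: "'a \<Rightarrow> 'a \<Rightarrow> complex"
  assumes cinner_commute: "cinner x y = cnj (cinner y x)"
    and cinner_add_left: "cinner (x + y) z = cinner x z + cinner y z"
    and cinner_scaleC_left: "cinner (c *\<^sub>C x) y = c * cinner x y"
    and Re_cinner: "Re (cinner x y) = inner x y"

instantiation complex :: complex_hilbert_space
begin

definition scaleC_complex :: "complex \<Rightarrow> complex \<Rightarrow> complex"
  where "scaleC_complex c z = c * z"

definition cinner_complex :: "complex \<Rightarrow> complex \<Rightarrow> complex"
  where "cinner_complex z w = z * cnj w"

instance
  by standard
    (auto simp: scaleC_complex_def cinner_complex_def algebra_simps norm_mult
      scaleR_conv_of_real inner_complex_def)

end

instantiation blinfun :: (real_normed_vector, complex_normed_vector) complex_normed_vector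
begin

lift_definition scaleC_blinfun :: "complex \<Rightarrow> ('a \<Rightarrow>\<^sub>L 'b) \<Rightarrow> ('a \<Rightarrow>\<^sub>L 'b)"
  is "\<lambda>c T x. c *\<^sub>C T x"
proof -
  fix c :: complex and T :: "'a \<Rightarrow> 'b"
  assume T: "bounded_linear T"
  interpret T: bounded_linear T by (fact T)
  obtain K where K: "\<And>x. norm (T x) \<le> norm x * K"
    using T.bounded by blast
  show "bounded_linear (\<lambda>x. c *\<^sub>C T x)"
  proof (rule bounded_linear_intro[where K = "cmod c * K"])
    fix x y :: 'a and r :: real
    show "c *\<^sub>C T (x + y) = c *\<^sub>C T x + c *\<^sub>C T y"
      by (simp add: T.add scaleC_add_right)
    show "c *\<^sub>C T (r *\<^sub>R x) = r *\<^sub>R c *\<^sub>C T x"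
      by (simp add: T.scaleR scaleC_scaleC mult.commute flip: scaleC_of_real)
    show "norm (c *\<^sub>C T x) \<le> norm x * (cmod c * K)"
      using mult_left_mono[OF K[of x], of "cmod c"] by (simp add: norm_scaleC algebra_simps)
  qed
qed

instance
proof
  fix c d :: complex and r :: real and S T :: "'a \<Rightarrow>\<^sub>L 'b"
  show "c *\<^sub>C (S + T) = c *\<^sub>C S + c *\<^sub>C T"
    by (transfer, simp add: scaleC_add_right)
  show "(c + d) *\<^sub>C T = c *\<^sub>C T + d *\<^sub>C T"
    by (transfer, simp add: scaleC_add_left)
  show mult: "c *\<^sub>C d *\<^sub>C T = (c * d) *\<^sub>C T" for c d and T :: "'a \<Rightarrow>\<^sub>L 'b"
    by (transfer, simp add: scaleC_scaleC)
  show real: "complex_of_real r *\<^sub>C T = r *\<^sub>R T" for r and T :: "'a \<Rightarrow>\<^sub>L 'b"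
    by (transfer, simp add: scaleC_of_real)
  have le: "norm (b *\<^sub>C U) \<le> cmod b * norm U" for b and U :: "'a \<Rightarrow>\<^sub>L 'b"
  proof (rule norm_blinfun_bound)
    fix x
    have "norm (blinfun_apply U x) \<le> norm U * norm x" by (rule norm_blinfun)
    then show "norm (blinfun_apply (b *\<^sub>C U) x) \<le> cmod b * norm U * norm x"
      by (simp add: scaleC_blinfun.rep_eq norm_scaleC mult.assoc mult_left_mono)
  qed simp
  show "norm (c *\<^sub>C T) = cmod c * norm T"
  proof (cases "c = 0")
    case True
    then show ?thesis using le[of c T] by simp
  next
    case False
    have one: "1 *\<^sub>C T = T"
      using real[of 1 T] by simp
    have "inverse c *\<^sub>C c *\<^sub>C T = T"
      using False one mult[of "inverse c" c T] by simp
    then have "norm T \<le> inverse (cmod c) * norm (c *\<^sub>C T)"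
      using le[of "inverse c" "c *\<^sub>C T"] by (simp add: norm_inverse)
    then have "cmod c * norm T \<le> norm (c *\<^sub>C T)"
      using False by (simp add: field_simps)
    with le[of c T] show ?thesis by simp
  qed
qed

end

text \<open>
  The type of bounded operators of the library consists of real-linear operators;
  the bounded operators between complex Hilbert spaces are those that are also complex linear.
\<close>

definition complex_linear_blinfun ::
    "('a::complex_normed_vector \<Rightarrow>\<^sub>L 'b::complex_normed_vector) \<Rightarrow> bool"
  where "complex_linear_blinfun T \<longleftrightarrow>
    (\<forall>c x. blinfun_apply T (c *\<^sub>C x) = c *\<^sub>C blinfun_apply T x)"

text \<open>
  Complex Frechet differentiability at every point of the open unit ball of \<open>complex ^ 'm\<close>
  (which carries the Euclidean norm).
\<close>

definition holomorphic_on_ball ::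
    "(complex ^ 'm \<Rightarrow> 'b::complex_normed_vector) \<Rightarrow> bool"
  where "holomorphic_on_ball f \<longleftrightarrow>
    (\<forall>z\<in>ball 0 1. \<exists>D. (f has_derivative D) (at z) \<and> (\<forall>c v. D (c *s v) = c *\<^sub>C D v))"

text \<open>
  A Hilbert module over the polynomial ring in variables indexed by \<open>'m\<close>, on a carrier set.
  The Hilbert space structure is recorded by its norm, which determines the inner product by
  polarization. \<open>mact M i\<close> is multiplication by the \<open>i\<close>-th coordinate; these operators
  determine the action of all polynomials.
\<close>

record ('m, 'a) hilbert_module =
  mcarrier :: "'a set"
  madd :: "'a \<Rightarrow> 'a \<Rightarrow> 'a"
  mscale :: "complex \<Rightarrow> 'a \<Rightarrow> 'a"
  mnorm :: "'a \<Rightarrow> real"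
  mact :: "'m \<Rightarrow> 'a \<Rightarrow> 'a"

definition module_topology :: "('m, 'a) hilbert_module \<Rightarrow> 'a topology"
  where "module_topology M =
    Metric_space.mtopology (mcarrier M) (\<lambda>x y. mnorm M (madd M x (mscale M (- 1) y)))"

definition bounded_linear_map ::
    "('m, 'a) hilbert_module \<Rightarrow> ('m, 'b) hilbert_module \<Rightarrow> ('a \<Rightarrow> 'b) \<Rightarrow> bool"
  where "bounded_linear_map M N T \<longleftrightarrow>
    T \<in> mcarrier M \<rightarrow> mcarrier N \<and>
    (\<forall>x\<in>mcarrier M. \<forall>y\<in>mcarrier M. T (madd M x y) = madd N (T x) (T y)) \<and>
    (\<forall>c. \<forall>x\<in>mcarrier M. T (mscale M c x) = mscale N c (T x)) \<and>
    (\<exists>C. \<forall>x\<in>mcarrier M. mnorm N (T x) \<le> C * mnorm M x)"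

definition module_map ::
    "('m, 'a) hilbert_module \<Rightarrow> ('m, 'b) hilbert_module \<Rightarrow> ('a \<Rightarrow> 'b) \<Rightarrow> bool"
  where "module_map M N T \<longleftrightarrow>
    bounded_linear_map M N T \<and> (\<forall>i. \<forall>x\<in>mcarrier M. T (mact M i x) = mact N i (T x))"

definition similar_modules ::
    "('m, 'a) hilbert_module \<Rightarrow> ('m, 'b) hilbert_module \<Rightarrow> bool"
  where "similar_modules M N \<longleftrightarrow>
    (\<exists>T T'. module_map M N T \<and> bounded_linear_map N M T' \<and>
      (\<forall>x\<in>mcarrier M. T' (T x) = x) \<and> (\<forall>y\<in>mcarrier N. T (T' y) = y))"

text \<open>
  The quotient by a submodule \<open>S\<close>: its elements are the cosets of \<open>S\<close>, with the usual
  quotient norm. Adding \<open>S\<close> again in the scalar multiplication and the action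
  matters because the image of a coset under an operator is in general not a full coset.
\<close>

definition quotient_module ::
    "('m, 'a) hilbert_module \<Rightarrow> 'a set \<Rightarrow> ('m, 'a set) hilbert_module"
  where "quotient_module M S =
    \<lparr> mcarrier = (\<lambda>x. madd M x ` S) ` mcarrier M,
      madd = (\<lambda>A B. {madd M x y | x y. x \<in> A \<and> y \<in> B}),
      mscale = (\<lambda>c A. {madd M (mscale M c x) s | x s. x \<in> A \<and> s \<in> S}),
      mnorm = (\<lambda>A. INF x\<in>A. mnorm M x),
      mact = (\<lambda>i A. {madd M (mact M i x) s | x s. x \<in> A \<and> s \<in> S}) \<rparr>"

text \<open>Multi-indices are functions \<open>'m \<Rightarrow> nat\<close>.\<close>

definition multinomial :: "('m::finite \<Rightarrow> nat) \<Rightarrow> real"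
  where "multinomial k = fact (\<Sum>i\<in>UNIV. k i) / (\<Prod>i\<in>UNIV. fact (k i))"

definition monomial :: "('m::finite \<Rightarrow> nat) \<Rightarrow> complex ^ 'm \<Rightarrow> complex"
  where "monomial k z = (\<Prod>i\<in>UNIV. (z $ i) ^ k i)"

definition power_series_on_ball ::
    "(('m::finite \<Rightarrow> nat) \<Rightarrow> 'e::complex_hilbert_space) \<Rightarrow> (complex ^ 'm \<Rightarrow> 'e) \<Rightarrow> bool"
  where "power_series_on_ball a f \<longleftrightarrow>
    (\<forall>z\<in>ball 0 1. ((\<lambda>k. monomial k z *\<^sub>C a k) has_sum f z) UNIV)"

definition taylor_coeffs ::
    "(complex ^ 'm \<Rightarrow> 'e::complex_hilbert_space) \<Rightarrow> ('m::finite \<Rightarrow> nat) \<Rightarrow> 'e"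
  where "taylor_coeffs f = (THE a. power_series_on_ball a f)"

text \<open>
  The Drury-Arveson module with coefficients in \<open>'e\<close>. A function on the open unit ball is
  represented by its extension by zero to all of \<open>complex ^ 'm\<close>, so that functions on the ball
  are equal iff their representatives are. Membership forces \<open>f\<close> to be holomorphic, being the
  sum of a power series converging on the whole ball.
\<close>

definition drury_arveson ::
    "('m::finite, complex ^ 'm \<Rightarrow> 'e::complex_hilbert_space) hilbert_module"
  where "drury_arveson =
    \<lparr> mcarrier = {f. (\<forall>z. z \<notin> ball 0 1 \<longrightarrow> f z = 0) \<and>
        (\<exists>a. power_series_on_ball a f \<and>
          (\<lambda>k. (norm (a k))\<^sup>2 / multinomial k) summable_on UNIV)},
      madd = (\<lambda>f g z. f z + g z),
      mscale = (\<lambda>c f z. c *\<^sub>C f z),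
      mnorm = (\<lambda>f. sqrt (\<Sum>\<^sub>\<infinity>k. (norm (taylor_coeffs f k))\<^sup>2 / multinomial k)),
      mact = (\<lambda>i f z. (z $ i) *\<^sub>C f z) \<rparr>"

definition mult_op ::
    "(complex ^ 'm \<Rightarrow> 'e::complex_hilbert_space \<Rightarrow>\<^sub>L 'f::complex_hilbert_space) \<Rightarrow>
      (complex ^ 'm \<Rightarrow> 'e) \<Rightarrow> (complex ^ 'm \<Rightarrow> 'f)"
  where "mult_op \<phi> f = (\<lambda>z. blinfun_apply (\<phi> z) (f z))"

text \<open>The values of a multiplier outside the ball are irrelevant.\<close>

definition multiplier ::
    "(complex ^ 'm::finite \<Rightarrow> 'e::complex_hilbert_space \<Rightarrow>\<^sub>L 'f::complex_hilbert_space) \<Rightarrow> bool"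
  where "multiplier \<phi> \<longleftrightarrow>
    (\<forall>z\<in>ball 0 1. complex_linear_blinfun (\<phi> z)) \<and>
    holomorphic_on_ball \<phi> \<and>
    (\<forall>f\<in>mcarrier drury_arveson. mult_op \<phi> f \<in> mcarrier drury_arveson)"

definition mult_range ::
    "(complex ^ 'm::finite \<Rightarrow> 'e::complex_hilbert_space \<Rightarrow>\<^sub>L 'f::complex_hilbert_space) \<Rightarrow>
      (complex ^ 'm \<Rightarrow> 'f) set"
  where "mult_range \<phi> = mult_op \<phi> ` mcarrier drury_arveson"

end

theory Submission
  imports Defs
begin

text \<open>
  Write \<open>S\<^sub>i\<close> for multiplication by \<open>z\<^sub>i\<close> on a vector-valued Drury-Arveson space and \<open>L\<^sub>i\<close> for its
  adjoint. A similarity between the quotient by \<open>ran M\<^sub>\<theta>\<close> and the space over \<open>\<F>\<close> is the same as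
  a surjective module map \<open>R\<close> onto the latter with kernel \<open>ran M\<^sub>\<theta>\<close>. Everything then rests on one
  lifting property: if \<open>A\<close> and \<open>B\<close> are module maps with \<open>ran B \<subseteq> ran A\<close>, then \<open>B = A C\<close> for some
  module map \<open>C\<close> (lemma \<open>module_hom_factorization\<close>). Applied to \<open>A = R\<close> and \<open>B = 1\<close> it gives \<open>J\<close> with
  \<open>R J = 1\<close>. The module map \<open>1 - J R\<close> has range in \<open>ker R = ran M\<^sub>\<theta>\<close>, so a second application gives
  \<open>M\<^sub>\<theta> C = 1 - J R\<close>, and \<open>M\<^sub>\<theta> C M\<^sub>\<theta> = M\<^sub>\<theta>\<close> because \<open>R M\<^sub>\<theta> = 0\<close>. Finally \<open>C\<close> is multiplication by a
  multiplier \<open>\<psi>\<close>, and evaluating the last identity on constant functions gives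
  \<open>\<theta> \<psi> \<theta> = \<theta>\<close> pointwise.

  The lifting property is the commutant lifting theorem for the row contraction \<open>(S\<^sub>1, \<dots>, S\<^sub>m)\<close>.
  Let \<open>N\<close> be the orthogonal complement of \<open>ker A\<close>. The equation \<open>A y = B x\<close> has a unique solution
  \<open>y = C0 x\<close> in \<open>N\<close>, bounded in \<open>x\<close> by the open mapping theorem
  (\<open>closed_relation_bounded_choice\<close>). The adjoint \<open>D0\<close> of \<open>C0\<close> intertwines the \<open>L\<^sub>i\<close> on the
  \<open>L\<^sub>i\<close>-invariant space \<open>N\<close>, and any extension \<open>D\<close> of it from \<open>N\<close> that intertwines the \<open>L\<^sub>i\<close>
  everywhere provides \<open>C\<close> as its adjoint. Such a \<open>D\<close> is constructed in \<open>intertwining_extension\<close> by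
  the lurking isometry method, driven by the energy identity
  \<open>|x|\<^sup>2 = |x\<^sub>0|\<^sup>2 + |L\<^sub>1 x|\<^sup>2 + \<dots> + |L\<^sub>m x|\<^sup>2\<close>, in which \<open>x\<^sub>0\<close> is the constant coefficient.

  The Hilbert space arguments only use the real inner product. Complex linearity of \<open>C\<close> is restored
  at the end by averaging, which is harmless because \<open>A\<close>, \<open>B\<close> and the shifts are complex linear.
\<close>

section \<open>Hilbert and Banach space preliminaries\<close>

instance complex_hilbert_space \<subseteq> banach ..

text \<open>
  The representing vector minimizes \<open>b x x - 2 * l x\<close> over \<open>N\<close>: a minimizing sequence is Cauchy by
  the parallelogram law for \<open>b\<close>, and the first variation at its limit vanishes. A form \<open>b\<close> other
  than the inner product is admitted because the lifting argument projects with respect to an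
  equivalent inner product on \<open>N\<close>.
\<close>

lemma quadratic_form_riesz:
  fixes N :: "'a::{real_inner,complete_space} set" and b :: "'a \<Rightarrow> 'a \<Rightarrow> real"
  assumes N: "subspace N" "closed N" and b: "bounded_bilinear b"
    and sym: "\<And>x y. b x y = b y x"
    and e: "e > 0" and coer: "\<And>x. x \<in> N \<Longrightarrow> e * (norm x)\<^sup>2 \<le> b x x"
    and l: "bounded_linear l"
  shows "\<exists>x\<in>N. \<forall>v\<in>N. b x v = l v"
proof -
  interpret b: bounded_bilinear b by (fact b)
  interpret l: bounded_linear l by (fact l)
  define J where "J x = b x x - 2 * l x" for x
  obtain K where K: "K > 0" "\<And>x. norm (l x) \<le> norm x * K"
    using l.pos_bounded by blast
  have lower: "J x \<ge> - K\<^sup>2 / e" if "x \<in> N" for x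
  proof -
    have "l x \<le> norm x * K" using K(2)[of x] by simp
    moreover have "e * (norm x)\<^sup>2 - 2 * (norm x * K) + K\<^sup>2 / e = (e * norm x - K)\<^sup>2 / e"
      using e by (simp add: field_simps power2_eq_square)
    moreover have "(e * norm x - K)\<^sup>2 / e \<ge> 0" using e by simp
    ultimately show ?thesis using coer[OF that] unfolding J_def by simp
  qed
  define m where "m = Inf (J ` N)"
  have N0: "0 \<in> N" using N(1) by (rule subspace_0)
  have bdd: "bdd_below (J ` N)" using lower by (auto intro!: bdd_belowI)
  have m: "m \<le> J x" if "x \<in> N" for x
    unfolding m_def using that bdd by (simp add: cINF_lower)
  have "\<exists>x\<in>N. J x < m + 1 / real (Suc n)" for n
  proof -
    have "Inf (J ` N) < m + 1 / real (Suc n)" unfolding m_def by simp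
    then show ?thesis using N0 bdd by (subst (asm) cInf_less_iff) auto
  qed
  then obtain X where X: "\<And>n. X n \<in> N" "\<And>n. J (X n) < m + 1 / real (Suc n)" by metis
  have para: "e * (norm (x - y))\<^sup>2 \<le> 2 * (J x - m) + 2 * (J y - m)" if "x \<in> N" "y \<in> N" for x y
  proof -
    have mid: "(1/2) *\<^sub>R (x + y) \<in> N" using that N(1) by (simp add: subspace_add subspace_scale)
    have "b (x - y) (x - y) = 2 * J x + 2 * J y - 4 * J ((1/2) *\<^sub>R (x + y))"
      unfolding J_def
      by (simp add: b.add_left b.add_right b.diff_left b.diff_right b.scaleR_left b.scaleR_right
          l.add l.scaleR sym[of y x] algebra_simps)
    then show ?thesis using coer[of "x - y"] m[OF mid] that N(1) by (simp add: subspace_diff)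
  qed
  have "Cauchy X"
  proof (rule metric_CauchyI)
    fix d :: real assume d: "d > 0"
    obtain M where M: "M > 0" "inverse (real M) < e * d\<^sup>2 / 4"
      using reals_Archimedean2[of "4 / (e * d\<^sup>2)"] d e ex_inverse_of_nat_less[of "e * d\<^sup>2 / 4"]
      by (auto simp: field_simps)
    have "dist (X p) (X q) < d" if "p \<ge> M" "q \<ge> M" for p q
    proof -
      have *: "J (X r) - m < e * d\<^sup>2 / 4" if "r \<ge> M" for r
      proof -
        have "1 / real (Suc r) \<le> inverse (real M)" using that M(1) by (simp add: field_simps)
        then show ?thesis using X(2)[of r] M(2) by linarith
      qed
      have "e * (norm (X p - X q))\<^sup>2 < e * d\<^sup>2"
        using para[OF X(1) X(1), of p q] *[OF that(1)] *[OF that(2)] by argo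
      then have "(norm (X p - X q))\<^sup>2 < d\<^sup>2" using e by simp
      then show ?thesis using d by (simp add: dist_norm power2_less_imp_less)
    qed
    then show "\<exists>M. \<forall>p\<ge>M. \<forall>q\<ge>M. dist (X p) (X q) < d" by blast
  qed
  then obtain x where x: "X \<longlonglongrightarrow> x" using Cauchy_convergent convergent_def by blast
  have xN: "x \<in> N" using x X(1) N(2) by (meson closed_sequentially)
  have "(\<lambda>n. J (X n)) \<longlonglongrightarrow> J x"
    unfolding J_def by (intro tendsto_intros b.tendsto l.tendsto x)
  moreover have "(\<lambda>n. m + 1 / real (Suc n)) \<longlonglongrightarrow> m + 0"
    using lim_inverse_n'[THEN LIMSEQ_Suc] by (intro tendsto_intros) (auto simp: field_simps)
  ultimately have Jx: "J x \<le> m"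
    using X(2) by (intro LIMSEQ_le[of "\<lambda>n. J (X n)" _ "\<lambda>n. m + 1 / real (Suc n)"]) (auto intro: less_imp_le)
  have "b x v = l v" if v: "v \<in> N" for v
  proof -
    define \<delta> where "\<delta> = b x v - l v"
    define \<beta> where "\<beta> = b v v"
    have \<beta>: "\<beta> \<ge> 0" unfolding \<beta>_def using coer[OF v] e
      by (smt (verit) mult_nonneg_nonneg zero_le_power2)
    \<comment> \<open>the minimizer would be \<open>- \<delta> / \<beta>\<close>; adding 1 covers \<open>\<beta> = 0\<close> and still gives a negative value\<close>
    define t where "t = - \<delta> / (\<beta> + 1)"
    have "x + t *\<^sub>R v \<in> N" using xN v N(1) by (simp add: subspace_add subspace_scale)
    from m[OF this] Jx have "0 \<le> J (x + t *\<^sub>R v) - J x" by simp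
    also have "\<dots> = 2 * t * \<delta> + t\<^sup>2 * \<beta>"
      unfolding J_def \<delta>_def \<beta>_def
      by (simp add: b.add_left b.add_right b.scaleR_left b.scaleR_right l.add l.scaleR sym[of v x]
          algebra_simps power2_eq_square)
    also have "\<dots> = - (\<delta>\<^sup>2 * (\<beta> + 2)) / (\<beta> + 1)\<^sup>2"
      using \<beta> unfolding t_def by (simp add: divide_simps power2_eq_square) algebra
    finally have "\<delta>\<^sup>2 * (\<beta> + 2) \<le> 0" using \<beta> by (auto simp: field_simps)
    then have "\<delta> = 0" using \<beta> by (auto simp: mult_le_0_iff)
    then show ?thesis unfolding \<delta>_def by simp
  qed
  then show ?thesis using xN by blast
qed

lemma adjoint_exists:
  fixes A :: "'a::{real_inner,complete_space} \<Rightarrow> 'b::real_inner"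
  assumes "bounded_linear A"
  obtains A' where "bounded_linear A'" "\<And>x y. inner (A x) y = inner x (A' y)"
proof -
  interpret A: bounded_linear A by fact
  have "\<exists>z\<in>UNIV. \<forall>x\<in>UNIV. inner z x = inner (A x) y" for y
  proof (rule quadratic_form_riesz[where e = 1])
    show "bounded_linear (\<lambda>x. inner (A x) y)"
      using bounded_linear_compose[OF bounded_linear_inner_left assms] by simp
  qed (auto simp: bounded_bilinear_inner inner_commute power2_norm_eq_inner)
  then obtain A' where A': "\<And>x y. inner (A x) y = inner x (A' y)"
    by (metis UNIV_I inner_commute)
  obtain K where K: "K \<ge> 0" "\<And>x. norm (A x) \<le> norm x * K" using A.nonneg_bounded by blast
  have "bounded_linear A'"
  proof (rule bounded_linear_intro[where K = K])
    fix x y and r :: real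
    show "A' (x + y) = A' x + A' y"
      by (rule vector_eq_ldot[THEN iffD1]) (simp add: inner_add_right flip: A')
    show "A' (r *\<^sub>R x) = r *\<^sub>R A' x"
      by (rule vector_eq_ldot[THEN iffD1]) (simp flip: A')
    have "norm (A' x) * norm (A' x) = inner (A (A' x)) x"
      by (simp add: A' power2_norm_eq_inner flip: power2_eq_square)
    also have "\<dots> \<le> norm (A (A' x)) * norm x" by (rule norm_cauchy_schwarz)
    also have "\<dots> \<le> norm (A' x) * (norm x * K)"
      using mult_right_mono[OF K(2)[of "A' x"], of "norm x"] by (simp add: algebra_simps)
    finally show "norm (A' x) \<le> norm x * K"
      using K(1) by (cases "norm (A' x) = 0") (simp_all add: mult_le_cancel_left_pos)
  qed
  with A' that show ?thesis by blast
qed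

lemma orthogonal_projection_exists:
  fixes N :: "'a::{real_inner,complete_space} set"
  assumes "subspace N" "closed N"
  obtains p where "p \<in> N" "\<And>v. v \<in> N \<Longrightarrow> inner (y - p) v = 0"
proof -
  have "\<exists>p\<in>N. \<forall>v\<in>N. inner p v = inner y v"
    by (rule quadratic_form_riesz[where e = 1])
      (use assms in \<open>auto simp: bounded_bilinear_inner inner_commute power2_norm_eq_inner
          bounded_linear_inner_right\<close>)
  then show ?thesis using that by (metis inner_diff_left right_minus_eq)
qed

text \<open>
  This is the open mapping theorem for the projection of \<open>W\<close> to its first factor. Stated for
  relations, it contains the closed graph theorem (\<open>W\<close> a graph) and also yields bounded solutions
  of equations \<open>A y = B x\<close>. By the Baire property, the \<open>x\<close> that have a partner of norm at
  most \<open>n\<close> are dense in some ball for suitable \<open>n\<close>; by symmetry and convexity the ball may be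
  centred at 0. Solving approximately with half the error and iterating on the remainder
  gives exact partners.
\<close>

lemma closed_relation_bounded_choice:
  fixes W :: "('a::banach \<times> 'b::banach) set"
  assumes W: "subspace W" "closed W" and dom: "\<And>x. \<exists>y. (x, y) \<in> W"
  obtains c where "c \<ge> 0" "\<And>x. \<exists>y. (x, y) \<in> W \<and> norm y \<le> c * norm x"
proof -
  define Z where "Z n = {x. \<exists>y. (x, y) \<in> W \<and> norm y \<le> real n}" for n :: nat
  have neg: "- x \<in> Z n" if "x \<in> Z n" for x n
  proof -
    obtain y where "(x, y) \<in> W" "norm y \<le> real n" using \<open>x \<in> Z n\<close> unfolding Z_def by auto
    then show ?thesis using subspace_neg[OF W(1), of "(x, y)"] unfolding Z_def
      by (auto intro!: exI[of _ "- y"])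
  qed
  have mid: "(1/2) *\<^sub>R (x + x') \<in> Z n" if xs: "x \<in> Z n" "x' \<in> Z n" for x x' n
  proof -
    obtain y y' where y: "(x, y) \<in> W" "norm y \<le> real n" "(x', y') \<in> W" "norm y' \<le> real n"
      using xs unfolding Z_def by blast
    have "(1/2) *\<^sub>R ((x, y) + (x', y')) \<in> W"
      using y W(1) by (intro subspace_scale subspace_add) auto
    moreover have "norm ((1/2) *\<^sub>R (y + y')) \<le> real n"
      using norm_triangle_ineq[of y y'] y by simp
    ultimately show ?thesis unfolding Z_def by auto
  qed
  have "\<exists>n. interior (closure (Z n)) \<noteq> {}"
  proof (rule ccontr)
    assume "\<not> ?thesis"
    then have int: "interior (closure (Z n)) = {}" for n by blast
    have "Met_TC.mtopology interior_of \<Union>(range (\<lambda>n. closure (Z n))) = {}"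
      by (rule Met_TC.metric_Baire_category_alt)
        (auto simp: int complete_UNIV euclidean_interior_of)
    then have "(\<Union>n. closure (Z n)) \<noteq> UNIV" by (auto simp: euclidean_interior_of)
    then obtain x where x: "\<And>n. x \<notin> closure (Z n)" by auto
    obtain y where "(x, y) \<in> W" using dom by blast
    moreover obtain n where "norm y \<le> real n" using real_arch_simple by blast
    ultimately have "x \<in> Z n" unfolding Z_def by auto
    then show False using x[of n] closure_subset by blast
  qed
  then obtain n x0 where "x0 \<in> interior (closure (Z n))" by blast
  then obtain r where r: "r > 0" "ball x0 r \<subseteq> closure (Z n)"
    by (meson mem_interior)
  have ball: "u \<in> closure (Z n)" if "norm u < r" for u
  proof -
    have "x0 + u \<in> closure (Z n)" "x0 - u \<in> closure (Z n)"
      using r(2) that by (auto simp: dist_norm)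
    then obtain p q where p: "\<And>k. p k \<in> Z n" "p \<longlonglongrightarrow> x0 + u" and q: "\<And>k. q k \<in> Z n" "q \<longlonglongrightarrow> x0 - u"
      unfolding closure_sequential by blast
    have "(\<lambda>k. (1/2) *\<^sub>R (p k + - q k)) \<longlonglongrightarrow> (1/2) *\<^sub>R (x0 + u + - (x0 - u))"
      by (intro tendsto_intros p q)
    moreover have "(1/2) *\<^sub>R (x0 + u + - (x0 - u)) = u"
      by (simp add: algebra_simps flip: scaleR_2)
    ultimately have "(\<lambda>k. (1/2) *\<^sub>R (p k + - q k)) \<longlonglongrightarrow> u" by (simp only:)
    moreover have "\<forall>k. (1/2) *\<^sub>R (p k + - q k) \<in> Z n" using mid neg p q by blast
    ultimately show ?thesis unfolding closure_sequential
      by (intro exI[of _ "\<lambda>k. (1/2) *\<^sub>R (p k + - q k)"] conjI)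
  qed
  \<comment> \<open>\<open>x\<close> is first scaled to norm \<open>r / 2\<close>, where partners of norm at most \<open>n\<close> are available\<close>
  define c where "c = 2 * real n / r"
  have c: "c \<ge> 0" unfolding c_def using r by simp
  have step: "\<exists>w\<in>W. norm (x - fst w) \<le> norm x / 2 \<and> norm (snd w) \<le> c * norm x" for x
  proof (cases "x = 0")
    case True
    then show ?thesis using subspace_0[OF W(1)] by (intro bexI[of _ 0]) auto
  next
    case False
    define s where "s = r / (2 * norm x)"
    have s: "s > 0" unfolding s_def using r False by simp
    have "norm (s *\<^sub>R x) < r" unfolding s_def using r False by simp
    from ball[OF this] obtain u where u: "u \<in> Z n" "dist u (s *\<^sub>R x) < s * norm x / 2"
      unfolding closure_approachable using s False by (metis half_gt_zero mult_pos_pos zero_less_norm_iff)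
    then obtain y where y: "(u, y) \<in> W" "norm y \<le> real n" unfolding Z_def by auto
    have "(1 / s) *\<^sub>R (u, y) \<in> W" using y W(1) by (intro subspace_scale)
    moreover have "norm (x - (1 / s) *\<^sub>R u) \<le> norm x / 2"
    proof -
      have "x - (1 / s) *\<^sub>R u = (1 / s) *\<^sub>R (s *\<^sub>R x - u)"
        using s by (simp add: algebra_simps)
      then have "norm (x - (1 / s) *\<^sub>R u) = (1 / s) * norm (s *\<^sub>R x - u)"
        using s by simp
      also have "\<dots> \<le> (1 / s) * (s * norm x / 2)"
        using u(2) s by (intro mult_left_mono) (auto simp: dist_norm norm_minus_commute)
      finally show ?thesis using s by simp
    qed
    moreover have "norm ((1 / s) *\<^sub>R y) \<le> c * norm x"
      using y(2) r False unfolding s_def c_def by (simp add: field_simps)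
    ultimately show ?thesis by (intro bexI[of _ "(1 / s) *\<^sub>R (u, y)"]) auto
  qed
  then obtain g where g: "\<And>x. g x \<in> W" "\<And>x. norm (x - fst (g x)) \<le> norm x / 2"
      "\<And>x. norm (snd (g x)) \<le> c * norm x" by metis
  have "\<exists>y. (x, y) \<in> W \<and> norm y \<le> 2 * c * norm x" for x
  proof -
    define R where "R k = ((\<lambda>x. x - fst (g x)) ^^ k) x" for k
    have R_Suc: "R (Suc k) = R k - fst (g (R k))" for k unfolding R_def by simp
    have R_le: "norm (R k) \<le> norm x * (1/2) ^ k" for k
    proof (induction k)
      case (Suc k)
      then show ?case using g(2)[of "R k"] by (simp add: R_Suc)
    qed (simp add: R_def)
    have y_le: "norm (snd (g (R k))) \<le> c * norm x * (1/2) ^ k" for k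
      using g(3)[of "R k"] mult_left_mono[OF R_le[of k] c] by (simp add: algebra_simps)
    have geo: "(\<lambda>k. c * norm x * (1/2) ^ k) sums (c * norm x * 2)"
      using geometric_sums[of "1/2::real"] by (intro sums_mult) simp
    have summ: "summable (\<lambda>k. norm (snd (g (R k))))"
      by (rule summable_comparison_test'[OF sums_summable[OF geo], of 0]) (simp add: y_le)
    define y where "y = (\<Sum>k. snd (g (R k)))"
    have "norm y \<le> (\<Sum>k. norm (snd (g (R k))))" unfolding y_def by (rule summable_norm[OF summ])
    also have "\<dots> \<le> (\<Sum>k. c * norm x * (1/2) ^ k)"
      by (rule suminf_le[OF y_le summ sums_summable[OF geo]])
    also have "\<dots> = 2 * c * norm x" using sums_unique[OF geo] by simp
    finally have norm_y: "norm y \<le> 2 * c * norm x" .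
    have fst_part: "(\<Sum>k<j. fst (g (R k))) = x - R j" for j
      by (induction j) (simp_all add: R_Suc, simp add: R_def)
    have "(\<lambda>j. norm x * (1/2) ^ j) \<longlonglongrightarrow> norm x * 0"
      by (intro tendsto_intros LIMSEQ_power_zero) simp
    then have "R \<longlonglongrightarrow> 0" using R_le by (intro Lim_null_comparison[where f = R]) auto
    then have "(\<lambda>j. x - R j) \<longlonglongrightarrow> x - 0" by (intro tendsto_intros)
    moreover have "(\<lambda>j. \<Sum>k<j. snd (g (R k))) \<longlonglongrightarrow> y"
      unfolding y_def using summable_LIMSEQ[OF summable_norm_cancel[OF summ]] .
    ultimately have "(\<lambda>j. (x - R j, \<Sum>k<j. snd (g (R k)))) \<longlonglongrightarrow> (x, y)"
      using tendsto_Pair by fastforce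
    moreover have "(x - R j, \<Sum>k<j. snd (g (R k))) \<in> W" for j
    proof -
      have "(\<Sum>k<j. g (R k)) \<in> W" using g(1) W(1) by (intro subspace_sum)
      moreover have "(\<Sum>k<j. g (R k)) = (x - R j, \<Sum>k<j. snd (g (R k)))"
        unfolding fst_part[symmetric] by (induction j) (simp_all add: zero_prod_def plus_prod_def)
      ultimately show ?thesis by simp
    qed
    ultimately have "(x, y) \<in> W" using W(2) by (meson closed_sequentially)
    with norm_y show ?thesis by blast
  qed
  then show ?thesis using that[of "2 * c"] c by (simp add: mult.assoc)
qed

section \<open>Multi-indices\<close>

abbreviation mdegree :: "('m::finite \<Rightarrow> nat) \<Rightarrow> nat"
  where "mdegree k \<equiv> \<Sum>i\<in>UNIV. k i"

definition incr :: "'m \<Rightarrow> ('m \<Rightarrow> nat) \<Rightarrow> ('m \<Rightarrow> nat)"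
  where "incr i k = k(i := Suc (k i))"

lemma incr_apply: "incr i k j = (if j = i then Suc (k i) else k j)"
  by (simp add: incr_def)

lemma inj_incr: "inj (incr i)"
  by (rule injI) (auto simp: incr_def fun_eq_iff split: if_splits)

lemma range_incr: "range (incr i) = {k. k i > 0}"
proof -
  have "k = incr i (k(i := k i - 1))" if "k i > 0" for k
    using that by (auto simp: incr_def fun_eq_iff)
  then show ?thesis by (auto simp: incr_apply)
qed

lemma mdegree_incr: "mdegree (incr i k) = Suc (mdegree k)"
proof -
  have "mdegree (incr i k) = (\<Sum>j\<in>UNIV. k j + (if j = i then 1 else 0))"
    by (rule sum.cong) (auto simp: incr_apply)
  then show ?thesis by (simp add: sum.distrib)
qed

lemma multinomial_pos: "multinomial k > 0"
  unfolding multinomial_def by (intro divide_pos_pos prod_pos) auto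

lemma multinomial_nonneg [simp]: "multinomial k \<ge> 0"
  using multinomial_pos[of k] by simp

lemma multinomial_zero [simp]: "multinomial (\<lambda>_. 0) = 1"
  by (simp add: multinomial_def)

lemma multinomial_incr: "multinomial (incr i k) * real (Suc (k i)) = multinomial k * real (Suc (mdegree k))"
proof -
  have "(\<Prod>j\<in>UNIV. fact (incr i k j)) = (\<Prod>j\<in>UNIV. fact (k j) * (if j = i then real (Suc (k i)) else 1))"
    by (rule prod.cong) (auto simp: incr_apply)
  also have "\<dots> = (\<Prod>j\<in>UNIV. fact (k j)) * real (Suc (k i))"
    by (simp add: prod.distrib)
  finally have p: "(\<Prod>j\<in>UNIV. fact (incr i k j)) = (\<Prod>j\<in>UNIV. fact (k j)) * real (Suc (k i))" .
  have "(\<Prod>j\<in>UNIV. fact (k j) :: real) \<noteq> 0" by simp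
  moreover have "s * D / (P * a) * a = D / P * s" if "P \<noteq> 0" "a > 0" for s D P a :: real
    using that by simp
  ultimately show ?thesis unfolding multinomial_def p mdegree_incr fact_Suc by simp
qed

definition homogeneous :: "nat \<Rightarrow> ('m::finite \<Rightarrow> nat) set"
  where "homogeneous n = {k. mdegree k = n}"

lemma finite_degree_less: "finite {k::'m::finite \<Rightarrow> nat. mdegree k < n}"
proof (rule finite_subset)
  show "{k::'m \<Rightarrow> nat. mdegree k < n} \<subseteq> PiE UNIV (\<lambda>_. {..n})"
  proof
    fix k :: "'m \<Rightarrow> nat" assume k: "k \<in> {k. mdegree k < n}"
    have "k i \<le> mdegree k" for i by (rule member_le_sum) auto
    with k show "k \<in> PiE UNIV (\<lambda>_. {..n})" by (auto intro: order.trans less_imp_le)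
  qed
qed (auto intro: finite_PiE)

lemma finite_homogeneous: "finite (homogeneous n)"
  by (rule finite_subset[OF _ finite_degree_less[of "Suc n"]]) (auto simp: homogeneous_def)

lemma homogeneous_0: "homogeneous 0 = {\<lambda>_. 0}"
  by (auto simp: homogeneous_def)

lemma sum_mdegree_less:
  fixes h :: "('m::finite \<Rightarrow> nat) \<Rightarrow> 'a::comm_monoid_add"
  shows "(\<Sum>k | mdegree k < n. h k) = (\<Sum>j<n. \<Sum>k\<in>homogeneous j. h k)"
proof -
  have "{k::'m \<Rightarrow> nat. mdegree k < n} = (\<Union>j\<in>{..<n}. homogeneous j)" by (auto simp: homogeneous_def)
  moreover have "(\<Sum>k\<in>(\<Union>j\<in>{..<n}. homogeneous j). h k) = (\<Sum>j<n. \<Sum>k\<in>homogeneous j. h k)"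
    by (rule sum.UNION_disjoint) (auto simp: finite_homogeneous, auto simp: homogeneous_def)
  ultimately show ?thesis by (simp only:)
qed

lemma filterlim_degree_less:
  "filterlim (\<lambda>n. {k::'m::finite \<Rightarrow> nat. mdegree k < n}) (finite_subsets_at_top UNIV) sequentially"
  unfolding filterlim_finite_subsets_at_top
proof (intro allI impI)
  fix X :: "('m \<Rightarrow> nat) set" assume X: "finite X \<and> X \<subseteq> UNIV"
  have "\<forall>\<^sub>F n in sequentially. Max (mdegree ` X) < n" by (rule eventually_gt_at_top)
  then show "\<forall>\<^sub>F n in sequentially. finite {k::'m \<Rightarrow> nat. mdegree k < n} \<and> X \<subseteq> {k. mdegree k < n} \<and> {k::'m \<Rightarrow> nat. mdegree k < n} \<subseteq> UNIV"
  proof eventually_elim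
    case (elim n)
    have "mdegree k < n" if "k \<in> X" for k
      using elim X that by (meson Max_ge finite_imageI imageI le_less_trans)
    then show ?case by (auto simp: finite_degree_less)
  qed
qed

lemma has_sum_imp_homogeneous_sums:
  assumes "(h has_sum s) (UNIV :: ('m::finite \<Rightarrow> nat) set)"
  shows "(\<lambda>j. \<Sum>k\<in>homogeneous j. h k) sums s"
  using filterlim_compose[OF assms[unfolded has_sum_def] filterlim_degree_less]
  by (simp add: sums_def sum_mdegree_less)

lemma summable_on_if_homogeneous_bounded:
  fixes h :: "('m::finite \<Rightarrow> nat) \<Rightarrow> real"
  assumes h: "\<And>k. h k \<ge> 0" and B: "\<And>n. (\<Sum>j<n. \<Sum>k\<in>homogeneous j. h k) \<le> B"
  shows "h summable_on UNIV" "infsum h UNIV \<le> B"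
proof -
  have F: "sum h F \<le> B" if F: "finite F" for F
  proof -
    obtain n where "F \<subseteq> {k. mdegree k < n}"
    proof
      show "F \<subseteq> {k. mdegree k < Suc (Max (mdegree ` F))}" using F by (auto intro!: le_imp_less_Suc)
    qed
    then have "sum h F \<le> (\<Sum>k | mdegree k < n. h k)"
      by (intro sum_mono2) (auto simp: finite_degree_less h)
    with B[of n] show ?thesis by (simp add: sum_mdegree_less)
  qed
  show 1: "h summable_on UNIV"
    by (rule nonneg_bounded_partial_sums_imp_summable_on[where C = B])
      (auto simp: h F intro!: eventually_finite_subsets_at_top_weakI)
  show "infsum h UNIV \<le> B" by (rule infsum_le_finite_sums[OF 1]) (auto simp: F)
qed

text \<open>
  The multinomial recursion \<open>\<gamma>\<^sub>k = \<gamma>\<^bsub>k - e\<^sub>1\<^esub> + \<dots> + \<gamma>\<^bsub>k - e\<^sub>m\<^esub>\<close>, summed against \<open>G\<close>. Since \<open>\<gamma>\<^sub>k\<close>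
  counts the words with letter multiplicities \<open>k\<close>, both sides run over the words of length
  \<open>n + 1\<close>, the right-hand side sorted by first letter.
\<close>

lemma sum_homogeneous_Suc:
  fixes G :: "('m::finite \<Rightarrow> nat) \<Rightarrow> real"
  shows "(\<Sum>k\<in>homogeneous (Suc n). multinomial k * G k) =
    (\<Sum>i\<in>UNIV. \<Sum>k\<in>homogeneous n. multinomial k * G (incr i k))"
proof -
  have "(\<Sum>k\<in>homogeneous n. multinomial k * G (incr i k)) =
      (\<Sum>k\<in>homogeneous (Suc n). multinomial k * (real (k i) / real (Suc n)) * G k)" for i
  proof -
    have im: "incr i ` homogeneous n = {k \<in> homogeneous (Suc n). k i > 0}" (is "?A = ?B")
    proof
      show "?A \<subseteq> ?B" by (auto simp: homogeneous_def mdegree_incr) (simp add: incr_apply)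
      show "?B \<subseteq> ?A"
      proof
        fix k assume k: "k \<in> ?B"
        then have "k \<in> range (incr i)" by (simp add: range_incr)
        then obtain l where "k = incr i l" by blast
        with k show "k \<in> ?A" by (auto simp: homogeneous_def mdegree_incr)
      qed
    qed
    have "(\<Sum>k\<in>homogeneous n. multinomial k * G (incr i k)) =
        (\<Sum>k\<in>homogeneous n. multinomial (incr i k) * (real (incr i k i) / real (Suc n)) * G (incr i k))"
    proof (rule sum.cong[OF refl])
      fix k :: "'m \<Rightarrow> nat" assume "k \<in> homogeneous n"
      then have "multinomial (incr i k) * real (Suc (k i)) = multinomial k * real (Suc n)"
        using multinomial_incr[of i k] by (simp add: homogeneous_def)
      then have "multinomial (incr i k) * (real (incr i k i) / real (Suc n)) = multinomial k"
        by (simp add: incr_apply field_simps)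
      then show "multinomial k * G (incr i k) =
          multinomial (incr i k) * (real (incr i k i) / real (Suc n)) * G (incr i k)" by simp
    qed
    also have "\<dots> = (\<Sum>k\<in>incr i ` homogeneous n. multinomial k * (real (k i) / real (Suc n)) * G k)"
      by (subst sum.reindex) (auto intro: inj_on_subset[OF inj_incr])
    also have "\<dots> = (\<Sum>k\<in>homogeneous (Suc n). multinomial k * (real (k i) / real (Suc n)) * G k)"
      unfolding im by (rule sum.mono_neutral_left) (auto simp: finite_homogeneous)
    finally show ?thesis .
  qed
  then have "(\<Sum>i\<in>UNIV. \<Sum>k\<in>homogeneous n. multinomial k * G (incr i k)) =
      (\<Sum>i\<in>UNIV. \<Sum>k\<in>homogeneous (Suc n). multinomial k * (real (k i) / real (Suc n)) * G k)"
    by simp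
  also have "\<dots> = (\<Sum>k\<in>homogeneous (Suc n). \<Sum>i\<in>UNIV. multinomial k * (real (k i) / real (Suc n)) * G k)"
    by (rule sum.swap)
  also have "\<dots> = (\<Sum>k\<in>homogeneous (Suc n). multinomial k * G k)"
  proof (rule sum.cong[OF refl])
    fix k :: "'m \<Rightarrow> nat" assume "k \<in> homogeneous (Suc n)"
    then have d: "(\<Sum>i\<in>UNIV. real (k i)) = real (Suc n)"
      unfolding homogeneous_def by (simp flip: of_nat_sum)
    have "(\<Sum>i\<in>UNIV. multinomial k * (real (k i) / real (Suc n)) * G k) =
        multinomial k * ((\<Sum>i\<in>UNIV. real (k i)) / real (Suc n)) * G k"
      by (simp add: sum_distrib_left sum_distrib_right sum_divide_distrib)
    then show "(\<Sum>i\<in>UNIV. multinomial k * (real (k i) / real (Suc n)) * G k) = multinomial k * G k"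
      unfolding d by simp
  qed
  finally show ?thesis by simp
qed

section \<open>The Drury-Arveson space\<close>

text \<open>
  An element with coefficients \<open>f\<^sub>k\<close> stands for the function with Taylor coefficients
  \<open>\<gamma>\<^sub>k f\<^sub>k\<close>. In this normalization the squared norm is the sum of \<open>\<gamma>\<^sub>k |f\<^sub>k|\<^sup>2\<close>, and the adjoint of
  multiplication by \<open>z\<^sub>i\<close> is the plain translation of indices \<open>f\<^sub>k \<mapsto> f\<^bsub>k + e\<^sub>i\<^esub>\<close>.
\<close>

typedef (overloaded) ('m, 'e) da =
  "{f :: ('m::finite \<Rightarrow> nat) \<Rightarrow> 'e::complex_hilbert_space.
      (\<lambda>k. multinomial k * (norm (f k))\<^sup>2) summable_on UNIV}"
  morphisms coeff Abs_da
  by (rule exI[of _ "\<lambda>_. 0"]) simp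

setup_lifting type_definition_da

lemma coeff_summable: "(\<lambda>k. multinomial k * (norm (coeff x k))\<^sup>2) summable_on UNIV"
  using coeff[of x] by simp

lemma da_eqI: "(\<And>k. coeff x k = coeff y k) \<Longrightarrow> x = y"
  using coeff_inject by blast

lemma norm_sum_sq: "(norm (x + y))\<^sup>2 \<le> 2 * (norm x)\<^sup>2 + 2 * (norm (y::'a::real_normed_vector))\<^sup>2"
proof -
  have "(norm (x + y))\<^sup>2 \<le> (norm x + norm y)\<^sup>2"
    by (intro power_mono norm_triangle_ineq) simp
  also have "\<dots> \<le> 2 * (norm x)\<^sup>2 + 2 * (norm y)\<^sup>2"
    using sum_squares_bound[of "norm x" "norm y"] by (simp add: power2_sum)
  finally show ?thesis .
qed

instantiation da :: (finite, complex_hilbert_space) ab_group_add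
begin

lift_definition zero_da :: "('a, 'b) da" is "\<lambda>_. 0" by simp

lift_definition uminus_da :: "('a, 'b) da \<Rightarrow> ('a, 'b) da" is "\<lambda>f k. - f k" by simp

lemma da_add_closed:
  fixes f g :: "('a \<Rightarrow> nat) \<Rightarrow> 'b"
  assumes "(\<lambda>k. multinomial k * (norm (f k))\<^sup>2) summable_on UNIV"
    "(\<lambda>k. multinomial k * (norm (g k))\<^sup>2) summable_on UNIV"
  shows "(\<lambda>k. multinomial k * (norm (f k + g k))\<^sup>2) summable_on UNIV"
proof (rule summable_on_comparison_test)
  show "(\<lambda>k. 2 * (multinomial k * (norm (f k))\<^sup>2) + 2 * (multinomial k * (norm (g k))\<^sup>2)) summable_on UNIV"
    by (intro summable_on_add summable_on_cmult_right assms)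
  show "multinomial k * (norm (f k + g k))\<^sup>2 \<le>
      2 * (multinomial k * (norm (f k))\<^sup>2) + 2 * (multinomial k * (norm (g k))\<^sup>2)" for k
    using mult_left_mono[OF norm_sum_sq[of "f k" "g k"] multinomial_nonneg[of k]]
    by (simp add: algebra_simps)
qed auto

lift_definition plus_da :: "('a, 'b) da \<Rightarrow> ('a, 'b) da \<Rightarrow> ('a, 'b) da" is "\<lambda>f g k. f k + g k"
  by (rule da_add_closed)

lift_definition minus_da :: "('a, 'b) da \<Rightarrow> ('a, 'b) da \<Rightarrow> ('a, 'b) da" is "\<lambda>f g k. f k - g k"
  by (simp only: diff_conv_add_uminus, rule da_add_closed, simp_all)

instance
  by standard (transfer, simp add: algebra_simps fun_eq_iff)+

end

lemma da_scale_closed: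
  assumes "(\<lambda>k. multinomial k * (norm (f k))\<^sup>2) summable_on UNIV"
    and "\<And>k. norm (g k) \<le> c * norm (f k)" 
  shows "(\<lambda>k. multinomial k * (norm (g k))\<^sup>2) summable_on UNIV"
proof (rule summable_on_comparison_test)
  show "(\<lambda>k. c\<^sup>2 * (multinomial k * (norm (f k))\<^sup>2)) summable_on UNIV"
    by (intro summable_on_cmult_right assms)
  show "multinomial k * (norm (g k))\<^sup>2 \<le> c\<^sup>2 * (multinomial k * (norm (f k))\<^sup>2)" for k
    using mult_left_mono[OF power_mono[OF assms(2)[of k] norm_ge_zero, of 2] multinomial_nonneg[of k]]
    by (simp add: power_mult_distrib algebra_simps)
qed auto

instantiation da :: (finite, complex_hilbert_space) real_vector
begin

lift_definition scaleR_da :: "real \<Rightarrow> ('a, 'b) da \<Rightarrow> ('a, 'b) da" is "\<lambda>r f k. r *\<^sub>R f k"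
  subgoal for r f by (rule da_scale_closed[of f _ "\<bar>r\<bar>"]) auto
  done

instance
  by standard (transfer, simp add: algebra_simps fun_eq_iff)+

end

lemma coeff_simps [simp]:
  "coeff 0 k = 0" "coeff (- x) k = - coeff x k" "coeff (x + y) k = coeff x k + coeff y k"
  "coeff (x - y) k = coeff x k - coeff y k" "coeff (r *\<^sub>R x) k = r *\<^sub>R coeff x k"
  by (transfer, simp)+

lemma coeff_sum: "coeff (\<Sum>i\<in>A. f i) k = (\<Sum>i\<in>A. coeff (f i) k)"
  by (induction A rule: infinite_finite_induct) simp_all

lemma da_inner_summable:
  "(\<lambda>k. multinomial k * inner (coeff x k) (coeff y k)) summable_on UNIV"
proof -
  have "(\<lambda>k. norm (multinomial k * inner (coeff x k) (coeff y k))) summable_on UNIV"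
  proof (rule Infinite_Sum.abs_summable_on_comparison_test')
    show "(\<lambda>k. multinomial k * (norm (coeff x k))\<^sup>2 + multinomial k * (norm (coeff y k))\<^sup>2) summable_on UNIV"
      by (intro summable_on_add coeff_summable)
    fix k
    have "\<bar>inner (coeff x k) (coeff y k)\<bar> \<le> (norm (coeff x k))\<^sup>2 + (norm (coeff y k))\<^sup>2"
      using Cauchy_Schwarz_ineq2[of "coeff x k" "coeff y k"]
        sum_squares_bound[of "norm (coeff x k)" "norm (coeff y k)"]
        mult_nonneg_nonneg[OF norm_ge_zero[of "coeff x k"] norm_ge_zero[of "coeff y k"]]
      by linarith
    from mult_left_mono[OF this multinomial_nonneg[of k]]
    show "norm (multinomial k * inner (coeff x k) (coeff y k)) \<le>
        multinomial k * (norm (coeff x k))\<^sup>2 + multinomial k * (norm (coeff y k))\<^sup>2"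
      by (simp only: distrib_left real_norm_def abs_mult abs_of_nonneg[OF multinomial_nonneg])
  qed
  then show ?thesis by (rule Infinite_Sum.abs_summable_summable)
qed

instantiation da :: (finite, complex_hilbert_space) real_inner
begin

definition inner_da :: "('a, 'b) da \<Rightarrow> ('a, 'b) da \<Rightarrow> real"
  where "inner_da x y = (\<Sum>\<^sub>\<infinity>k. multinomial k * inner (coeff x k) (coeff y k))"

definition norm_da :: "('a, 'b) da \<Rightarrow> real" where "norm_da x = sqrt (inner x x)"

definition sgn_da :: "('a, 'b) da \<Rightarrow> ('a, 'b) da" where "sgn_da x = inverse (norm x) *\<^sub>R x"

definition dist_da :: "('a, 'b) da \<Rightarrow> ('a, 'b) da \<Rightarrow> real" where "dist_da x y = norm (x - y)"

definition uniformity_da :: "(('a, 'b) da \<times> ('a, 'b) da) filter"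
  where "uniformity_da = (INF e\<in>{0 <..}. principal {(x, y). dist x y < e})"

definition open_da :: "('a, 'b) da set \<Rightarrow> bool"
  where "open_da U \<longleftrightarrow> (\<forall>x\<in>U. eventually (\<lambda>(x', y). x' = x \<longrightarrow> y \<in> U) uniformity)"

instance
proof
  fix x y z :: "('a, 'b) da" and r :: real
  show "inner x y = inner y x" by (simp add: inner_da_def inner_commute)
  show "inner (x + y) z = inner x z + inner y z"
    by (simp add: inner_da_def inner_add_left distrib_left infsum_add da_inner_summable)
  show "inner (r *\<^sub>R x) y = r * inner x y"
    by (simp add: inner_da_def mult.left_commute infsum_cmult_right')
  show "0 \<le> inner x x" by (simp add: inner_da_def infsum_nonneg)
  show "(inner x x = 0) = (x = 0)"
  proof
    assume "inner x x = 0"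
    then have "multinomial k * inner (coeff x k) (coeff x k) = 0" for k
      unfolding inner_da_def
      using nonneg_infsum_le_0D[OF _ da_inner_summable[of x x], of k] by auto
    then have "coeff x k = 0" for k using multinomial_pos[of k] by (metis inner_eq_zero_iff less_irrefl mult_eq_0_iff)
    then show "x = 0" by (intro da_eqI) simp
  qed (simp add: inner_da_def)
qed (auto simp: norm_da_def sgn_da_def dist_da_def uniformity_da_def open_da_def)

end

lemma has_sum_inner_da:
  "((\<lambda>k. multinomial k * inner (coeff x k) (coeff y k)) has_sum inner x y) UNIV"
  unfolding inner_da_def by (rule has_sum_infsum[OF da_inner_summable])

lemma has_sum_norm_da:
  "((\<lambda>k. multinomial k * (norm (coeff x k))\<^sup>2) has_sum (norm x)\<^sup>2) UNIV"
  using has_sum_inner_da[of x x] by (simp add: power2_norm_eq_inner)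

lemma norm_coeff_le: "multinomial k * (norm (coeff x k))\<^sup>2 \<le> (norm x)\<^sup>2"
  using finite_sum_le_has_sum[OF has_sum_norm_da[of x], of "{k}"] by simp

lemma coeff_0_le: "norm (coeff x (\<lambda>_. 0)) \<le> norm x"
  using norm_coeff_le[of "\<lambda>_. 0" x] by (simp add: power2_le_iff_abs_le)

lemma da_bounded_exists:
  fixes f :: "('m::finite \<Rightarrow> nat) \<Rightarrow> 'e::complex_hilbert_space"
  assumes "\<And>F. finite F \<Longrightarrow> (\<Sum>k\<in>F. multinomial k * (norm (f k))\<^sup>2) \<le> B\<^sup>2" "B \<ge> 0"
  obtains x where "coeff x = f" "norm x \<le> B"
proof -
  have "(\<lambda>k. multinomial k * (norm (f k))\<^sup>2) summable_on UNIV"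
    by (rule nonneg_bounded_partial_sums_imp_summable_on[where C = "B\<^sup>2"])
      (auto simp: assms(1) intro!: eventually_finite_subsets_at_top_weakI)
  then have f: "coeff (Abs_da f) = f" by (intro Abs_da_inverse) simp
  have "(norm (Abs_da f))\<^sup>2 \<le> B\<^sup>2"
    by (rule has_sum_le_finite_sums[OF has_sum_norm_da]) (simp add: f assms)
  then show ?thesis using that f assms(2) by (simp add: power2_le_iff_abs_le)
qed

instance da :: (finite, complex_hilbert_space) complete_space
proof
  fix X :: "nat \<Rightarrow> ('a, 'b) da" assume X: "Cauchy X"
  have "Cauchy (\<lambda>n. coeff (X n) k)" for k
  proof (rule metric_CauchyI)
    fix e :: real assume e: "e > 0"
    define e' where "e' = e * sqrt (multinomial k)"
    have e': "e' > 0" unfolding e'_def using e multinomial_pos[of k] by simp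
    obtain M where M: "\<And>m n. m \<ge> M \<Longrightarrow> n \<ge> M \<Longrightarrow> dist (X m) (X n) < e'"
      using metric_CauchyD[OF X e'] by blast
    have "dist (coeff (X m) k) (coeff (X n) k) < e" if "m \<ge> M" "n \<ge> M" for m n
    proof -
      have "multinomial k * (norm (coeff (X m - X n) k))\<^sup>2 \<le> (norm (X m - X n))\<^sup>2"
        by (rule norm_coeff_le)
      also have "\<dots> < e'\<^sup>2" using M[OF that] e' by (intro power_strict_mono) (auto simp: dist_norm)
      also have "\<dots> = multinomial k * e\<^sup>2" unfolding e'_def by (simp add: power_mult_distrib)
      finally have "(norm (coeff (X m - X n) k))\<^sup>2 < e\<^sup>2" using multinomial_pos[of k] by simp
      then show ?thesis using e by (simp add: dist_norm power2_less_imp_less)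
    qed
    then show "\<exists>M. \<forall>m\<ge>M. \<forall>n\<ge>M. dist (coeff (X m) k) (coeff (X n) k) < e" by blast
  qed
  then have "\<exists>l. (\<lambda>n. coeff (X n) k) \<longlonglongrightarrow> l" for k
    using Cauchy_convergent convergent_def by blast
  then obtain f where f: "\<And>k. (\<lambda>n. coeff (X n) k) \<longlonglongrightarrow> f k" by metis
  \<comment> \<open>the coefficientwise limit \<open>f\<close> may a priori lie outside the space, hence the detour over \<open>y\<close>\<close>
  have close: "\<exists>y. coeff y = (\<lambda>k. coeff (X n) k - f k) \<and> norm y \<le> e"
    if "e > 0" and M: "\<And>m. m \<ge> M \<Longrightarrow> dist (X n) (X m) < e" for n e M
  proof -
    have "(\<Sum>k\<in>F. multinomial k * (norm (coeff (X n) k - f k))\<^sup>2) \<le> e\<^sup>2" if F: "finite F" for F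
    proof (rule LIMSEQ_le_const2)
      show "(\<lambda>m. \<Sum>k\<in>F. multinomial k * (norm (coeff (X n) k - coeff (X m) k))\<^sup>2)
          \<longlonglongrightarrow> (\<Sum>k\<in>F. multinomial k * (norm (coeff (X n) k - f k))\<^sup>2)"
        by (intro tendsto_intros f)
      have "(\<Sum>k\<in>F. multinomial k * (norm (coeff (X n) k - coeff (X m) k))\<^sup>2) \<le> e\<^sup>2" if "m \<ge> M" for m
      proof -
        have "(\<Sum>k\<in>F. multinomial k * (norm (coeff (X n - X m) k))\<^sup>2) \<le> (norm (X n - X m))\<^sup>2"
          by (rule finite_sum_le_has_sum[OF has_sum_norm_da]) (auto simp: F)
        also have "\<dots> \<le> e\<^sup>2"
          using M[OF that] by (intro power_mono) (auto simp: dist_norm)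
        finally show ?thesis by simp
      qed
      then show "\<exists>N. \<forall>m\<ge>N. (\<Sum>k\<in>F. multinomial k * (norm (coeff (X n) k - coeff (X m) k))\<^sup>2) \<le> e\<^sup>2"
        by blast
    qed
    then obtain y where "coeff y = (\<lambda>k. coeff (X n) k - f k)" "norm y \<le> e"
      using da_bounded_exists[of "\<lambda>k. coeff (X n) k - f k" e] \<open>e > 0\<close> by auto
    then show ?thesis by blast
  qed
  obtain M1 where "\<And>m n. m \<ge> M1 \<Longrightarrow> n \<ge> M1 \<Longrightarrow> dist (X m) (X n) < 1"
    using metric_CauchyD[OF X, of 1] by auto
  then obtain y1 where y1: "coeff y1 = (\<lambda>k. coeff (X M1) k - f k)" using close[of 1 M1 M1] by auto
  define L where "L = X M1 - y1"
  have L: "coeff L k = f k" for k unfolding L_def by (simp add: y1)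
  have "X \<longlonglongrightarrow> L"
  proof (rule metric_LIMSEQ_I)
    fix e :: real assume e: "e > 0"
    obtain M where M: "\<And>m n. m \<ge> M \<Longrightarrow> n \<ge> M \<Longrightarrow> dist (X m) (X n) < e / 2"
      using metric_CauchyD[OF X, of "e / 2"] e by auto
    have "dist (X n) L < e" if "n \<ge> M" for n
    proof -
      obtain y where y: "coeff y = (\<lambda>k. coeff (X n) k - f k)" "norm y \<le> e / 2"
        using close[of "e / 2" M n] M[OF \<open>n \<ge> M\<close>] e by auto
      have "X n - L = y" by (rule da_eqI) (simp add: y L)
      then show ?thesis using y e by (simp add: dist_norm)
    qed
    then show "\<exists>no. \<forall>n\<ge>no. dist (X n) L < e" by blast
  qed
  then show "convergent X" by (auto simp: convergent_def)
qed

instance da :: (finite, complex_hilbert_space) banach ..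

instantiation da :: (finite, complex_hilbert_space) complex_normed_vector
begin

lift_definition scaleC_da :: "complex \<Rightarrow> ('a, 'b) da \<Rightarrow> ('a, 'b) da" is "\<lambda>c f k. c *\<^sub>C f k"
  subgoal for c f by (rule da_scale_closed[of f _ "cmod c"]) (auto simp: norm_scaleC)
  done

lemma coeff_scaleC [simp]: "coeff (c *\<^sub>C x) k = c *\<^sub>C coeff x k"
  by transfer simp

instance
proof
  fix c d :: complex and r :: real and x y :: "('a, 'b) da"
  show "c *\<^sub>C (x + y) = c *\<^sub>C x + c *\<^sub>C y" by (rule da_eqI) (simp add: scaleC_add_right)
  show "(c + d) *\<^sub>C x = c *\<^sub>C x + d *\<^sub>C x" by (rule da_eqI) (simp add: scaleC_add_left)
  show "c *\<^sub>C d *\<^sub>C x = (c * d) *\<^sub>C x" by (rule da_eqI) (simp add: scaleC_scaleC)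
  show "complex_of_real r *\<^sub>C x = r *\<^sub>R x" by (rule da_eqI) (simp add: scaleC_of_real)
  have "((\<lambda>k. multinomial k * (norm (coeff (c *\<^sub>C x) k))\<^sup>2) has_sum ((cmod c)\<^sup>2 * (norm x)\<^sup>2)) UNIV"
    using has_sum_cmult_right[OF has_sum_norm_da[of x], of "(cmod c)\<^sup>2"]
    by (simp add: norm_scaleC power_mult_distrib mult.left_commute)
  with has_sum_norm_da[of "c *\<^sub>C x"] have "(norm (c *\<^sub>C x))\<^sup>2 = (cmod c * norm x)\<^sup>2"
    unfolding power_mult_distrib by (rule has_sum_unique)
  then show "norm (c *\<^sub>C x) = cmod c * norm x" by simp
qed

end

section \<open>Shifts\<close>

text \<open>
  Casts of degrees are kept folded, since the weights \<open>k\<^sub>i / |k|\<close> are rewritten as a whole.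
\<close>

declare of_nat_sum [simp del]

lemma multiindex_induct [case_names zero incr]:
  fixes k :: "'m::finite \<Rightarrow> nat"
  assumes "P (\<lambda>_. 0)" "\<And>i k. P k \<Longrightarrow> P (incr i k)"
  shows "P k"
proof (induction "mdegree k" arbitrary: k)
  case 0
  then have "k = (\<lambda>_. 0)" by auto
  then show ?case using assms(1) by simp
next
  case (Suc n)
  then have "\<exists>i. k i > 0" by (metis gr0I nat.distinct(1) sum.neutral)
  then obtain i where "k \<in> range (incr i)" by (auto simp: range_incr)
  then obtain l where l: "k = incr i l" by blast
  then have "n = mdegree l" using Suc(2) by (simp add: mdegree_incr)
  then show ?case using Suc(1) assms(2) l by blast
qed

lemma multinomial_le_incr: "multinomial k \<le> multinomial (incr i k)"
proof -
  have "real (Suc (k i)) \<le> real (Suc (mdegree k))" by (auto intro: member_le_sum)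
  then have "multinomial (incr i k) * real (Suc (k i)) \<le> multinomial (incr i k) * real (Suc (mdegree k))"
    by (intro mult_left_mono) auto
  then have "multinomial k * real (Suc (mdegree k)) \<le> multinomial (incr i k) * real (Suc (mdegree k))"
    by (simp only: multinomial_incr)
  then show ?thesis by (rule mult_right_le_imp_le) simp
qed

text \<open>
  The adjoint of multiplication by \<open>z\<^sub>i\<close>.
\<close>

definition bshift :: "'m \<Rightarrow> ('m::finite, 'e::complex_hilbert_space) da \<Rightarrow> ('m, 'e) da"
  where "bshift i x = Abs_da (\<lambda>k. coeff x (incr i k))"

lemma bshift_aux:
  "coeff (bshift i x) = (\<lambda>k. coeff x (incr i k)) \<and> norm (bshift i x) \<le> norm x"
proof -
  obtain y where y: "coeff y = (\<lambda>k. coeff x (incr i k))" "norm y \<le> norm x"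
  proof (rule da_bounded_exists)
    fix F :: "('a \<Rightarrow> nat) set" assume F: "finite F"
    have "(\<Sum>k\<in>F. multinomial k * (norm (coeff x (incr i k)))\<^sup>2) \<le>
        (\<Sum>k\<in>F. multinomial (incr i k) * (norm (coeff x (incr i k)))\<^sup>2)"
      by (intro sum_mono mult_right_mono multinomial_le_incr) simp
    also have "\<dots> = (\<Sum>k\<in>incr i ` F. multinomial k * (norm (coeff x k))\<^sup>2)"
      by (subst sum.reindex) (auto intro: inj_on_subset[OF inj_incr])
    also have "\<dots> \<le> (norm x)\<^sup>2"
      by (rule finite_sum_le_has_sum[OF has_sum_norm_da]) (auto simp: F)
    finally show "(\<Sum>k\<in>F. multinomial k * (norm (coeff x (incr i k)))\<^sup>2) \<le> (norm x)\<^sup>2" .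
  qed auto
  then have "bshift i x = y" unfolding bshift_def by (metis coeff_inverse)
  with y show ?thesis by simp
qed

lemma coeff_bshift [simp]: "coeff (bshift i x) k = coeff x (incr i k)"
  using bshift_aux[of i x] by simp

definition decr :: "'m \<Rightarrow> ('m \<Rightarrow> nat) \<Rightarrow> ('m \<Rightarrow> nat)"
  where "decr i k = k(i := k i - 1)"

text \<open>
  Multiplication by \<open>z\<^sub>i\<close>. The factor \<open>k\<^sub>i / |k|\<close> is the quotient of the multinomial
  coefficients of \<open>k - e\<^sub>i\<close> and \<open>k\<close>; it vanishes for \<open>k\<^sub>i = 0\<close>, where \<open>decr\<close> truncates.
\<close>

definition fshift :: "'m \<Rightarrow> ('m::finite, 'e::complex_hilbert_space) da \<Rightarrow> ('m, 'e) da"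
  where "fshift i x = Abs_da (\<lambda>k. (real (k i) / real (mdegree k)) *\<^sub>R coeff x (decr i k))"

lemma incr_decr: "k i > 0 \<Longrightarrow> incr i (decr i k) = k"
  by (auto simp: incr_def decr_def fun_eq_iff)

lemma decr_incr: "decr i (incr i k) = k"
  by (auto simp: incr_def decr_def fun_eq_iff)

lemma multinomial_decr: "k i > 0 \<Longrightarrow> multinomial k * (real (k i) / real (mdegree k)) = multinomial (decr i k)"
proof -
  assume k: "k i > 0"
  have "Suc (decr i k i) = k i" "Suc (mdegree (decr i k)) = mdegree k"
    using k mdegree_incr[of i "decr i k"] by (simp_all add: incr_decr) (simp add: decr_def)
  then have eq: "multinomial k * real (k i) = multinomial (decr i k) * real (mdegree k)"
    using multinomial_incr[of i "decr i k"] k by (simp only: incr_decr)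
  have "k i \<le> mdegree k" by (rule member_le_sum) auto
  then have "mdegree k > 0" using k by linarith
  then have "real (mdegree k) > 0" by (simp only: of_nat_0_less_iff)
  then have "a * (b / real (mdegree k)) = d" if "a * b = d * real (mdegree k)" for a b d
    using that by (metis less_irrefl nonzero_eq_divide_eq times_divide_eq_right)
  with eq show ?thesis by blast
qed

lemma fshift_aux:
  "coeff (fshift i x) = (\<lambda>k. (real (k i) / real (mdegree k)) *\<^sub>R coeff x (decr i k)) \<and>
    norm (fshift i x) \<le> norm x"
proof -
  obtain y where y: "coeff y = (\<lambda>k. (real (k i) / real (mdegree k)) *\<^sub>R coeff x (decr i k))" "norm y \<le> norm x"
  proof (rule da_bounded_exists)
    fix F :: "('a \<Rightarrow> nat) set" assume F: "finite F"
    have "(\<Sum>k\<in>F. multinomial k * (norm ((real (k i) / real (mdegree k)) *\<^sub>R coeff x (decr i k)))\<^sup>2) =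
        (\<Sum>k\<in>{k\<in>F. k i > 0}. multinomial k * (norm ((real (k i) / real (mdegree k)) *\<^sub>R coeff x (decr i k)))\<^sup>2)"
      by (rule sum.mono_neutral_right) (auto simp: F)
    also have "\<dots> \<le> (\<Sum>k\<in>{k\<in>F. k i > 0}. multinomial (decr i k) * (norm (coeff x (decr i k)))\<^sup>2)"
    proof (rule sum_mono)
      fix k assume k: "k \<in> {k\<in>F. k i > 0}"
      define r where "r = real (k i) / real (mdegree k)"
      have "k i \<le> mdegree k" by (simp add: member_le_sum)
      then have r: "0 \<le> r" "r \<le> 1" unfolding r_def by (auto simp: divide_le_eq)
      have "multinomial k * (norm (r *\<^sub>R coeff x (decr i k)))\<^sup>2 =
          r * ((multinomial k * r) * (norm (coeff x (decr i k)))\<^sup>2)"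
        using r by (simp add: power_mult_distrib power2_eq_square)
      also have "\<dots> \<le> 1 * ((multinomial k * r) * (norm (coeff x (decr i k)))\<^sup>2)"
        using r by (intro mult_right_mono) auto
      also have "multinomial k * r = multinomial (decr i k)"
        unfolding r_def using k by (intro multinomial_decr) simp
      finally show "multinomial k * (norm ((real (k i) / real (mdegree k)) *\<^sub>R coeff x (decr i k)))\<^sup>2
          \<le> multinomial (decr i k) * (norm (coeff x (decr i k)))\<^sup>2"
        unfolding r_def by (simp only: mult_1)
    qed
    also have "\<dots> = (\<Sum>k\<in>decr i ` {k\<in>F. k i > 0}. multinomial k * (norm (coeff x k))\<^sup>2)"
    proof (subst sum.reindex)
      show "inj_on (decr i) {k\<in>F. k i > 0}"
        by (rule inj_on_inverseI[where g = "incr i"]) (simp add: incr_decr)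
    qed simp
    also have "\<dots> \<le> (norm x)\<^sup>2"
      by (rule finite_sum_le_has_sum[OF has_sum_norm_da]) (auto simp: F)
    finally show "(\<Sum>k\<in>F. multinomial k * (norm ((real (k i) / real (mdegree k)) *\<^sub>R coeff x (decr i k)))\<^sup>2) \<le> (norm x)\<^sup>2" .
  qed auto
  then have "fshift i x = y" unfolding fshift_def by (metis coeff_inverse)
  with y show ?thesis by simp
qed

lemma coeff_fshift: "coeff (fshift i x) k = (real (k i) / real (mdegree k)) *\<^sub>R coeff x (decr i k)"
  using fshift_aux[of i x] by simp

definition const_da :: "'e \<Rightarrow> ('m::finite, 'e::complex_hilbert_space) da"
  where "const_da e = Abs_da (\<lambda>k. if k = (\<lambda>_. 0) then e else 0)"

lemma coeff_const_da: "coeff (const_da e) k = (if k = (\<lambda>_. 0) then e else 0)"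
proof -
  have "(\<lambda>k. multinomial k * (norm (if k = (\<lambda>_. 0) then e else 0))\<^sup>2) summable_on UNIV"
    by (rule finite_nonzero_values_imp_summable_on) (rule finite_subset[of _ "{\<lambda>_. 0}"], auto)
  then show ?thesis unfolding const_da_def by (subst Abs_da_inverse) auto
qed

lemma inner_const_da: "inner (const_da e) y = inner e (coeff y (\<lambda>_. 0))"
proof -
  have "((\<lambda>k. multinomial k * inner (coeff (const_da e) k) (coeff y k)) has_sum inner e (coeff y (\<lambda>_. 0))) UNIV"
    by (rule has_sum_finite_neutralI[where B = "{\<lambda>_. 0}"]) (auto simp: coeff_const_da)
  then show ?thesis using has_sum_inner_da has_sum_unique by blast
qed

lemma norm_const_da: "norm (const_da e) = norm e"
  by (simp add: norm_eq_sqrt_inner inner_const_da coeff_const_da)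

lemma inner_fshift: "inner (fshift i x) y = inner x (bshift i y)"
proof -
  let ?h = "\<lambda>k. multinomial k * inner (coeff (fshift i x) k) (coeff y k)"
  have "(?h has_sum inner (fshift i x) y) UNIV" by (rule has_sum_inner_da)
  then have "(?h has_sum inner (fshift i x) y) (range (incr i))"
    by (subst has_sum_cong_neutral[where T = UNIV]) (auto simp: range_incr coeff_fshift)
  then have "(?h \<circ> incr i has_sum inner (fshift i x) y) UNIV"
    by (subst (asm) has_sum_reindex) (auto intro: inj_incr)
  moreover have "?h \<circ> incr i = (\<lambda>k. multinomial k * inner (coeff x k) (coeff (bshift i y) k))"
  proof
    fix k
    have "multinomial (incr i k) * (real (incr i k i) / real (mdegree (incr i k))) = multinomial k"
      by (subst multinomial_decr) (auto simp: decr_incr incr_apply[of i k i])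
    then show "(?h \<circ> incr i) k = multinomial k * inner (coeff x k) (coeff (bshift i y) k)"
      by (simp only: comp_apply coeff_fshift coeff_bshift decr_incr inner_scaleR_left flip: mult.assoc)
  qed
  ultimately show ?thesis using has_sum_inner_da[of x "bshift i y"] has_sum_unique by metis
qed

lemma bounded_linear_bshift: "bounded_linear (bshift i)"
  by (rule bounded_linear_intro[where K = 1])
    (use bshift_aux in \<open>auto intro!: da_eqI\<close>)

lemma bounded_linear_fshift: "bounded_linear (fshift i)"
proof (rule bounded_linear_intro[where K = 1])
  show "norm (fshift i x) \<le> norm x * 1" for x :: "('a, 'b) da" using fshift_aux[of i x] by simp
qed (auto intro!: da_eqI simp: coeff_fshift scaleR_add_right)

lemma bounded_linear_const_da: "bounded_linear const_da"
  by (rule bounded_linear_intro[where K = 1])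
    (auto intro!: da_eqI simp: coeff_const_da norm_const_da)

lemma bounded_linear_coeff_0: "bounded_linear (\<lambda>x. coeff x (\<lambda>_. 0))"
  by (rule bounded_linear_intro[where K = 1]) (auto simp: coeff_0_le)

lemma scaleR_scaleC_commute: "r *\<^sub>R c *\<^sub>C x = c *\<^sub>C r *\<^sub>R (x::'a::complex_normed_vector)"
  by (simp add: scaleC_scaleC mult.commute flip: scaleC_of_real)

lemma fshift_scaleC: "fshift i (c *\<^sub>C x) = c *\<^sub>C fshift i x"
  by (rule da_eqI) (simp add: coeff_fshift scaleR_scaleC_commute)

lemma scaleC_zero_right [simp]: "c *\<^sub>C (0::'a::complex_normed_vector) = 0"
  using norm_scaleC[of c "0::'a"] by simp

lemma const_da_scaleC: "const_da (c *\<^sub>C e) = c *\<^sub>C const_da e"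
  by (rule da_eqI) (simp add: coeff_const_da)

text \<open>
  At index \<open>k\<close> the \<open>i\<close>-th summand on the right contributes \<open>k\<^sub>i / |k|\<close> times the coefficient of \<open>x\<close>,
  and these weights add up to 1 unless \<open>k = 0\<close>.
\<close>

lemma da_decomposition: "x = const_da (coeff x (\<lambda>_. 0)) + (\<Sum>i\<in>UNIV. fshift i (bshift i x))"
proof (rule da_eqI)
  fix k :: "'a \<Rightarrow> nat"
  have *: "coeff (fshift i (bshift i x)) k = (real (k i) / real (mdegree k)) *\<^sub>R coeff x k" for i
    by (cases "k i = 0") (simp_all add: coeff_fshift incr_decr)
  have "coeff (\<Sum>i\<in>UNIV. fshift i (bshift i x)) k = (real (mdegree k) / real (mdegree k)) *\<^sub>R coeff x k"
    by (simp only: coeff_sum * of_nat_sum sum_divide_distrib flip: scaleR_sum_left)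
  moreover have "k = (\<lambda>_. 0)" if "mdegree k = 0" using that by auto
  ultimately show "coeff x k = coeff (const_da (coeff x (\<lambda>_. 0)) + (\<Sum>i\<in>UNIV. fshift i (bshift i x))) k"
    by (cases "mdegree k = 0") (auto simp: coeff_const_da)
qed

lemma inner_decomposition:
  "inner x y = inner (coeff x (\<lambda>_. 0)) (coeff y (\<lambda>_. 0)) + (\<Sum>i\<in>UNIV. inner (bshift i x) (bshift i y))"
  by (subst da_decomposition[of x]) (simp add: inner_add_left inner_const_da inner_sum_left inner_fshift)

lemma norm_decomposition:
  "(norm x)\<^sup>2 = (norm (coeff x (\<lambda>_. 0)))\<^sup>2 + (\<Sum>i\<in>UNIV. (norm (bshift i x))\<^sup>2)"
  using inner_decomposition[of x x] by (simp add: power2_norm_eq_inner)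

definition mshift :: "('m \<Rightarrow> nat) \<Rightarrow> ('m::finite, 'e::complex_hilbert_space) da \<Rightarrow> ('m, 'e) da"
  where "mshift k x = Abs_da (\<lambda>j. coeff x (\<lambda>i. j i + k i))"

lemma coeff_mshift: "coeff (mshift k x) j = coeff x (\<lambda>i. j i + k i)"
proof -
  have "\<exists>y. coeff y = (\<lambda>j. coeff x (\<lambda>i. j i + k i))"
  proof (induction k rule: multiindex_induct)
    case zero
    then show ?case by (auto intro: exI[of _ x])
  next
    case (incr l k)
    then obtain y where y: "coeff y = (\<lambda>j. coeff x (\<lambda>i. j i + k i))" by blast
    have "(\<lambda>i. incr l j i + k i) = (\<lambda>i. j i + incr l k i)" for j by (auto simp: incr_def fun_eq_iff)
    then show ?case by (intro exI[of _ "bshift l y"]) (auto simp: y)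
  qed
  then show ?thesis unfolding mshift_def by (metis coeff_inverse)
qed

lemma mshift_0: "mshift (\<lambda>_. 0) x = x"
  by (rule da_eqI) (simp add: coeff_mshift)

lemma mshift_incr: "mshift (incr i k) x = mshift k (bshift i x)"
proof (rule da_eqI)
  fix j
  have "(\<lambda>l. j l + incr i k l) = incr i (\<lambda>l. j l + k l)" by (auto simp: incr_def fun_eq_iff)
  then show "coeff (mshift (incr i k) x) j = coeff (mshift k (bshift i x)) j"
    by (simp add: coeff_mshift)
qed

lemma bshift_mshift: "bshift i (mshift k x) = mshift k (bshift i x)"
proof (rule da_eqI)
  fix j
  have "(\<lambda>l. incr i j l + k l) = incr i (\<lambda>l. j l + k l)" by (auto simp: incr_def fun_eq_iff)
  then show "coeff (bshift i (mshift k x)) j = coeff (mshift k (bshift i x)) j"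
    by (simp add: coeff_mshift)
qed

lemma mshift_add: "mshift k (x + y) = mshift k x + mshift k y"
  by (rule da_eqI) (simp add: coeff_mshift)

lemma mshift_scaleR: "mshift k (r *\<^sub>R x) = r *\<^sub>R mshift k x"
  by (rule da_eqI) (simp add: coeff_mshift)

text \<open>
  The sum of \<open>\<phi> (L\<^sub>w y)\<close> over all words \<open>w\<close> of length \<open>n\<close>. As the backward shifts commute, the value
  depends only on the letter multiplicities \<open>k\<close> of \<open>w\<close>, which are shared by \<open>multinomial k\<close> words.
\<close>

definition level_sum ::
    "(('m::finite, 'e::complex_hilbert_space) da \<Rightarrow> real) \<Rightarrow> nat \<Rightarrow> ('m, 'e) da \<Rightarrow> real"
  where "level_sum \<phi> n y = (\<Sum>k\<in>homogeneous n. multinomial k * \<phi> (mshift k y))"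

lemma level_sum_0: "level_sum \<phi> 0 y = \<phi> y"
  by (simp add: level_sum_def homogeneous_0 mshift_0)

lemma level_sum_Suc: "level_sum \<phi> (Suc n) y = (\<Sum>i\<in>UNIV. level_sum \<phi> n (bshift i y))"
  unfolding level_sum_def by (simp add: sum_homogeneous_Suc mshift_incr)

lemma level_sum_Suc': "level_sum \<phi> (Suc n) y = level_sum (\<lambda>x. \<Sum>i\<in>UNIV. \<phi> (bshift i x)) n y"
  unfolding level_sum_def sum_homogeneous_Suc mshift_incr bshift_mshift
  by (subst sum.swap) (simp add: sum_distrib_left)

lemma level_sum_mono: "(\<And>x. \<phi> x \<le> \<phi>' x) \<Longrightarrow> level_sum \<phi> n y \<le> level_sum \<phi>' n y"
  unfolding level_sum_def by (intro sum_mono mult_left_mono) auto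

lemma level_sum_cmult: "level_sum (\<lambda>x. c * \<phi> x) n y = c * level_sum \<phi> n y"
  unfolding level_sum_def by (simp add: sum_distrib_left mult.left_commute)

lemma level_sum_add: "level_sum (\<lambda>x. \<phi> x + \<phi>' x) n y = level_sum \<phi> n y + level_sum \<phi>' n y"
  unfolding level_sum_def by (simp add: sum.distrib distrib_left)

text \<open>
  Read \<open>Q\<close> as stored energy, \<open>\<delta>\<close> as output and \<open>\<epsilon>\<close> as input: a one-step dissipation inequality
  bounds the stored energy together with the output along all words of length below \<open>n\<close>.
\<close>

lemma energy_telescope:
  assumes "\<And>y. Q y + \<delta> y \<le> \<epsilon> y + (\<Sum>i\<in>UNIV. Q (bshift i y))"
  shows "Q y + (\<Sum>j<n. level_sum \<delta> j y) \<le> (\<Sum>j<n. level_sum \<epsilon> j y) + level_sum Q n y"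
proof (induction n)
  case (Suc n)
  have "level_sum Q n y + level_sum \<delta> n y \<le> level_sum \<epsilon> n y + level_sum Q (Suc n) y"
    using level_sum_mono[of "\<lambda>y. Q y + \<delta> y" "\<lambda>y. \<epsilon> y + (\<Sum>i\<in>UNIV. Q (bshift i y))" n y] assms
    by (simp add: level_sum_add level_sum_Suc')
  with Suc show ?case by simp
qed (simp add: level_sum_0)

lemma norm_level_sum:
  "(norm y)\<^sup>2 = (\<Sum>j<n. level_sum (\<lambda>x. (norm (coeff x (\<lambda>_. 0)))\<^sup>2) j y) + level_sum (\<lambda>x. (norm x)\<^sup>2) n y"
proof (induction n)
  case (Suc n)
  have "level_sum (\<lambda>x. (norm x)\<^sup>2) n y =
      level_sum (\<lambda>x. (norm (coeff x (\<lambda>_. 0)))\<^sup>2) n y + level_sum (\<lambda>x. (norm x)\<^sup>2) (Suc n) y"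
    by (subst norm_decomposition) (simp add: level_sum_add level_sum_Suc')
  with Suc show ?case by simp
qed (simp add: level_sum_0)

text \<open>
  The row of multiplication operators is pure: by the telescoped energy identity, what is left
  after \<open>n\<close> backward shifts is a tail of the series for \<open>|y|\<^sup>2\<close>.
\<close>

lemma level_sum_norm_tendsto_0: "(\<lambda>n. level_sum (\<lambda>x. (norm x)\<^sup>2) n y) \<longlonglongrightarrow> 0"
proof -
  have "(\<lambda>j. \<Sum>k\<in>homogeneous j. multinomial k * (norm (coeff y k))\<^sup>2) sums (norm y)\<^sup>2"
    by (rule has_sum_imp_homogeneous_sums[OF has_sum_norm_da])
  then have "(\<lambda>n. \<Sum>j<n. level_sum (\<lambda>x. (norm (coeff x (\<lambda>_. 0)))\<^sup>2) j y) \<longlonglongrightarrow> (norm y)\<^sup>2"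
    unfolding sums_def level_sum_def by (simp add: coeff_mshift)
  then have "(\<lambda>n. (norm y)\<^sup>2 - (\<Sum>j<n. level_sum (\<lambda>x. (norm (coeff x (\<lambda>_. 0)))\<^sup>2) j y)) \<longlonglongrightarrow> (norm y)\<^sup>2 - (norm y)\<^sup>2"
    by (intro tendsto_intros)
  moreover have "(norm y)\<^sup>2 - (\<Sum>j<n. level_sum (\<lambda>x. (norm (coeff x (\<lambda>_. 0)))\<^sup>2) j y) = level_sum (\<lambda>x. (norm x)\<^sup>2) n y" for n
    using norm_level_sum[of y n] by simp
  ultimately show ?thesis by simp
qed

section \<open>Extension of intertwining maps\<close>

lemma bounded_bilinear_add:
  assumes "bounded_bilinear f" "bounded_bilinear g"
  shows "bounded_bilinear (\<lambda>x y. f x y + g x y)"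
proof -
  interpret f: bounded_bilinear f by fact
  interpret g: bounded_bilinear g by fact
  obtain K where K: "\<And>x y. norm (f x y) \<le> norm x * norm y * K" using f.bounded by blast
  obtain L where L: "\<And>x y. norm (g x y) \<le> norm x * norm y * L" using g.bounded by blast
  show ?thesis
  proof
    show "\<exists>K. \<forall>a b. norm (f a b + g a b) \<le> norm a * norm b * K"
    proof (intro exI allI)
      fix a b
      show "norm (f a b + g a b) \<le> norm a * norm b * (K + L)"
        using norm_triangle_ineq[of "f a b" "g a b"] K[of a b] L[of a b] by (simp add: distrib_left)
    qed
  qed (simp_all add: f.add_left f.add_right f.scaleR_left f.scaleR_right
      g.add_left g.add_right g.scaleR_left g.scaleR_right scaleR_add_right)
qed

lemma bounded_bilinear_cmult:
  assumes "bounded_bilinear (f :: 'a::real_normed_vector \<Rightarrow> 'b::real_normed_vector \<Rightarrow> real)"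
  shows "bounded_bilinear (\<lambda>x y. c * f x y)"
proof -
  interpret f: bounded_bilinear f by fact
  obtain K where K: "\<And>x y. norm (f x y) \<le> norm x * norm y * K" using f.bounded by blast
  show ?thesis
  proof
    show "\<exists>K. \<forall>a b. norm (c * f a b) \<le> norm a * norm b * K"
    proof (intro exI allI)
      fix a b
      show "norm (c * f a b) \<le> norm a * norm b * (\<bar>c\<bar> * K)"
        using mult_left_mono[OF K[of a b], of "\<bar>c\<bar>"] by (simp add: abs_mult mult_ac)
    qed
  qed (simp_all add: f.add_left f.add_right f.scaleR_left f.scaleR_right algebra_simps)
qed

text \<open>
  A map \<open>D\<close> that intertwines the backward shifts is determined by its constant coefficient:
  \<open>(D y)\<^sub>k\<close> is the constant coefficient of \<open>D\<close> applied to the \<open>k\<close>-fold shift of \<open>y\<close>. So a functional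
  extending \<open>d0 = (D0 \<cdot>)\<^sub>0\<close> is wanted whose outputs along all words in the shifts, applied to \<open>y\<close>, are square summable.

  With a constant \<open>c\<close> that makes \<open>q x x = c |x|\<^sup>2 - |D0 x|\<^sup>2\<close> coercive, the energy identities for \<open>x\<close>
  and \<open>D0 x\<close> give \<open>q x x + |d0 x|\<^sup>2 = c |x\<^sub>0|\<^sup>2 + \<Sum>\<^sub>i q (L\<^sub>i x) (L\<^sub>i x)\<close> on \<open>N\<close>. Hence the input
  \<open>(x\<^sub>0, (L\<^sub>i x)\<^sub>i)\<close> determines the pair \<open>(d0 x, x)\<close> isometrically. Composed with the orthogonal
  projection onto such inputs this becomes a contraction \<open>(g, u) \<mapsto> (d0 (R g u), R g u)\<close> defined for
  arbitrary \<open>g\<close> and \<open>u\<close>. Because \<open>q\<close> is coercive, \<open>N\<close> itself serves as the state space, so no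
  defect operator or completion has to be formed.

  The states \<open>\<Gamma> y\<close> of the resulting linear system solve \<open>\<Gamma> y = R y\<^sub>0 (\<Gamma> (L\<^sub>i y))\<^sub>i\<close>; they are limits of
  the iterates \<open>gam\<close> started at 0, which converge because the backward shifts are pure. On \<open>N\<close>
  the state is \<open>y\<close> itself, so that \<open>d0 (\<Gamma> y)\<close> extends \<open>d0\<close>, and \<open>energy_telescope\<close> bounds the outputs.
\<close>

theorem intertwining_extension:
  fixes N :: "('m::finite, 'g::complex_hilbert_space) da set"
    and D0 :: "('m, 'g) da \<Rightarrow> ('m, 'f::complex_hilbert_space) da"
  assumes N: "subspace N" "closed N" and inv: "\<And>i v. v \<in> N \<Longrightarrow> bshift i v \<in> N"
    and D0: "bounded_linear D0" and comm: "\<And>i v. v \<in> N \<Longrightarrow> D0 (bshift i v) = bshift i (D0 v)"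
  obtains D where "bounded_linear D" "\<And>i y. D (bshift i y) = bshift i (D y)" "\<And>v. v \<in> N \<Longrightarrow> D v = D0 v"
proof -
  interpret D0: bounded_linear D0 by fact
  obtain K where K: "\<And>x. norm (D0 x) \<le> norm x * K" using D0.bounded by blast
  \<comment> \<open>the extra 1 makes \<open>q\<close> coercive and not merely nonnegative\<close>
  define c where "c = K\<^sup>2 + 1"
  have c: "c \<ge> 1" "c \<ge> 0" unfolding c_def by auto
  define q where "q x y = c * inner x y + (- 1) * inner (D0 x) (D0 y)" for x y
  define d0 where "d0 x = coeff (D0 x) (\<lambda>_. 0)" for x
  define b where "b x y = q x y + inner (d0 x) (d0 y)" for x y
  have d0: "bounded_linear d0"
    unfolding d0_def using bounded_linear_compose[OF bounded_linear_coeff_0 D0] .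
  interpret d0: bounded_linear d0 by (fact d0)
  have q_bil: "bounded_bilinear q" unfolding q_def
    by (intro bounded_bilinear_add bounded_bilinear_cmult bounded_bilinear_inner
        bounded_bilinear.comp[OF bounded_bilinear_inner D0 D0])
  interpret q: bounded_bilinear q by (fact q_bil)
  have b_bil: "bounded_bilinear b" unfolding b_def
    by (intro bounded_bilinear_add q_bil bounded_bilinear.comp[OF bounded_bilinear_inner d0 d0])
  interpret b: bounded_bilinear b by (fact b_bil)
  have q_sym: "q x y = q y x" for x y unfolding q_def by (simp add: inner_commute)
  have b_sym: "b x y = b y x" for x y unfolding b_def by (simp add: q_sym inner_commute)
  have q_ge: "(norm x)\<^sup>2 \<le> q x x" for x
  proof -
    have "(norm (D0 x))\<^sup>2 \<le> (norm x * K)\<^sup>2" using K[of x] by (intro power_mono) auto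
    then show ?thesis unfolding q_def c_def power2_norm_eq_inner[symmetric]
      by (simp add: power_mult_distrib algebra_simps)
  qed
  have q_nonneg: "0 \<le> q x x" for x using q_ge[of x] by (meson order.trans zero_le_power2)
  have q_le: "q x x \<le> c * (norm x)\<^sup>2" for x
    unfolding q_def by (simp add: power2_norm_eq_inner)
  have b_ge: "(norm x)\<^sup>2 \<le> b x x" for x
    using q_ge[of x] unfolding b_def by (simp add: add_increasing2)
  have bal: "b x v = c * inner (coeff x (\<lambda>_. 0)) (coeff v (\<lambda>_. 0)) + (\<Sum>i\<in>UNIV. q (bshift i x) (bshift i v))"
    if "x \<in> N" "v \<in> N" for x v
  proof -
    have "(\<Sum>i\<in>UNIV. q (bshift i x) (bshift i v)) =
        c * (\<Sum>i\<in>UNIV. inner (bshift i x) (bshift i v)) -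
        (\<Sum>i\<in>UNIV. inner (bshift i (D0 x)) (bshift i (D0 v)))"
      unfolding q_def using that by (simp add: comm sum_subtractf sum_distrib_left)
    then show ?thesis
      unfolding b_def q_def d0_def inner_decomposition[of x v] inner_decomposition[of "D0 x" "D0 v"]
      by (simp add: algebra_simps)
  qed
  \<comment> \<open>\<open>R g u\<close> is the \<open>x \<in> N\<close> whose input is the orthogonal projection of \<open>(g, u)\<close> onto the inputs from \<open>N\<close>\<close>
  define rhs where "rhs g u v = c * inner g (coeff v (\<lambda>_. 0)) + (\<Sum>i\<in>UNIV. q (u i) (bshift i v))"
    for g and u :: "'m \<Rightarrow> ('m, 'g) da" and v
  have "\<exists>x\<in>N. \<forall>v\<in>N. b x v = rhs g u v" for g u
  proof (rule quadratic_form_riesz[where e = 1])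
    show "bounded_linear (rhs g u)" unfolding rhs_def
      by (intro bounded_linear_add bounded_linear_const_mult bounded_linear_sum
          bounded_linear_compose[OF bounded_linear_inner_right bounded_linear_coeff_0]
          bounded_linear_compose[OF q.bounded_linear_right bounded_linear_bshift])
  qed (use N b_bil b_sym b_ge in auto)
  then obtain R where R: "\<And>g u. R g u \<in> N" "\<And>g u v. v \<in> N \<Longrightarrow> b (R g u) v = rhs g u v"
    by metis
  have R_eqI: "R g u = x" if x: "x \<in> N" "\<And>v. v \<in> N \<Longrightarrow> b x v = rhs g u v" for g u x
  proof -
    have mem: "R g u - x \<in> N" using R(1) x(1) N(1) by (simp add: subspace_diff)
    have "b (R g u - x) (R g u - x) = 0" using R(2)[OF mem] x(2)[OF mem] by (simp add: b.diff_left)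
    then have "(norm (R g u - x))\<^sup>2 \<le> 0" using b_ge[of "R g u - x"] by simp
    then show ?thesis by simp
  qed
  have R_add: "R (g + g') (\<lambda>i. u i + u' i) = R g u + R g' u'" for g g' u u'
    by (rule R_eqI) (use N(1) R in \<open>auto simp: subspace_add b.add_left rhs_def inner_add_left
        q.add_left sum.distrib distrib_left\<close>)
  have R_scale: "R (r *\<^sub>R g) (\<lambda>i. r *\<^sub>R u i) = r *\<^sub>R R g u" for g u r
    by (rule R_eqI) (use N(1) R in \<open>auto simp: subspace_scale b.scaleR_left rhs_def
        q.scaleR_left sum_distrib_left algebra_simps\<close>)
  have R_diff: "R g u - R g' u' = R (g - g') (\<lambda>i. u i - u' i)" for g g' u u'
    by (rule R_eqI[symmetric]) (use N(1) R in \<open>auto simp: subspace_diff b.diff_left rhs_def inner_diff_left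
        q.diff_left sum_subtractf right_diff_distrib\<close>)
  have R_self: "R (coeff x (\<lambda>_. 0)) (\<lambda>i. bshift i x) = x" if "x \<in> N" for x
    by (rule R_eqI) (use that bal in \<open>auto simp: rhs_def\<close>)
  have q_amgm: "2 * q x y \<le> q x x + q y y" for x y
    using q_nonneg[of "x - y"] by (simp add: q.diff_left q.diff_right q_sym[of y x])
  \<comment> \<open>the projection is contractive\<close>
  have R_energy: "b (R g u) (R g u) \<le> c * (norm g)\<^sup>2 + (\<Sum>i\<in>UNIV. q (u i) (u i))" for g u
  proof -
    let ?x = "R g u"
    have "2 * inner g (coeff ?x (\<lambda>_. 0)) \<le> (norm g)\<^sup>2 + (norm (coeff ?x (\<lambda>_. 0)))\<^sup>2"
      using inner_ge_zero[of "g - coeff ?x (\<lambda>_. 0)"]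
      by (simp add: power2_norm_eq_inner inner_diff_left inner_diff_right inner_commute)
    from mult_left_mono[OF this c(2)]
    have "2 * (c * inner g (coeff ?x (\<lambda>_. 0))) \<le> c * (norm g)\<^sup>2 + c * (norm (coeff ?x (\<lambda>_. 0)))\<^sup>2"
      by (simp add: algebra_simps)
    moreover have "2 * (\<Sum>i\<in>UNIV. q (u i) (bshift i ?x)) \<le>
        (\<Sum>i\<in>UNIV. q (u i) (u i)) + (\<Sum>i\<in>UNIV. q (bshift i ?x) (bshift i ?x))"
      unfolding sum_distrib_left sum.distrib[symmetric] by (intro sum_mono q_amgm)
    moreover have "b ?x ?x = rhs g u ?x" using R by blast
    ultimately show ?thesis using bal[OF R(1) R(1), of g u g u]
      unfolding rhs_def by (simp add: power2_norm_eq_inner)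
  qed
  have qR: "q (R 0 u) (R 0 u) \<le> (\<Sum>i\<in>UNIV. q (u i) (u i))" for u
  proof -
    have "q (R 0 u) (R 0 u) \<le> b (R 0 u) (R 0 u)" unfolding b_def by simp
    also have "\<dots> \<le> (\<Sum>i\<in>UNIV. q (u i) (u i))" using R_energy[of 0 u] by simp
    finally show ?thesis .
  qed
  define gam where "gam = rec_nat (\<lambda>y. 0) (\<lambda>_ G y. R (coeff y (\<lambda>_. 0)) (\<lambda>i. G (bshift i y)))"
  have gam_0: "gam 0 y = 0" for y unfolding gam_def by simp
  have gam_Suc: "gam (Suc n) y = R (coeff y (\<lambda>_. 0)) (\<lambda>i. gam n (bshift i y))" for n y
    unfolding gam_def by simp
  have gam_add: "gam n (x + y) = gam n x + gam n y" for n x y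
    by (induction n arbitrary: x y)
      (simp_all add: gam_0 gam_Suc R_add linear_add[OF bounded_linear.linear[OF bounded_linear_bshift]])
  have gam_scale: "gam n (r *\<^sub>R x) = r *\<^sub>R gam n x" for n x r
    by (induction n arbitrary: x)
      (simp_all add: gam_0 gam_Suc R_scale linear_scale[OF bounded_linear.linear[OF bounded_linear_bshift]])
  have gam_N: "gam n y \<in> N" for n y
    by (cases n) (simp_all add: gam_0 gam_Suc R subspace_0[OF N(1)])
  have gam_energy: "b (gam (Suc n) y) (gam (Suc n) y) \<le>
      c * (norm (coeff y (\<lambda>_. 0)))\<^sup>2 + (\<Sum>i\<in>UNIV. q (gam n (bshift i y)) (gam n (bshift i y)))" for n y
    unfolding gam_Suc by (rule R_energy)
  have gam_bound: "q (gam n y) (gam n y) \<le> c * (norm y)\<^sup>2" for n y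
  proof (induction n arbitrary: y)
    case 0
    then show ?case using c by (simp add: gam_0 q.zero_left)
  next
    case (Suc n)
    have "q (gam (Suc n) y) (gam (Suc n) y) \<le> b (gam (Suc n) y) (gam (Suc n) y)"
      unfolding b_def by simp
    also have "\<dots> \<le> c * (norm (coeff y (\<lambda>_. 0)))\<^sup>2 + (\<Sum>i\<in>UNIV. c * (norm (bshift i y))\<^sup>2)"
      by (intro order.trans[OF gam_energy] add_left_mono sum_mono Suc)
    also have "\<dots> = c * (norm y)\<^sup>2"
      unfolding norm_decomposition[of y] by (simp add: distrib_left sum_distrib_left)
    finally show ?case .
  qed
  have gam_cauchy: "q (gam (n + p) y - gam n y) (gam (n + p) y - gam n y) \<le> c * level_sum (\<lambda>x. (norm x)\<^sup>2) n y" for n p y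
  proof (induction n arbitrary: y)
    case 0
    then show ?case using gam_bound[of p y] by (simp add: gam_0 level_sum_0)
  next
    case (Suc n)
    have "gam (Suc n + p) y - gam (Suc n) y = R 0 (\<lambda>i. gam (n + p) (bshift i y) - gam n (bshift i y))"
      by (simp add: gam_Suc R_diff)
    then have "q (gam (Suc n + p) y - gam (Suc n) y) (gam (Suc n + p) y - gam (Suc n) y) \<le>
        (\<Sum>i\<in>UNIV. q (gam (n + p) (bshift i y) - gam n (bshift i y)) (gam (n + p) (bshift i y) - gam n (bshift i y)))"
      by (simp only: qR)
    also have "\<dots> \<le> (\<Sum>i\<in>UNIV. c * level_sum (\<lambda>x. (norm x)\<^sup>2) n (bshift i y))"
      by (intro sum_mono Suc)
    finally show ?case by (simp add: level_sum_Suc sum_distrib_left)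
  qed
  have gam_N_fix: "q (y - gam n y) (y - gam n y) \<le> c * level_sum (\<lambda>x. (norm x)\<^sup>2) n y" if "y \<in> N" for n y
    using that
  proof (induction n arbitrary: y)
    case 0
    then show ?case using q_le[of y] by (simp add: gam_0 level_sum_0)
  next
    case (Suc n)
    have "y - gam (Suc n) y = R (coeff y (\<lambda>_. 0)) (\<lambda>i. bshift i y) - gam (Suc n) y"
      by (simp add: R_self[OF Suc.prems])
    also have "\<dots> = R 0 (\<lambda>i. bshift i y - gam n (bshift i y))"
      by (simp add: gam_Suc R_diff)
    finally have "q (y - gam (Suc n) y) (y - gam (Suc n) y) \<le>
        (\<Sum>i\<in>UNIV. q (bshift i y - gam n (bshift i y)) (bshift i y - gam n (bshift i y)))"
      by (simp only: qR)
    also have "\<dots> \<le> (\<Sum>i\<in>UNIV. c * level_sum (\<lambda>x. (norm x)\<^sup>2) n (bshift i y))"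
      by (intro sum_mono Suc.IH inv Suc.prems)
    finally show ?case by (simp add: level_sum_Suc sum_distrib_left)
  qed
  have lim0: "(\<lambda>n. c * level_sum (\<lambda>x. (norm x)\<^sup>2) n y) \<longlonglongrightarrow> 0" for y :: "('m, 'g) da"
    using tendsto_mult[OF tendsto_const[of c] level_sum_norm_tendsto_0[of y]] by simp
  have "Cauchy (\<lambda>n. gam n y)" for y
  proof (rule metric_CauchyI)
    fix e :: real assume e: "e > 0"
    obtain M where M: "\<And>n. n \<ge> M \<Longrightarrow> norm (c * level_sum (\<lambda>x. (norm x)\<^sup>2) n y) < (e / 2)\<^sup>2"
      using LIMSEQ_D[OF lim0, of "(e / 2)\<^sup>2" y] e by auto
    have *: "dist (gam n y) (gam M y) < e / 2" if "n \<ge> M" for n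
    proof -
      have "(norm (gam n y - gam M y))\<^sup>2 < (e / 2)\<^sup>2"
        using q_ge[of "gam n y - gam M y"] gam_cauchy[of M "n - M" y] M[of M] that by simp
      from power2_less_imp_less[OF this] e show ?thesis by (simp add: dist_norm)
    qed
    have "dist (gam m y) (gam n y) < e" if "m \<ge> M" "n \<ge> M" for m n
      using dist_triangle_half_l[OF *[OF that(1)] *[OF that(2)]] .
    then show "\<exists>M. \<forall>m\<ge>M. \<forall>n\<ge>M. dist (gam m y) (gam n y) < e" by blast
  qed
  then have "\<exists>l. (\<lambda>n. gam n y) \<longlonglongrightarrow> l" for y using Cauchy_convergent convergent_def by blast
  then obtain \<Gamma> where \<Gamma>: "\<And>y. (\<lambda>n. gam n y) \<longlonglongrightarrow> \<Gamma> y" by metis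
  have \<Gamma>_add: "\<Gamma> (x + y) = \<Gamma> x + \<Gamma> y" for x y
    using LIMSEQ_unique[OF \<Gamma>[of "x + y"]] tendsto_add[OF \<Gamma>[of x] \<Gamma>[of y]] by (simp add: gam_add)
  have \<Gamma>_scale: "\<Gamma> (r *\<^sub>R x) = r *\<^sub>R \<Gamma> x" for r x
    using LIMSEQ_unique[OF \<Gamma>[of "r *\<^sub>R x"]] tendsto_scaleR[OF tendsto_const \<Gamma>[of x]] by (simp add: gam_scale)
  have \<Gamma>_fix: "\<Gamma> y = y" if "y \<in> N" for y
  proof -
    have "(\<lambda>n. q (y - gam n y) (y - gam n y)) \<longlonglongrightarrow> 0"
      by (rule tendsto_sandwich[OF _ _ tendsto_const lim0[of y]])
        (use q_nonneg gam_N_fix[OF that] in auto)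
    moreover have "(\<lambda>n. q (y - gam n y) (y - gam n y)) \<longlonglongrightarrow> q (y - \<Gamma> y) (y - \<Gamma> y)"
      by (intro q.tendsto tendsto_intros \<Gamma>)
    ultimately have "q (y - \<Gamma> y) (y - \<Gamma> y) = 0" using LIMSEQ_unique by blast
    then have "(norm (y - \<Gamma> y))\<^sup>2 \<le> 0" using q_ge by metis
    then show ?thesis by simp
  qed
  have \<Gamma>_energy: "q (\<Gamma> y) (\<Gamma> y) + (norm (d0 (\<Gamma> y)))\<^sup>2 \<le>
      c * (norm (coeff y (\<lambda>_. 0)))\<^sup>2 + (\<Sum>i\<in>UNIV. q (\<Gamma> (bshift i y)) (\<Gamma> (bshift i y)))" for y
  proof -
    have "b (\<Gamma> y) (\<Gamma> y) \<le> c * (norm (coeff y (\<lambda>_. 0)))\<^sup>2 + (\<Sum>i\<in>UNIV. q (\<Gamma> (bshift i y)) (\<Gamma> (bshift i y)))"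
    proof (rule LIMSEQ_le)
      show "(\<lambda>n. b (gam (Suc n) y) (gam (Suc n) y)) \<longlonglongrightarrow> b (\<Gamma> y) (\<Gamma> y)"
        by (intro b.tendsto LIMSEQ_Suc \<Gamma>)
      show "(\<lambda>n. c * (norm (coeff y (\<lambda>_. 0)))\<^sup>2 + (\<Sum>i\<in>UNIV. q (gam n (bshift i y)) (gam n (bshift i y)))) \<longlonglongrightarrow>
          c * (norm (coeff y (\<lambda>_. 0)))\<^sup>2 + (\<Sum>i\<in>UNIV. q (\<Gamma> (bshift i y)) (\<Gamma> (bshift i y)))"
        by (intro tendsto_intros q.tendsto \<Gamma>)
    qed (use gam_energy in auto)
    then show ?thesis unfolding b_def by (simp add: power2_norm_eq_inner)
  qed
  have \<Gamma>_bound: "q (\<Gamma> y) (\<Gamma> y) \<le> c * (norm y)\<^sup>2" for y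
    by (rule LIMSEQ_le_const2[OF q.tendsto[OF \<Gamma> \<Gamma>]]) (use gam_bound in auto)
  \<comment> \<open>the output energy of the system\<close>
  define \<delta> where "\<delta> y = (norm (d0 (\<Gamma> y)))\<^sup>2" for y
  have \<delta>_nonneg: "\<delta> y \<ge> 0" for y unfolding \<delta>_def by simp
  have \<delta>_sum: "(\<Sum>j<n. level_sum \<delta> j y) \<le> c * (norm y)\<^sup>2" for n y
  proof -
    have "q (\<Gamma> y) (\<Gamma> y) + (\<Sum>j<n. level_sum \<delta> j y) \<le>
        (\<Sum>j<n. level_sum (\<lambda>y. c * (norm (coeff y (\<lambda>_. 0)))\<^sup>2) j y) + level_sum (\<lambda>y. q (\<Gamma> y) (\<Gamma> y)) n y"
      by (rule energy_telescope) (use \<Gamma>_energy in \<open>simp add: \<delta>_def\<close>)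
    also have "\<dots> \<le> (\<Sum>j<n. level_sum (\<lambda>y. c * (norm (coeff y (\<lambda>_. 0)))\<^sup>2) j y) + level_sum (\<lambda>y. c * (norm y)\<^sup>2) n y"
      by (intro add_left_mono level_sum_mono \<Gamma>_bound)
    also have "\<dots> = c * (norm y)\<^sup>2"
      unfolding norm_level_sum[of y n] by (simp add: level_sum_cmult sum_distrib_left distrib_left)
    finally show ?thesis using q_nonneg[of "\<Gamma> y"] by linarith
  qed
  have "\<exists>z. coeff z = (\<lambda>k. d0 (\<Gamma> (mshift k y))) \<and> norm z \<le> sqrt c * norm y" for y
  proof -
    define h where "h k = multinomial k * \<delta> (mshift k y)" for k
    have "h k \<ge> 0" for k using \<delta>_nonneg by (simp add: h_def)
    moreover have "(\<Sum>j<n. \<Sum>k\<in>homogeneous j. h k) \<le> c * (norm y)\<^sup>2" for n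
      using \<delta>_sum[where n = n and y = y] by (simp add: h_def level_sum_def)
    ultimately have "h summable_on UNIV" "infsum h UNIV \<le> c * (norm y)\<^sup>2"
      by (rule summable_on_if_homogeneous_bounded)+
    then have "sum h F \<le> c * (norm y)\<^sup>2" if "finite F" for F
      using finite_sum_le_infsum[of h UNIV F] that \<delta>_nonneg by (force simp: h_def)
    then obtain z where "coeff z = (\<lambda>k. d0 (\<Gamma> (mshift k y)))" "norm z \<le> sqrt c * norm y"
      using da_bounded_exists[of "\<lambda>k. d0 (\<Gamma> (mshift k y))" "sqrt c * norm y"] c
      by (auto simp: h_def \<delta>_def power_mult_distrib)
    then show ?thesis by blast
  qed
  then obtain D where D: "\<And>y. coeff (D y) = (\<lambda>k. d0 (\<Gamma> (mshift k y)))" "\<And>y. norm (D y) \<le> sqrt c * norm y"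
    by metis
  show ?thesis
  proof
    show "bounded_linear D"
      by (rule bounded_linear_intro[where K = "sqrt c"])
        (auto intro!: da_eqI simp: D mult.commute mshift_add mshift_scaleR \<Gamma>_add \<Gamma>_scale d0.add d0.scaleR)
    show "D (bshift i y) = bshift i (D y)" for i y
      by (rule da_eqI) (simp add: D mshift_incr)
    fix v assume v: "v \<in> N"
    have "mshift k v \<in> N \<and> D0 (mshift k v) = mshift k (D0 v)" for k
      using v
    proof (induction k arbitrary: v rule: multiindex_induct)
      case (incr i k)
      then show ?case using incr.IH[OF inv[OF incr.prems]] by (simp add: mshift_incr comm)
    qed (simp add: mshift_0)
    then show "D v = D0 v"
      by (intro da_eqI) (simp add: D \<Gamma>_fix d0_def coeff_mshift)
  qed
qed

section \<open>Factorization of module maps\<close>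

text \<open>
  For \<open>v\<close> orthogonal to the kernel \<open>Z\<close> of \<open>A\<close>, the identity \<open>D0 (L\<^sub>i v) = L\<^sub>i (D0 v)\<close> is dual to the
  fact that \<open>S\<^sub>i (C0 x)\<close> and \<open>C0 (S\<^sub>i x)\<close> solve the same equation and so differ by an element of \<open>Z\<close>.
  After the extension, \<open>C x - C0 x\<close> is orthogonal to \<open>N\<close>, hence lies in \<open>Z\<close>, and \<open>A C = A C0 = B\<close>.
\<close>

lemma shift_commuting_factorization:
  fixes A :: "('m::finite, 'g::complex_hilbert_space) da \<Rightarrow> ('m, 'k::complex_hilbert_space) da"
    and B :: "('m, 'f::complex_hilbert_space) da \<Rightarrow> ('m, 'k) da"
  assumes A: "bounded_linear A" and B: "bounded_linear B"
    and A_shift: "\<And>i x. A (fshift i x) = fshift i (A x)"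
    and B_shift: "\<And>i x. B (fshift i x) = fshift i (B x)"
    and ran: "range B \<subseteq> range A"
  obtains C where "bounded_linear C" "\<And>i x. C (fshift i x) = fshift i (C x)" "\<And>x. A (C x) = B x"
proof -
  interpret A: bounded_linear A by fact
  interpret B: bounded_linear B by fact
  interpret fs: bounded_linear "fshift i" for i by (rule bounded_linear_fshift)
  define Z where "Z = {u. A u = 0}"
  define N where "N = {v. \<forall>u\<in>Z. inner u v = 0}"
  have Z: "subspace Z" "closed Z"
  proof -
    show "subspace Z" unfolding Z_def by (auto simp: subspace_def A.add A.scaleR)
    show "closed Z" unfolding Z_def
      by (intro closed_Collect_eq continuous_intros A.continuous_on)
  qed
  have N: "subspace N" "closed N"
  proof -
    show "subspace N" unfolding N_def by (auto simp: subspace_def inner_add_right)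
    have "N = (\<Inter>u\<in>Z. {v. inner u v = 0})" unfolding N_def by auto
    then show "closed N" by (auto intro!: closed_INT closed_Collect_eq continuous_intros)
  qed
  have split: "\<exists>p\<in>Z. u - p \<in> N" for u
  proof -
    obtain p where "p \<in> Z" "\<And>v. v \<in> Z \<Longrightarrow> inner (u - p) v = 0"
      using orthogonal_projection_exists[OF Z] by metis
    then show ?thesis unfolding N_def by (auto simp: inner_commute)
  qed
  have NZ: "u = 0" if "u \<in> N" "u \<in> Z" for u
    using that unfolding N_def by (metis (mono_tags) inner_eq_zero_iff mem_Collect_eq)
  have Nperp: "u \<in> Z" if u: "\<And>v. v \<in> N \<Longrightarrow> inner v u = 0" for u
  proof -
    obtain p where p: "p \<in> Z" "u - p \<in> N" using split by blast
    have "inner p (u - p) = 0" using p unfolding N_def by blast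
    moreover have "inner u (u - p) = 0" using u[OF p(2)] by (simp add: inner_commute)
    ultimately have "inner (u - p) (u - p) = 0" by (simp add: inner_diff_left)
    then show ?thesis using p(1) by simp
  qed
  \<comment> \<open>the solutions \<open>y\<close> of \<open>A y = B x\<close> of least norm, as a relation\<close>
  define W where "W = {w. snd w \<in> N \<and> A (snd w) = B (fst w)}"
  have "subspace W" using N(1) unfolding W_def by (auto simp: subspace_def A.add A.scaleR B.add B.scaleR)
  moreover have "closed W"
  proof -
    have "W = (snd -` N) \<inter> {w. A (snd w) = B (fst w)}" unfolding W_def by auto
    then show ?thesis
      by (auto intro!: closed_Int closed_vimage closed_Collect_eq N(2) continuous_intros
          A.continuous_on B.continuous_on)
  qed
  moreover have "\<exists>y. (x, y) \<in> W" for x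
  proof -
    obtain y where y: "A y = B x" using ran by (metis UNIV_I image_subset_iff imageE)
    obtain p where p: "p \<in> Z" "y - p \<in> N" using split by blast
    then show ?thesis using y unfolding W_def Z_def by (intro exI[of _ "y - p"]) (auto simp: A.diff)
  qed
  ultimately obtain c where c: "\<And>x. \<exists>y. (x, y) \<in> W \<and> norm y \<le> c * norm x"
    using closed_relation_bounded_choice by metis
  then obtain C0 where C0: "\<And>x. C0 x \<in> N" "\<And>x. A (C0 x) = B x" "\<And>x. norm (C0 x) \<le> c * norm x"
    unfolding W_def by simp metis
  have C0_eqI: "C0 x = y" if "y \<in> N" "A y = B x" for x y
  proof -
    have "C0 x - y \<in> Z" unfolding Z_def by (simp add: A.diff C0 that)
    then show ?thesis using NZ[of "C0 x - y"] subspace_diff[OF N(1) C0(1) that(1)] by simp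
  qed
  have "bounded_linear C0"
  proof (rule bounded_linear_intro[where K = c])
    show "C0 (x + y) = C0 x + C0 y" for x y
      by (rule C0_eqI) (simp_all add: A.add B.add C0 subspace_add N(1))
    show "C0 (r *\<^sub>R x) = r *\<^sub>R C0 x" for r x
      by (rule C0_eqI) (simp_all add: A.scaleR B.scaleR C0 subspace_scale N(1))
  qed (use C0(3) in \<open>simp add: mult.commute\<close>)
  then obtain D0 where D0: "bounded_linear D0" "\<And>x y. inner (C0 x) y = inner x (D0 y)"
    using adjoint_exists by metis
  have N_shift: "bshift i v \<in> N" if "v \<in> N" for i v
  proof -
    have "fshift i u \<in> Z" if "u \<in> Z" for u using that unfolding Z_def by (simp add: A_shift fs.zero)
    then show ?thesis using that unfolding N_def by (simp flip: inner_fshift)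
  qed
  have D0_shift: "D0 (bshift i v) = bshift i (D0 v)" if v: "v \<in> N" for i v
  proof (rule vector_eq_ldot[THEN iffD1], rule allI)
    fix x
    have "fshift i (C0 x) - C0 (fshift i x) \<in> Z"
      unfolding Z_def by (simp add: A.diff A_shift B_shift C0)
    then have "inner (fshift i (C0 x) - C0 (fshift i x)) v = 0" using v unfolding N_def by blast
    then show "inner x (D0 (bshift i v)) = inner x (bshift i (D0 v))"
      by (simp add: inner_diff_left inner_fshift flip: D0(2))
        (simp add: D0(2) flip: inner_fshift)
  qed
  obtain D where D: "bounded_linear D" "\<And>i y. D (bshift i y) = bshift i (D y)" "\<And>v. v \<in> N \<Longrightarrow> D v = D0 v"
    using intertwining_extension[OF N N_shift D0(1) D0_shift] by metis
  obtain C where C: "bounded_linear C" "\<And>x y. inner (D x) y = inner x (C y)"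
    using adjoint_exists[OF D(1)] by metis
  show ?thesis
  proof
    show "bounded_linear C" by fact
    show "C (fshift i x) = fshift i (C x)" for i x
    proof (rule vector_eq_ldot[THEN iffD1], rule allI)
      fix y
      have "inner y (C (fshift i x)) = inner (fshift i x) (D y)" unfolding C(2)[symmetric] by (rule inner_commute)
      also have "\<dots> = inner (D (bshift i y)) x" unfolding inner_fshift by (simp add: D inner_commute)
      also have "\<dots> = inner (fshift i (C x)) y" unfolding C(2) inner_fshift by (rule inner_commute)
      finally show "inner y (C (fshift i x)) = inner y (fshift i (C x))" by (simp add: inner_commute)
    qed
    show "A (C x) = B x" for x
    proof -
      have "C x - C0 x \<in> Z"
      proof (rule Nperp)
        fix v assume "v \<in> N"
        then have "inner v (C x) = inner (D0 v) x" by (simp add: D flip: C(2))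
        also have "\<dots> = inner v (C0 x)" using D0(2)[of x v] by (simp add: inner_commute)
        finally show "inner v (C x - C0 x) = 0" by (simp add: inner_diff_right)
      qed
      then show ?thesis unfolding Z_def by (simp add: A.diff C0)
    qed
  qed
qed

lemma complex_linear_if_i:
  fixes C :: "'a::complex_normed_vector \<Rightarrow> 'b::complex_normed_vector"
  assumes C: "bounded_linear C" and i: "\<And>x. C (\<i> *\<^sub>C x) = \<i> *\<^sub>C C x"
  shows "C (c *\<^sub>C x) = c *\<^sub>C C x"
proof -
  interpret C: bounded_linear C by fact
  have split: "c *\<^sub>C y = Re c *\<^sub>R y + Im c *\<^sub>R (\<i> *\<^sub>C y)" for y :: "'d::complex_normed_vector"
  proof -
    have "c *\<^sub>C y = (complex_of_real (Re c) + complex_of_real (Im c) * \<i>) *\<^sub>C y"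
      by (subst complex_eq[of c]) (simp only: mult.commute)
    also have "\<dots> = Re c *\<^sub>R y + Im c *\<^sub>R (\<i> *\<^sub>C y)"
      by (simp only: scaleC_add_left scaleC_of_real flip: scaleC_scaleC)
    finally show ?thesis .
  qed
  show ?thesis unfolding split[of x] split[of "C x"] by (simp add: C.add C.scaleR i)
qed

lemma bounded_linear_scaleC: "bounded_linear (\<lambda>x::'a::complex_normed_vector. c *\<^sub>C x)"
  by (rule bounded_linear_intro[where K = "cmod c"])
    (simp_all add: scaleC_add_right scaleR_scaleC_commute norm_scaleC)

lemma scaleC_one [simp]: "1 *\<^sub>C x = (x::'a::complex_normed_vector)"
  using scaleC_of_real[of 1 x] by simp

lemma scaleC_minus_left: "(- c) *\<^sub>C x = - (c *\<^sub>C (x::'a::complex_normed_vector))"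
  using scaleC_of_real[of "-1" "c *\<^sub>C x"] by (simp add: scaleC_scaleC)

text \<open>
  Commuting with the coordinate multiplications is what it means to commute with all polynomials.
\<close>

definition module_hom ::
    "(('m::finite, 'e::complex_hilbert_space) da \<Rightarrow> ('m, 'f::complex_hilbert_space) da) \<Rightarrow> bool"
  where "module_hom T \<longleftrightarrow> bounded_linear T \<and> (\<forall>c x. T (c *\<^sub>C x) = c *\<^sub>C T x) \<and>
    (\<forall>i x. T (fshift i x) = fshift i (T x))"

text \<open>
  The complex linear part \<open>(C - \<i> C \<i>) / 2\<close> of a real linear solution is again a solution.
\<close>

theorem module_hom_factorization:
  fixes A :: "('m::finite, 'g::complex_hilbert_space) da \<Rightarrow> ('m, 'k::complex_hilbert_space) da"
    and B :: "('m, 'f::complex_hilbert_space) da \<Rightarrow> ('m, 'k) da"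
  assumes A: "module_hom A" and B: "module_hom B" and ran: "range B \<subseteq> range A"
  obtains C where "module_hom C" "\<And>x. A (C x) = B x"
proof -
  obtain C where C: "bounded_linear C" "\<And>i x. C (fshift i x) = fshift i (C x)" "\<And>x. A (C x) = B x"
    using shift_commuting_factorization[of A B] assms unfolding module_hom_def by metis
  interpret C: bounded_linear C by (fact C(1))
  interpret A: bounded_linear A using A unfolding module_hom_def by blast
  interpret fs: bounded_linear "fshift i" for i by (rule bounded_linear_fshift)
  interpret sc: bounded_linear "\<lambda>x::('m, 'g) da. c *\<^sub>C x" for c by (rule bounded_linear_scaleC)
  define C' where "C' x = (1/2) *\<^sub>R (C x - \<i> *\<^sub>C C (\<i> *\<^sub>C x))" for x
  have bl: "bounded_linear C'" unfolding C'_def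
    by (intro bounded_linear_const_scaleR bounded_linear_sub C(1)
        bounded_linear_compose[OF bounded_linear_scaleC]
        bounded_linear_compose[OF C(1) bounded_linear_scaleC])
  have ii: "\<i> *\<^sub>C \<i> *\<^sub>C x = - x" for x :: "'x::complex_normed_vector"
    by (simp add: scaleC_scaleC scaleC_minus_left)
  show ?thesis
  proof
    have "C' (\<i> *\<^sub>C x) = \<i> *\<^sub>C C' x" for x
      unfolding C'_def by (simp add: ii C.neg sc.neg sc.add sc.diff add.commute flip: scaleR_scaleC_commute)
    moreover have "C' (fshift i x) = fshift i (C' x)" for i x
      unfolding C'_def by (simp add: C fs.scaleR fs.diff flip: fshift_scaleC)
    ultimately show "module_hom C'"
      unfolding module_hom_def using bl complex_linear_if_i by blast
    show "A (C' x) = B x" for x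
    proof -
      have "A (C' x) = (1/2) *\<^sub>R (B x - \<i> *\<^sub>C \<i> *\<^sub>C B x)"
        unfolding C'_def using A B unfolding module_hom_def by (simp add: A.scaleR A.diff C(3))
      then show ?thesis by (simp add: ii flip: scaleR_2)
    qed
  qed
qed

section \<open>Evaluation of power series\<close>

lemma cmod_monomial: "cmod (monomial k z) = (\<Prod>i\<in>UNIV. cmod (z $ i) ^ k i)"
  by (simp add: monomial_def norm_power flip: prod_norm)

lemma monomial_incr: "monomial (incr i k) z = z $ i * monomial k z"
proof -
  have "monomial (incr i k) z = (\<Prod>j\<in>UNIV. (if j = i then z $ i else 1) * (z $ j) ^ k j)"
    unfolding monomial_def by (rule prod.cong) (auto simp: incr_apply)
  then show ?thesis by (simp add: prod.distrib monomial_def)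
qed

lemma monomial_0 [simp]: "monomial (\<lambda>_. 0) z = 1"
  by (simp add: monomial_def)

lemma norm_cvec_sq: "(norm (z :: complex ^ 'm::finite))\<^sup>2 = (\<Sum>i\<in>UNIV. (cmod (z $ i))\<^sup>2)"
  by (simp add: norm_vec_def L2_set_def sum_nonneg)

text \<open>
  The multinomial theorem for \<open>(|z\<^sub>1|\<^sup>2 + \<dots> + |z\<^sub>m|\<^sup>2)\<^sup>n\<close>. Summed over \<open>n\<close>, this is the value
  \<open>1 / (1 - |z|\<^sup>2)\<close> of the reproducing kernel on the diagonal, which bounds point evaluation.
\<close>

lemma sum_homogeneous_monomial:
  "(\<Sum>k\<in>homogeneous n. multinomial k * (cmod (monomial k z))\<^sup>2) = ((norm z)\<^sup>2) ^ n"
proof (induction n)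
  case (Suc n)
  have "(\<Sum>k\<in>homogeneous (Suc n). multinomial k * (cmod (monomial k z))\<^sup>2) =
      (\<Sum>i\<in>UNIV. (cmod (z $ i))\<^sup>2 * (\<Sum>k\<in>homogeneous n. multinomial k * (cmod (monomial k z))\<^sup>2))"
    unfolding sum_homogeneous_Suc monomial_incr
    by (simp add: norm_mult power_mult_distrib sum_distrib_left mult.left_commute)
  also have "\<dots> = (norm z)\<^sup>2 * ((norm z)\<^sup>2) ^ n"
    by (simp add: Suc norm_cvec_sq sum_distrib_right)
  finally show ?case by simp
qed (simp add: homogeneous_0)

lemma summable_monomial:
  fixes z :: "complex ^ 'm::finite"
  assumes "z \<in> ball 0 1"
  shows "(\<lambda>k. multinomial k * (cmod (monomial k z))\<^sup>2) summable_on UNIV"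
    "(\<Sum>\<^sub>\<infinity>k. multinomial k * (cmod (monomial k z))\<^sup>2) \<le> 1 / (1 - (norm z)\<^sup>2)"
proof -
  have z: "(norm z)\<^sup>2 < 1" using assms by (simp add: abs_square_less_1)
  have "(\<Sum>j<n. \<Sum>k\<in>homogeneous j. multinomial k * (cmod (monomial k z))\<^sup>2) \<le> 1 / (1 - (norm z)\<^sup>2)" for n
  proof -
    have "(\<Sum>j<n. ((norm z)\<^sup>2) ^ j) \<le> (\<Sum>j. ((norm z)\<^sup>2) ^ j)"
      using z by (intro sum_le_suminf summable_geometric) auto
    also have "\<dots> = 1 / (1 - (norm z)\<^sup>2)" using z by (intro suminf_geometric) simp
    finally show ?thesis by (simp add: sum_homogeneous_monomial)
  qed
  then show "(\<lambda>k. multinomial k * (cmod (monomial k z))\<^sup>2) summable_on UNIV"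
    "(\<Sum>\<^sub>\<infinity>k. multinomial k * (cmod (monomial k z))\<^sup>2) \<le> 1 / (1 - (norm z)\<^sup>2)"
    using summable_on_if_homogeneous_bounded[of "\<lambda>k. multinomial k * (cmod (monomial k z))\<^sup>2"] by auto
qed

definition deval :: "('m::finite, 'e::complex_hilbert_space) da \<Rightarrow> complex ^ 'm \<Rightarrow> 'e"
  where "deval x z = (\<Sum>\<^sub>\<infinity>k. monomial k z *\<^sub>C multinomial k *\<^sub>R coeff x k)"

lemma deval_abs_summable:
  assumes z: "z \<in> ball 0 1"
  shows "(\<lambda>k. norm (monomial k z *\<^sub>C multinomial k *\<^sub>R coeff x k)) summable_on UNIV"
    "(\<Sum>\<^sub>\<infinity>k. norm (monomial k z *\<^sub>C multinomial k *\<^sub>R coeff x k)) \<le> sqrt (1 / (1 - (norm z)\<^sup>2)) * norm x"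
proof -
  let ?h = "\<lambda>k. norm (monomial k z *\<^sub>C multinomial k *\<^sub>R coeff x k)"
  have F: "sum ?h F \<le> sqrt (1 / (1 - (norm z)\<^sup>2)) * norm x" if F: "finite F" for F
  proof -
    have "?h k = \<bar>sqrt (multinomial k) * cmod (monomial k z)\<bar> * \<bar>sqrt (multinomial k) * norm (coeff x k)\<bar>" for k
      by (simp add: norm_scaleC abs_mult)
    then have "sum ?h F = (\<Sum>k\<in>F. \<bar>sqrt (multinomial k) * cmod (monomial k z)\<bar> * \<bar>sqrt (multinomial k) * norm (coeff x k)\<bar>)"
      by simp
    also have "\<dots> \<le> L2_set (\<lambda>k. sqrt (multinomial k) * cmod (monomial k z)) F * L2_set (\<lambda>k. sqrt (multinomial k) * norm (coeff x k)) F"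
      by (rule L2_set_mult_ineq)
    also have "\<dots> \<le> sqrt (1 / (1 - (norm z)\<^sup>2)) * sqrt ((norm x)\<^sup>2)"
    proof (intro mult_mono)
      have "(\<Sum>k\<in>F. multinomial k * (cmod (monomial k z))\<^sup>2) \<le> (\<Sum>\<^sub>\<infinity>k. multinomial k * (cmod (monomial k z))\<^sup>2)"
        by (rule finite_sum_le_infsum) (auto simp: F summable_monomial[OF z])
      then show "L2_set (\<lambda>k. sqrt (multinomial k) * cmod (monomial k z)) F \<le> sqrt (1 / (1 - (norm z)\<^sup>2))"
        unfolding L2_set_def using summable_monomial(2)[OF z] by (simp add: power_mult_distrib)
      have "(\<Sum>k\<in>F. multinomial k * (norm (coeff x k))\<^sup>2) \<le> (norm x)\<^sup>2"
        by (rule finite_sum_le_has_sum[OF has_sum_norm_da]) (auto simp: F)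
      then show "L2_set (\<lambda>k. sqrt (multinomial k) * norm (coeff x k)) F \<le> sqrt ((norm x)\<^sup>2)"
        unfolding L2_set_def by (simp add: power_mult_distrib del: real_sqrt_abs)
    qed (use z in \<open>auto simp: abs_square_le_1\<close>)
    finally show ?thesis by simp
  qed
  show 1: "?h summable_on UNIV"
    by (rule nonneg_bounded_partial_sums_imp_summable_on[where C = "sqrt (1 / (1 - (norm z)\<^sup>2)) * norm x"])
      (auto intro!: eventually_finite_subsets_at_top_weakI F)
  show "infsum ?h UNIV \<le> sqrt (1 / (1 - (norm z)\<^sup>2)) * norm x"
    by (rule infsum_le_finite_sums[OF 1]) (auto intro: F)
qed

lemma deval_has_sum:
  assumes z: "z \<in> ball 0 1"
  shows "((\<lambda>k. monomial k z *\<^sub>C multinomial k *\<^sub>R coeff x k) has_sum deval x z) UNIV"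
  unfolding deval_def by (rule has_sum_infsum[OF Infinite_Sum.abs_summable_summable[OF deval_abs_summable(1)[OF z]]])

lemma norm_deval_le:
  assumes z: "z \<in> ball 0 1"
  shows "norm (deval x z) \<le> sqrt (1 / (1 - (norm z)\<^sup>2)) * norm x"
  unfolding deval_def using norm_infsum_bound[OF deval_abs_summable(1)[OF z]] deval_abs_summable(2)[OF z]
  by (rule order.trans)

lemma deval_eqI:
  assumes "z \<in> ball 0 1" "((\<lambda>k. monomial k z *\<^sub>C multinomial k *\<^sub>R coeff x k) has_sum s) UNIV"
  shows "deval x z = s"
  using deval_has_sum[OF assms(1)] assms(2) has_sum_unique by blast

lemma bounded_linear_scaleC_left: "bounded_linear (\<lambda>c. c *\<^sub>C (x::'a::complex_normed_vector))"
  by (rule bounded_linear_intro[where K = "norm x"])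
    (simp_all add: scaleC_add_left norm_scaleC scaleR_conv_of_real flip: scaleC_scaleC scaleC_of_real)

lemma deval_add: "z \<in> ball 0 1 \<Longrightarrow> deval (x + y) z = deval x z + deval y z"
  by (rule deval_eqI, assumption)
    (simp add: scaleR_add_right scaleC_add_right has_sum_add[OF deval_has_sum deval_has_sum])

lemma deval_scaleC: "z \<in> ball 0 1 \<Longrightarrow> deval (c *\<^sub>C x) z = c *\<^sub>C deval x z"
proof (rule deval_eqI, assumption)
  assume z: "z \<in> ball 0 1"
  show "((\<lambda>k. monomial k z *\<^sub>C multinomial k *\<^sub>R coeff (c *\<^sub>C x) k) has_sum c *\<^sub>C deval x z) UNIV"
    using has_sum_bounded_linear[OF bounded_linear_scaleC[of c] deval_has_sum[OF z, of x]]
    by (simp add: scaleC_scaleC mult.commute scaleR_scaleC_commute)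
qed

lemma deval_scaleR: "z \<in> ball 0 1 \<Longrightarrow> deval (r *\<^sub>R x) z = r *\<^sub>R deval x z"
  using deval_scaleC[of z "complex_of_real r" x] by (simp add: scaleC_of_real)

lemma bounded_linear_deval: "z \<in> ball 0 1 \<Longrightarrow> bounded_linear (\<lambda>x. deval x z)"
  by (rule bounded_linear_intro[where K = "sqrt (1 / (1 - (norm z)\<^sup>2))"])
    (simp_all only: deval_add deval_scaleR mult.commute[of "norm _"] norm_deval_le)

lemma deval_const: "z \<in> ball 0 1 \<Longrightarrow> deval (const_da e) z = e"
  by (rule deval_eqI, assumption, rule has_sum_finite_neutralI[where B = "{\<lambda>_. 0}"])
    (auto simp: coeff_const_da)

lemma deval_fshift:
  assumes z: "z \<in> ball 0 1"
  shows "deval (fshift i x) z = (z $ i) *\<^sub>C deval x z"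
proof (rule deval_eqI[OF z])
  let ?h = "\<lambda>k. monomial k z *\<^sub>C multinomial k *\<^sub>R coeff (fshift i x) k"
  have "(?h \<circ> incr i) k = (z $ i) *\<^sub>C monomial k z *\<^sub>C multinomial k *\<^sub>R coeff x k" for k
  proof -
    have "multinomial (incr i k) * (real (incr i k i) / real (mdegree (incr i k))) = multinomial k"
      by (subst multinomial_decr) (auto simp: decr_incr incr_apply[of i k i])
    then show ?thesis
      by (simp only: comp_apply coeff_fshift decr_incr scaleR_scaleR monomial_incr scaleC_scaleC)
  qed
  then have "(?h \<circ> incr i has_sum (z $ i) *\<^sub>C deval x z) UNIV"
    using has_sum_bounded_linear[OF bounded_linear_scaleC[of "z $ i"] deval_has_sum[OF z, of x]]
    by (simp add: comp_def)
  then have "(?h has_sum (z $ i) *\<^sub>C deval x z) (range (incr i))"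
    by (subst has_sum_reindex) (auto intro: inj_incr)
  then show "(?h has_sum (z $ i) *\<^sub>C deval x z) UNIV"
    by (subst (asm) has_sum_cong_neutral[where T = UNIV]) (auto simp: range_incr coeff_fshift)
qed

lemma deval_unfold:
  assumes z: "z \<in> ball 0 1"
  shows "deval x z = coeff x (\<lambda>_. 0) + (\<Sum>i\<in>UNIV. (z $ i) *\<^sub>C deval (bshift i x) z)"
proof -
  interpret dv: bounded_linear "\<lambda>x. deval x z" by (rule bounded_linear_deval[OF z])
  show ?thesis
    by (subst da_decomposition[of x]) (simp add: dv.add dv.sum deval_const[OF z] deval_fshift[OF z])
qed

section \<open>Uniqueness of power series\<close>

lemma has_sum_difference:
  fixes f g :: "'i \<Rightarrow> 'b::real_normed_vector"
  assumes "(f has_sum s) A" "(g has_sum t) A"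
  shows "((\<lambda>x. f x - g x) has_sum (s - t)) A"
  using has_sum_add[OF assms(1) has_sum_bounded_linear[OF bounded_linear_minus[OF bounded_linear_ident] assms(2)]]
  by simp

text \<open>
  The constant coefficient is the value at 0. For the remaining ones the series is split as
  \<open>f = g + z\<^sub>i h\<close> with \<open>g\<close> collecting the terms free of \<open>z\<^sub>i\<close>. Setting \<open>z\<^sub>i = 0\<close> shows \<open>g = 0\<close>, so \<open>h\<close>
  vanishes where \<open>z\<^sub>i \<noteq> 0\<close> and by continuity everywhere; its coefficients are those of \<open>f\<close> at
  \<open>k + e\<^sub>i\<close>, and induction applies. Absolute summability on a fixed polydisc is part of the
  hypothesis because it gives the continuity of \<open>h\<close> and passes from \<open>f\<close> to \<open>h\<close>.
\<close>

lemma power_series_zero_on_polydisc: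
  fixes a :: "('m::finite \<Rightarrow> nat) \<Rightarrow> 'e::complex_hilbert_space"
  assumes r: "r > 0" and summable: "(\<lambda>k. r ^ mdegree k * norm (a k)) summable_on UNIV"
    and zero: "\<And>z :: complex ^ 'm. (\<And>i. cmod (z $ i) \<le> r) \<Longrightarrow> ((\<lambda>k. monomial k z *\<^sub>C a k) has_sum 0) UNIV"
  shows "a k = 0"
  using summable zero
proof (induction k arbitrary: a rule: multiindex_induct)
  case zero
  have "((\<lambda>k. monomial k (0 :: complex ^ 'm) *\<^sub>C a k) has_sum a (\<lambda>_. 0)) UNIV"
  proof (rule has_sum_finite_neutralI[where B = "{\<lambda>_. 0}"])
    fix k :: "'m \<Rightarrow> nat" assume "k \<in> UNIV - {\<lambda>_. 0}"
    then obtain i where "k i \<noteq> 0" by auto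
    then have "monomial k (0 :: complex ^ 'm) = 0"
      unfolding monomial_def by (intro prod_zero) (auto intro!: bexI[of _ i])
    then show "monomial k (0 :: complex ^ 'm) *\<^sub>C a k = 0"
      using norm_scaleC[of 0 "a k"] by simp
  qed auto
  moreover have "((\<lambda>k. monomial k (0 :: complex ^ 'm) *\<^sub>C a k) has_sum 0) UNIV"
    using r by (intro zero.prems(2)) simp
  ultimately show ?case by (rule has_sum_unique)
next
  case (incr i k)
  note summable = incr.prems(1) and zero = incr.prems(2)
  have scaleC_0 [simp]: "0 *\<^sub>C x = 0" for x :: 'e using norm_scaleC[of 0 x] by simp
  define a' where "a' k = a (incr i k)" for k
  have summable': "(\<lambda>k. r ^ mdegree k * norm (a' k)) summable_on UNIV"
  proof -
    have "(\<lambda>k. r ^ mdegree k * norm (a k)) summable_on range (incr i)"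
      using summable by (rule summable_on_subset_banach) simp
    then have "((\<lambda>k. r ^ mdegree k * norm (a k)) \<circ> incr i) summable_on UNIV"
      by (subst (asm) summable_on_reindex) (auto intro: inj_incr)
    then have "(\<lambda>k. (1 / r) * (((\<lambda>k. r ^ mdegree k * norm (a k)) \<circ> incr i) k)) summable_on UNIV"
      by (rule summable_on_cmult_right)
    moreover have "(1 / r) * (((\<lambda>k. r ^ mdegree k * norm (a k)) \<circ> incr i) k) = r ^ mdegree k * norm (a' k)" for k
      using r by (simp add: mdegree_incr a'_def)
    ultimately show ?thesis by simp
  qed
  define P where "P = {z :: complex ^ 'm. \<forall>i. cmod (z $ i) \<le> r}"
  define H where "H z = (\<Sum>\<^sub>\<infinity>k. monomial k z *\<^sub>C a' k)" for z :: "complex ^ 'm"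
  have bound: "norm (monomial k z *\<^sub>C a' k) \<le> r ^ mdegree k * norm (a' k)" if "z \<in> P" for z k
  proof -
    have "cmod (monomial k z) \<le> (\<Prod>i\<in>UNIV. r ^ k i)"
      unfolding cmod_monomial using that by (intro prod_mono) (auto simp: P_def power_mono)
    then show ?thesis by (simp add: norm_scaleC power_sum mult_right_mono)
  qed
  have H_sum: "((\<lambda>k. monomial k z *\<^sub>C a' k) has_sum H z) UNIV" if "z \<in> P" for z
    unfolding H_def
  proof (rule has_sum_infsum, rule Infinite_Sum.abs_summable_summable)
    show "(\<lambda>k. norm (monomial k z *\<^sub>C a' k)) summable_on UNIV"
      by (rule summable_on_comparison_test[OF summable']) (auto intro: bound that)
  qed
  have cont: "continuous_on P H"
  proof (rule uniform_limit_theorem)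
    show "uniform_limit P (\<lambda>X z. \<Sum>k\<in>X. monomial k z *\<^sub>C a' k) H (finite_subsets_at_top UNIV)"
      unfolding H_def by (rule Weierstrass_m_test_general[OF _ summable']) (auto intro: bound)
    have "continuous_on P (\<lambda>z. \<Sum>k\<in>X. monomial k z *\<^sub>C a' k)" for X
      unfolding monomial_def
      by (intro continuous_on_sum bounded_linear.continuous_on[OF bounded_linear_scaleC_left] continuous_intros)
    then show "\<forall>\<^sub>F X in finite_subsets_at_top UNIV. continuous_on P (\<lambda>z. \<Sum>k\<in>X. monomial k z *\<^sub>C a' k)"
      by simp
  qed simp
  have H_nz: "H z = 0" if z: "z \<in> P" "z $ i \<noteq> 0" for z
  proof -
    define z0 where "z0 = (\<chi> j. if j = i then 0 else z $ j)"
    have z0: "z0 \<in> P" using z(1) r by (auto simp: P_def z0_def)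
    let ?h = "\<lambda>k. monomial k z *\<^sub>C a k - monomial k z0 *\<^sub>C a k"
    have "(?h has_sum (0 - 0)) UNIV"
    proof -
      have "((\<lambda>k. monomial k z *\<^sub>C a k) has_sum 0) UNIV" "((\<lambda>k. monomial k z0 *\<^sub>C a k) has_sum 0) UNIV"
        using z(1) z0 by (auto simp: P_def intro!: zero)
      then show ?thesis by (rule has_sum_difference)
    qed
    moreover have "?h k = (if k i = 0 then 0 else monomial k z *\<^sub>C a k)" for k
    proof (cases "k i = 0")
      case True
      then have "monomial k z0 = monomial k z"
        unfolding monomial_def z0_def by (intro prod.cong) auto
      then show ?thesis using True by simp
    next
      case False
      then have "monomial k z0 = 0"
        unfolding monomial_def z0_def by (intro prod_zero) (auto intro!: bexI[of _ i])
      then show ?thesis using False by simp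
    qed
    ultimately have "((\<lambda>k. if k i = 0 then 0 else monomial k z *\<^sub>C a k) has_sum 0) UNIV" by simp
    then have "((\<lambda>k. monomial k z *\<^sub>C a k) has_sum 0) (range (incr i))"
      by (subst has_sum_cong_neutral[where T = UNIV and g = "\<lambda>k. if k i = 0 then 0 else monomial k z *\<^sub>C a k"])
        (auto simp: range_incr)
    then have "((\<lambda>k. (z $ i) *\<^sub>C monomial k z *\<^sub>C a' k) has_sum 0) UNIV"
      by (subst (asm) has_sum_reindex) (auto intro: inj_incr simp: comp_def monomial_incr a'_def scaleC_scaleC)
    from has_sum_bounded_linear[OF bounded_linear_scaleC[of "inverse (z $ i)"] this]
    have "((\<lambda>k. monomial k z *\<^sub>C a' k) has_sum 0) UNIV"
      using z(2) by (simp add: scaleC_scaleC flip: mult.assoc)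
    then show ?thesis unfolding H_def by (rule infsumI)
  qed
  have "H z = 0" if z: "z \<in> P" for z
  proof (cases "z $ i = 0")
    case False
    then show ?thesis using H_nz z by blast
  next
    case True
    define Z where "Z n = z + axis i (complex_of_real (r / real (Suc n)))" for n
    have Zi: "Z n $ j = (if j = i then complex_of_real (r / real (Suc n)) else z $ j)" for n j
      unfolding Z_def using True by (auto simp: axis_def)
    have Z: "Z n \<in> P" for n
      using z r by (auto simp: P_def Zi norm_divide divide_le_eq simp del: of_real_divide)
    have "(\<lambda>n. r / real (Suc n)) \<longlonglongrightarrow> 0"
      by (rule LIMSEQ_Suc[OF lim_const_over_n])
    then have lim: "(\<lambda>n. complex_of_real (r / real (Suc n))) \<longlonglongrightarrow> complex_of_real 0"
      by (rule tendsto_of_real)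
    have "Z \<longlonglongrightarrow> z"
    proof (rule vec_tendstoI)
      show "(\<lambda>n. Z n $ j) \<longlonglongrightarrow> z $ j" for j
        using lim True by (cases "j = i") (simp_all add: Zi del: of_real_divide)
    qed
    then have "(\<lambda>n. H (Z n)) \<longlonglongrightarrow> H z"
      by (rule continuous_on_tendsto_compose[OF cont]) (auto simp: Z z)
    moreover have "H (Z n) = 0" for n using r by (intro H_nz Z) (simp add: Zi del: of_real_divide)
    ultimately show ?thesis using LIMSEQ_unique[OF tendsto_const] by force
  qed
  then have "((\<lambda>k. monomial k z *\<^sub>C a' k) has_sum 0) UNIV" if "\<And>i. cmod (z $ i) \<le> r" for z
    using H_sum[of z] that by (auto simp: P_def)
  from incr.IH[OF summable' this] show ?case by (simp add: a'_def)
qed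

lemma multinomial_ge_1: "multinomial k \<ge> 1"
proof (induction k rule: multiindex_induct)
  case (incr i k)
  then show ?case using multinomial_le_incr[of k i] by simp
qed simp

text \<open>
  Unconditional convergence at the single point \<open>w = (s, \<dots>, s)\<close> bounds the terms
  \<open>s\<^bsup>|k|\<^esup> c\<^sub>k\<close> of the difference, and shrinking the radius makes them absolutely summable.
\<close>

lemma power_series_unique:
  fixes f :: "complex ^ 'm::finite \<Rightarrow> 'e::complex_hilbert_space"
  assumes "power_series_on_ball a f" "power_series_on_ball b f"
  shows "a = b"
proof -
  define c where "c k = a k - b k" for k
  have c: "((\<lambda>k. monomial k z *\<^sub>C c k) has_sum 0) UNIV" if "z \<in> ball 0 1" for z
  proof -
    have "((\<lambda>k. monomial k z *\<^sub>C a k - monomial k z *\<^sub>C b k) has_sum (f z - f z)) UNIV"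
      using assms that unfolding power_series_on_ball_def by (intro has_sum_difference) auto
    moreover have "monomial k z *\<^sub>C a k - monomial k z *\<^sub>C b k = monomial k z *\<^sub>C c k" for k
      using bounded_linear.linear[OF bounded_linear_scaleC[of "monomial k z"], THEN linear_diff, of "a k" "b k"]
      unfolding c_def by simp
    ultimately show ?thesis by simp
  qed
  \<comment> \<open>small enough for the polydisc of radius \<open>s\<close> to lie in the ball\<close>
  define s where "s = 1 / (real CARD('m) + 1)"
  have s: "0 < s" "s \<le> 1" unfolding s_def by auto
  have ball: "z \<in> ball 0 1" if "\<And>i. cmod (z $ i) \<le> s" for z :: "complex ^ 'm"
  proof -
    have "norm z \<le> (\<Sum>i\<in>UNIV. cmod (z $ i))" unfolding norm_vec_def by (rule L2_set_le_sum) simp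
    also have "\<dots> \<le> (\<Sum>i\<in>(UNIV::'m set). s)" by (intro sum_mono that)
    also have "\<dots> < 1" unfolding s_def by (simp add: divide_less_eq)
    finally show ?thesis by simp
  qed
  define w :: "complex ^ 'm" where "w = (\<chi> i. complex_of_real s)"
  have w: "w \<in> ball 0 1" using s by (intro ball) (simp add: w_def)
  have mw: "cmod (monomial k w) = s ^ mdegree k" for k
    using s by (simp add: cmod_monomial w_def power_sum)
  obtain M where M: "\<And>k. s ^ mdegree k * norm (c k) \<le> M"
  proof -
    let ?t = "\<lambda>k. monomial k w *\<^sub>C c k"
    have "\<forall>\<^sub>F X in finite_subsets_at_top UNIV. dist (sum ?t X) 0 < 1"
      using c[OF w] unfolding has_sum_def by (rule tendstoD) simp
    then obtain X where X: "finite X" "\<And>Y. finite Y \<Longrightarrow> X \<subseteq> Y \<Longrightarrow> norm (sum ?t Y) < 1"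
      unfolding eventually_finite_subsets_at_top dist_0_norm by (auto simp: dist_norm)
    have "norm (?t k) \<le> 2 + (\<Sum>k\<in>X. norm (?t k))" for k
    proof (cases "k \<in> X")
      case True
      then have "norm (?t k) \<le> (\<Sum>k\<in>X. norm (?t k))" using X(1) by (intro member_le_sum) auto
      then show ?thesis by simp
    next
      case False
      then have "?t k = sum ?t (insert k X) - sum ?t X" using X(1) by simp
      then have "norm (?t k) \<le> norm (sum ?t (insert k X)) + norm (sum ?t X)"
        by (metis norm_triangle_ineq4)
      also have "\<dots> \<le> 1 + 1" using X by (intro add_mono less_imp_le[OF X(2)]) auto
      finally have "norm (?t k) \<le> 2" by simp
      moreover have "0 \<le> (\<Sum>k\<in>X. norm (?t k))" by (intro sum_nonneg norm_ge_zero)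
      ultimately show ?thesis by linarith
    qed
    then have "s ^ mdegree k * norm (c k) \<le> 2 + (\<Sum>k\<in>X. norm (?t k))" for k
      by (simp only: norm_scaleC mw)
    then show ?thesis by (rule that)
  qed
  \<comment> \<open>one factor \<open>s\<^bsup>|k|\<^esup>\<close> controls \<open>c\<^sub>k\<close>; the square of another is summable, being at most the kernel term at \<open>w\<close>\<close>
  have "(\<lambda>k. (s ^ 3) ^ mdegree k * norm (c k)) summable_on UNIV"
  proof (rule summable_on_comparison_test)
    show "(\<lambda>k. M * (multinomial k * (cmod (monomial k w))\<^sup>2)) summable_on UNIV"
      by (intro summable_on_cmult_right summable_monomial w)
    fix k :: "'m \<Rightarrow> nat"
    have "0 \<le> s ^ mdegree k * norm (c k)" using s by simp
    then have M0: "M \<ge> 0" using M[of k] by linarith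
    have "(s ^ 3) ^ mdegree k * norm (c k) = (s ^ mdegree k * norm (c k)) * (1 * (s ^ mdegree k)\<^sup>2)"
      by (simp add: power2_eq_square power3_eq_cube power_mult_distrib)
    also have "\<dots> \<le> M * (multinomial k * (s ^ mdegree k)\<^sup>2)"
      using M0 by (intro mult_mono M multinomial_ge_1) auto
    finally show "(s ^ 3) ^ mdegree k * norm (c k) \<le> M * (multinomial k * (cmod (monomial k w))\<^sup>2)"
      by (simp add: mw)
  qed (use s in auto)
  moreover have "((\<lambda>k. monomial k z *\<^sub>C c k) has_sum 0) UNIV" if z: "\<And>i. cmod (z $ i) \<le> s ^ 3" for z
  proof (rule c, rule ball)
    fix i
    have "s ^ 3 \<le> s" using s power_decreasing[of 1 3 s] by simp
    then show "cmod (z $ i) \<le> s" using z[of i] by simp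
  qed
  ultimately have "c k = 0" for k
    using s power_series_zero_on_polydisc[of "s ^ 3" c k] by simp
  then show ?thesis unfolding c_def by auto
qed

section \<open>The Drury-Arveson module\<close>

definition da_fun :: "('m::finite, 'e::complex_hilbert_space) da \<Rightarrow> complex ^ 'm \<Rightarrow> 'e"
  where "da_fun x z = (if z \<in> ball 0 1 then deval x z else 0)"

lemma da_fun_power_series: "power_series_on_ball (\<lambda>k. multinomial k *\<^sub>R coeff x k) (da_fun x)"
  unfolding power_series_on_ball_def da_fun_def by (simp add: deval_has_sum del: mem_ball)

lemma taylor_coeffs_da_fun: "taylor_coeffs (da_fun x) = (\<lambda>k. multinomial k *\<^sub>R coeff x k)"
  unfolding taylor_coeffs_def
  by (rule the_equality[where P = "\<lambda>a. power_series_on_ball a (da_fun x)", OF da_fun_power_series])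
    (rule power_series_unique[OF _ da_fun_power_series])

lemma inj_da_fun: "inj da_fun"
proof (rule injI)
  fix x y :: "('a, 'b) da" assume "da_fun x = da_fun y"
  then have "taylor_coeffs (da_fun x) = taylor_coeffs (da_fun y)" by simp
  then have "multinomial k *\<^sub>R coeff x k = multinomial k *\<^sub>R coeff y k" for k
    unfolding taylor_coeffs_da_fun by metis
  moreover have "multinomial k \<noteq> 0" for k :: "'a \<Rightarrow> nat" using multinomial_pos[of k] by simp
  ultimately show "x = y" by (intro da_eqI) (metis scaleR_cancel_left)
qed

lemma mcarrier_drury_arveson:
  "mcarrier (drury_arveson :: ('m::finite, complex ^ 'm \<Rightarrow> 'e::complex_hilbert_space) hilbert_module) = range da_fun"
proof (intro equalityI subsetI)
  fix f :: "complex ^ 'm \<Rightarrow> 'e" assume "f \<in> mcarrier drury_arveson"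
  then obtain a where f: "\<And>z. z \<notin> ball 0 1 \<Longrightarrow> f z = 0" and a: "power_series_on_ball a f"
    and s: "(\<lambda>k. (norm (a k))\<^sup>2 / multinomial k) summable_on UNIV"
    unfolding drury_arveson_def by auto
  define x where "x = Abs_da (\<lambda>k. (1 / multinomial k) *\<^sub>R a k)"
  have "multinomial k * (norm ((1 / multinomial k) *\<^sub>R a k))\<^sup>2 = (norm (a k))\<^sup>2 / multinomial k" for k
    using multinomial_pos[of k] by (simp add: power_mult_distrib power2_eq_square)
  then have x: "coeff x k = (1 / multinomial k) *\<^sub>R a k" for k
    unfolding x_def using s by (subst Abs_da_inverse) auto
  have "multinomial k *\<^sub>R coeff x k = a k" for k using multinomial_pos[of k] by (simp add: x)
  then have "deval x z = f z" if "z \<in> ball 0 1" for z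
    using a that by (intro deval_eqI) (auto simp: power_series_on_ball_def)
  then have "f = da_fun x" by (intro ext) (metis da_fun_def f)
  then show "f \<in> range da_fun" by simp
next
  fix f :: "complex ^ 'm \<Rightarrow> 'e" assume "f \<in> range da_fun"
  then obtain x where x: "f = da_fun x" by blast
  have "(norm (multinomial k *\<^sub>R coeff x k))\<^sup>2 / multinomial k = multinomial k * (norm (coeff x k))\<^sup>2" for k
    using multinomial_pos[of k] by (simp add: power_mult_distrib power2_eq_square)
  then have "(\<lambda>k. (norm (multinomial k *\<^sub>R coeff x k))\<^sup>2 / multinomial k) summable_on UNIV"
    using coeff_summable[of x] by simp
  then show "f \<in> mcarrier drury_arveson"
    unfolding drury_arveson_def x using da_fun_power_series[of x] by (auto simp: da_fun_def)
qed

lemma mnorm_da_fun: "mnorm drury_arveson (da_fun x) = norm x"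
proof -
  have "(norm (multinomial k *\<^sub>R coeff x k))\<^sup>2 / multinomial k = multinomial k * (norm (coeff x k))\<^sup>2" for k
    using multinomial_pos[of k] by (simp add: power_mult_distrib power2_eq_square)
  then show ?thesis
    unfolding drury_arveson_def using infsumI[OF has_sum_norm_da[of x]] by (simp add: taylor_coeffs_da_fun)
qed

lemma madd_da_fun: "madd drury_arveson (da_fun x) (da_fun y) = da_fun (x + y)"
  by (auto simp: drury_arveson_def da_fun_def deval_add fun_eq_iff)

lemma mscale_da_fun: "mscale drury_arveson c (da_fun x) = da_fun (c *\<^sub>C x)"
  by (auto simp: drury_arveson_def da_fun_def deval_scaleC fun_eq_iff)

lemma mact_da_fun: "mact drury_arveson i (da_fun x) = da_fun (fshift i x)"
  by (auto simp: drury_arveson_def da_fun_def deval_fshift fun_eq_iff)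

section \<open>Evaluation depends holomorphically on the point\<close>

definition eval_op :: "complex ^ 'm \<Rightarrow> ('m::finite, 'e::complex_hilbert_space) da \<Rightarrow>\<^sub>L 'e"
  where "eval_op z = Blinfun (\<lambda>x. deval x z)"

lemma eval_op_apply: "z \<in> ball 0 1 \<Longrightarrow> blinfun_apply (eval_op z) x = deval x z"
  unfolding eval_op_def by (simp add: bounded_linear_Blinfun_apply bounded_linear_deval del: mem_ball)

definition bshift_op :: "'m \<Rightarrow> ('m::finite, 'e::complex_hilbert_space) da \<Rightarrow>\<^sub>L ('m, 'e) da"
  where "bshift_op i = Blinfun (bshift i)"

lemma bshift_op_apply [simp]: "blinfun_apply (bshift_op i) x = bshift i x"
  unfolding bshift_op_def by (simp add: bounded_linear_Blinfun_apply bounded_linear_bshift)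

definition coeff0_op :: "('m::finite, 'e::complex_hilbert_space) da \<Rightarrow>\<^sub>L 'e"
  where "coeff0_op = Blinfun (\<lambda>x. coeff x (\<lambda>_. 0))"

lemma coeff0_op_apply [simp]: "blinfun_apply coeff0_op x = coeff x (\<lambda>_. 0)"
  unfolding coeff0_op_def by (simp add: bounded_linear_Blinfun_apply bounded_linear_coeff_0)

text \<open>
  The operator \<open>X \<mapsto> z\<^sub>1 X L\<^sub>1 + \<dots> + z\<^sub>m X L\<^sub>m\<close>, of norm at most \<open>|z|\<close>. Evaluation \<open>E\<close> at \<open>z\<close> satisfies
  \<open>E = E\<^sub>0 + row_op z E\<close>, in which \<open>E\<^sub>0\<close> is evaluation at 0, so that questions about the dependence on \<open>z\<close>
  become questions about a contractive fixed point equation in the space of bounded operators.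
\<close>

definition row_op :: "complex ^ 'm \<Rightarrow> (('m::finite, 'e::complex_hilbert_space) da \<Rightarrow>\<^sub>L 'f::complex_hilbert_space) \<Rightarrow> (('m, 'e) da \<Rightarrow>\<^sub>L 'f)"
  where "row_op z X = (\<Sum>i\<in>UNIV. (z $ i) *\<^sub>C (X o\<^sub>L bshift_op i))"

lemma row_op_apply: "blinfun_apply (row_op z X) x = (\<Sum>i\<in>UNIV. (z $ i) *\<^sub>C blinfun_apply X (bshift i x))"
  unfolding row_op_def by (simp add: blinfun.sum_left scaleC_blinfun.rep_eq)

lemma norm_row_op: "norm (row_op z X) \<le> norm z * norm X"
proof (rule norm_blinfun_bound)
  fix x
  have "norm (blinfun_apply (row_op z X) x) \<le> (\<Sum>i\<in>UNIV. norm ((z $ i) *\<^sub>C blinfun_apply X (bshift i x)))"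
    unfolding row_op_apply by (rule norm_sum)
  also have "\<dots> \<le> (\<Sum>i\<in>UNIV. norm X * (\<bar>cmod (z $ i)\<bar> * \<bar>norm (bshift i x)\<bar>))"
  proof (rule sum_mono)
    fix i
    show "norm ((z $ i) *\<^sub>C blinfun_apply X (bshift i x)) \<le> norm X * (\<bar>cmod (z $ i)\<bar> * \<bar>norm (bshift i x)\<bar>)"
      using mult_left_mono[OF norm_blinfun[of X "bshift i x"], of "cmod (z $ i)"]
      by (simp add: norm_scaleC mult_ac)
  qed
  also have "\<dots> \<le> norm X * (L2_set (\<lambda>i. cmod (z $ i)) UNIV * L2_set (\<lambda>i. norm (bshift i x)) UNIV)"
    unfolding sum_distrib_left[symmetric] by (intro mult_left_mono L2_set_mult_ineq) auto
  also have "\<dots> \<le> norm X * (norm z * norm x)"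
  proof (intro mult_left_mono mult_mono)
    have "(\<Sum>i\<in>UNIV. (norm (bshift i x))\<^sup>2) \<le> (norm x)\<^sup>2" using norm_decomposition[of x] by simp
    then show "L2_set (\<lambda>i. norm (bshift i x)) UNIV \<le> norm x"
      unfolding L2_set_def by (rule real_le_lsqrt[rotated]) simp
  qed (auto simp: norm_vec_def)
  finally show "norm (blinfun_apply (row_op z X) x) \<le> norm z * norm X * norm x" by (simp add: mult_ac)
qed simp

lemma row_op_add_left: "row_op (z + w) X = row_op z X + row_op w X"
  by (simp add: row_op_def scaleC_add_left sum.distrib)

lemma row_op_scale_left: "row_op (c *s z) X = c *\<^sub>C row_op z X"
  by (rule blinfun_eqI)
    (simp add: row_op_apply scaleC_blinfun.rep_eq scaleC_scaleC
      linear_sum[OF bounded_linear.linear[OF bounded_linear_scaleC]])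

lemma row_op_diff_left: "row_op (z - w) X = row_op z X - row_op w X"
  using row_op_add_left[of "z - w" w X] by simp

lemma row_op_add_right: "row_op z (X + Y) = row_op z X + row_op z Y"
  by (rule blinfun_eqI) (simp add: row_op_apply blinfun.add_left scaleC_add_right sum.distrib)

lemma row_op_diff_right: "row_op z (X - Y) = row_op z X - row_op z Y"
  using row_op_add_right[of z "X - Y" Y] by simp

lemma row_op_scaleC_right: "row_op z (c *\<^sub>C X) = c *\<^sub>C row_op z X"
  by (rule blinfun_eqI)
    (simp add: row_op_apply scaleC_blinfun.rep_eq scaleC_scaleC mult.commute
      linear_sum[OF bounded_linear.linear[OF bounded_linear_scaleC]])

lemma eval_op_unfold: "z \<in> ball 0 1 \<Longrightarrow> eval_op z = coeff0_op + row_op z (eval_op z)"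
  by (rule blinfun_eqI) (simp add: eval_op_apply blinfun.add_left row_op_apply flip: deval_unfold del: mem_ball)

lemma row_op_equation_bound:
  assumes "X = Y + row_op z X"
  shows "(1 - norm z) * norm X \<le> norm Y"
proof -
  have "norm X \<le> norm Y + norm (row_op z X)" using assms norm_triangle_ineq by metis
  then show ?thesis using norm_row_op[of z X] by (simp add: left_diff_distrib)
qed

lemma row_op_equation_unique:
  assumes "z \<in> ball 0 1" "X = Y + row_op z X" "X' = Y + row_op z X'"
  shows "X = X'"
proof -
  have "X - X' = (Y + row_op z X) - (Y + row_op z X')" by (rule arg_cong2[OF assms(2,3)])
  then have "X - X' = 0 + row_op z (X - X')" unfolding row_op_diff_right by simp
  from row_op_equation_bound[OF this] assms(1) show ?thesis by (simp add: mult_le_0_iff)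
qed

lemma row_op_equation_solvable:
  assumes z: "z \<in> ball 0 1"
  shows "\<exists>X. X = Y + row_op z X"
proof -
  have "dist (Y + row_op z X) (Y + row_op z X') \<le> norm z * dist X X'" for X X'
    using norm_row_op[of z "X - X'"] by (simp add: dist_norm row_op_diff_right)
  then have "\<exists>!X. Y + row_op z X = X"
    using z by (intro banach_fix_type[of "norm z"]) auto
  then show ?thesis by metis
qed

text \<open>
  Differentiating \<open>E z = E\<^sub>0 + row_op z (E z)\<close> formally shows that the derivative in direction \<open>h\<close> must
  solve \<open>X = row_op h (E z) + row_op z X\<close>. This solution is taken as \<open>D h\<close>. The
  remainder \<open>E w - E z - D (w - z)\<close> solves an equation of the same kind with inhomogeneity of order
  \<open>|w - z|\<^sup>2\<close>, because \<open>E w - E z\<close> is of order \<open>|w - z|\<close> for the same reason.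
\<close>

theorem holomorphic_eval_op:
  assumes z: "z \<in> ball 0 1"
  shows "\<exists>D. ((eval_op :: complex ^ 'm::finite \<Rightarrow> ('m, 'e::complex_hilbert_space) da \<Rightarrow>\<^sub>L 'e) has_derivative D) (at z) \<and>
    (\<forall>c v. D (c *s v) = c *\<^sub>C D v)"
proof -
  let ?E = "eval_op :: complex ^ 'm \<Rightarrow> ('m, 'e) da \<Rightarrow>\<^sub>L 'e"
  define \<rho> where "\<rho> = 1 - norm z"
  have \<rho>: "\<rho> > 0" using z by (simp add: \<rho>_def)
  have "\<forall>h. \<exists>X. X = row_op h (?E z) + row_op z X"
    by (intro allI row_op_equation_solvable z)
  from choice[OF this] obtain D where D: "\<And>h. D h = row_op h (?E z) + row_op z (D h)" by blast
  have D_eqI: "D h = X" if "X = row_op h (?E z) + row_op z X" for h X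
    using row_op_equation_unique[OF z D that] .
  have D_add: "D (h + h') = D h + D h'" for h h'
    by (rule D_eqI, subst D[of h], subst D[of h']) (simp add: row_op_add_left row_op_add_right)
  have D_scaleC: "D (c *s h) = c *\<^sub>C D h" for c h
    by (rule D_eqI, subst D[of h]) (simp add: row_op_scale_left row_op_scaleC_right scaleC_add_right)
  have D_bound: "norm (D h) \<le> norm h * (norm (?E z) / \<rho>)" for h
  proof -
    have "\<rho> * norm (D h) \<le> norm h * norm (?E z)"
      using row_op_equation_bound[OF D] norm_row_op[of h "?E z"] unfolding \<rho>_def by (rule order.trans)
    then show ?thesis using \<rho> by (simp add: field_simps)
  qed
  have D_bl: "bounded_linear D"
  proof (rule bounded_linear_intro)
    show "D (r *\<^sub>R h) = r *\<^sub>R D h" for r h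
    proof -
      have "r *\<^sub>R h = complex_of_real r *s h"
        unfolding vec_eq_iff vector_scaleR_component vector_smult_component by (simp add: scaleR_conv_of_real)
      then show ?thesis by (simp add: D_scaleC scaleC_of_real)
    qed
  qed (fact D_add D_bound)+
  define K where "K = norm (coeff0_op :: ('m, 'e) da \<Rightarrow>\<^sub>L 'e)"
  have "(?E has_derivative D) (at z)"
  proof (rule has_derivativeI_sandwich[where e = "\<rho> / 2"])
    show "((\<lambda>w. 2 * K / \<rho> ^ 3 * norm (w - z)) \<longlongrightarrow> 0) (at z)"
    proof -
      have "((\<lambda>w. 2 * K / \<rho> ^ 3 * norm (w - z)) \<longlongrightarrow> 2 * K / \<rho> ^ 3 * norm (z - z)) (at z)"
        by (intro tendsto_intros)
      then show ?thesis by simp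
    qed
    fix w assume w: "w \<noteq> z" "dist w z < \<rho> / 2"
    have "norm w \<le> norm z + norm (w - z)" by (metis norm_triangle_sub)
    then have nw: "\<rho> / 2 \<le> 1 - norm w" using w(2) unfolding \<rho>_def dist_norm by argo
    then have wb: "w \<in> ball 0 1" using \<rho> by simp
    have 1: "norm (?E w) \<le> 2 * K / \<rho>"
    proof -
      have "(\<rho> / 2) * norm (?E w) \<le> (1 - norm w) * norm (?E w)" using nw by (rule mult_right_mono) simp
      also have "\<dots> \<le> K" unfolding K_def by (rule row_op_equation_bound[OF eval_op_unfold[OF wb]])
      finally show ?thesis using \<rho> by (simp add: field_simps)
    qed
    have diff: "?E w - ?E z = row_op (w - z) (?E w) + row_op z (?E w - ?E z)"
    proof -
      have "?E w - ?E z = row_op w (?E w) - row_op z (?E z)"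
        by (subst eval_op_unfold[OF wb], subst eval_op_unfold[OF z]) simp
      then show ?thesis unfolding row_op_diff_left row_op_diff_right by simp
    qed
    have 2: "norm (?E w - ?E z) \<le> norm (w - z) * (2 * K / \<rho>) / \<rho>"
    proof -
      have "\<rho> * norm (?E w - ?E z) \<le> norm (w - z) * norm (?E w)"
        using row_op_equation_bound[OF diff] norm_row_op[of "w - z" "?E w"] unfolding \<rho>_def by (rule order.trans)
      also have "\<dots> \<le> norm (w - z) * (2 * K / \<rho>)" using 1 by (rule mult_left_mono) simp
      finally show ?thesis using \<rho> by (simp add: pos_le_divide_eq mult.commute)
    qed
    let ?R = "?E w - ?E z - D (w - z)"
    have R: "?R = row_op (w - z) (?E w - ?E z) + row_op z ?R"
      by (subst diff, subst D) (simp add: row_op_diff_right row_op_add_right algebra_simps)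
    have "\<rho> * norm ?R \<le> norm (w - z) * norm (?E w - ?E z)"
      using row_op_equation_bound[OF R] norm_row_op[of "w - z" "?E w - ?E z"] unfolding \<rho>_def by (rule order.trans)
    also have "\<dots> \<le> norm (w - z) * (norm (w - z) * (2 * K / \<rho>) / \<rho>)" using 2 by (rule mult_left_mono) simp
    finally show "norm (?E w - ?E z - D (w - z)) / norm (w - z) \<le> 2 * K / \<rho> ^ 3 * norm (w - z)"
      using \<rho> w(1) by (simp add: field_simps power3_eq_cube)
  qed (use \<rho> D_bl in auto)
  with D_scaleC show ?thesis by blast
qed

section \<open>Multipliers and module maps\<close>

text \<open>
  The difference \<open>\<Delta>\<close> of both sides vanishes on constants and turns \<open>S\<^sub>i\<close> into the factor \<open>z\<^sub>i\<close>. By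
  \<open>da_decomposition\<close> it is then a fixed point of \<open>row_op z\<close>, and 0 is the only one.
\<close>

lemma module_hom_evaluation:
  assumes C: "module_hom C" and z: "z \<in> ball 0 1"
  shows "deval (C x) z = deval (C (const_da (deval x z))) z"
proof -
  interpret C: bounded_linear C using C by (simp add: module_hom_def)
  interpret dv: bounded_linear "\<lambda>x. deval x z" by (rule bounded_linear_deval[OF z])
  have fs: "C (fshift i x) = fshift i (C x)" for i x using C by (simp add: module_hom_def)
  have sc: "C (c *\<^sub>C x) = c *\<^sub>C C x" for c x using C by (simp add: module_hom_def)
  define \<Delta> where "\<Delta> x = deval (C x) z - deval (C (const_da (deval x z))) z" for x
  have bl: "bounded_linear \<Delta>" unfolding \<Delta>_def
    by (intro bounded_linear_sub bounded_linear_compose[OF bounded_linear_deval[OF z]] C.bounded_linear_axioms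
        bounded_linear_compose[OF C.bounded_linear_axioms] bounded_linear_compose[OF bounded_linear_const_da]
        bounded_linear_deval z)
  interpret \<Delta>: bounded_linear \<Delta> by (fact bl)
  have \<Delta>_const: "\<Delta> (const_da e) = 0" for e by (simp add: \<Delta>_def deval_const[OF z])
  have \<Delta>_shift: "\<Delta> (fshift i x) = (z $ i) *\<^sub>C \<Delta> x" for i x
    unfolding \<Delta>_def fs deval_fshift[OF z] const_da_scaleC sc deval_scaleC[OF z]
    by (simp add: linear_diff[OF bounded_linear.linear[OF bounded_linear_scaleC]])
  define T where "T = Blinfun \<Delta>"
  have T: "blinfun_apply T x = \<Delta> x" for x unfolding T_def by (simp add: bounded_linear_Blinfun_apply bl)
  have "T = 0 + row_op z T"
  proof (rule blinfun_eqI)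
    fix x
    show "blinfun_apply T x = blinfun_apply (0 + row_op z T) x"
      by (subst da_decomposition[of x]) (simp add: T \<Delta>.add \<Delta>.sum \<Delta>_const \<Delta>_shift row_op_apply)
  qed
  moreover have "0 = 0 + row_op z (0 :: ('a, 'b) da \<Rightarrow>\<^sub>L 'c)" using norm_row_op[of z 0] by simp
  ultimately have "T = 0" by (rule row_op_equation_unique[OF z])
  then have "\<Delta> x = 0" using T[of x] by simp
  then show ?thesis by (simp add: \<Delta>_def)
qed

text \<open>
  The multiplier is \<open>\<psi> z e = (C e) z\<close>, with \<open>e\<close> on the right viewed as a constant function. It is
  holomorphic in the operator norm because it is \<open>eval_op\<close> composed with a fixed operator.
\<close>

theorem multiplier_of_module_hom:
  fixes C :: "('m::finite, 'e::complex_hilbert_space) da \<Rightarrow> ('m, 'f::complex_hilbert_space) da"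
  assumes C: "module_hom C"
  obtains \<psi> :: "complex ^ 'm \<Rightarrow> 'e \<Rightarrow>\<^sub>L 'f"
    where "multiplier \<psi>" "\<And>x. mult_op \<psi> (da_fun x) = da_fun (C x)"
proof
  define S where "S = Blinfun (\<lambda>e. C (const_da e))"
  have Cbl: "bounded_linear C" using C by (simp add: module_hom_def)
  have S: "blinfun_apply S e = C (const_da e)" for e
    unfolding S_def
    by (simp add: bounded_linear_Blinfun_apply bounded_linear_compose[OF Cbl bounded_linear_const_da])
  define \<psi> where "\<psi> z = eval_op z o\<^sub>L S" for z
  have \<psi>: "blinfun_apply (\<psi> z) e = deval (C (const_da e)) z" if "z \<in> ball 0 1" for z e
    unfolding \<psi>_def using that by (simp add: eval_op_apply S del: mem_ball)
  show *: "mult_op \<psi> (da_fun x) = da_fun (C x)" for x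
  proof
    show "mult_op \<psi> (da_fun x) z = da_fun (C x) z" for z
      using module_hom_evaluation[OF C, of z x, symmetric]
      by (auto simp: mult_op_def da_fun_def \<psi> blinfun.zero_right simp del: mem_ball)
  qed
  have "holomorphic_on_ball \<psi>"
    unfolding holomorphic_on_ball_def
  proof
    fix z :: "complex ^ 'm" assume z: "z \<in> ball 0 1"
    obtain D where D: "((eval_op :: complex ^ 'm \<Rightarrow> ('m, 'f) da \<Rightarrow>\<^sub>L 'f) has_derivative D) (at z)"
      "\<And>c v. D (c *s v) = c *\<^sub>C D v"
      using holomorphic_eval_op[OF z] by blast
    have "(\<psi> has_derivative (\<lambda>h. D h o\<^sub>L S)) (at z)"
      unfolding \<psi>_def
      by (rule bounded_linear.has_derivative[OF bounded_bilinear.bounded_linear_left[OF bounded_bilinear_blinfun_compose] D(1)])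
    moreover have "D (c *s v) o\<^sub>L S = c *\<^sub>C (D v o\<^sub>L S)" for c v
      by (rule blinfun_eqI) (simp add: D(2) scaleC_blinfun.rep_eq)
    ultimately show "\<exists>D. (\<psi> has_derivative D) (at z) \<and> (\<forall>c v. D (c *s v) = c *\<^sub>C D v)" by blast
  qed
  moreover have "complex_linear_blinfun (\<psi> z)" if "z \<in> ball 0 1" for z
    using C that unfolding complex_linear_blinfun_def module_hom_def
    by (simp add: \<psi> const_da_scaleC deval_scaleC del: mem_ball)
  ultimately show "multiplier \<psi>"
    unfolding multiplier_def mcarrier_drury_arveson by (auto simp: *)
qed

text \<open>
  Boundedness is the closed graph theorem: point evaluations are continuous and separate
  functions, so the graph is an intersection of closed sets.
\<close>

theorem module_hom_of_multiplier:
  fixes \<theta> :: "complex ^ 'm::finite \<Rightarrow> 'e::complex_hilbert_space \<Rightarrow>\<^sub>L 'f::complex_hilbert_space"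
  assumes \<theta>: "multiplier \<theta>"
  obtains A where "module_hom A" "\<And>x. mult_op \<theta> (da_fun x) = da_fun (A x)"
proof -
  have lin: "blinfun_apply (\<theta> z) (c *\<^sub>C e) = c *\<^sub>C blinfun_apply (\<theta> z) e" if "z \<in> ball 0 1" for z c e
    using \<theta> that unfolding multiplier_def complex_linear_blinfun_def by blast
  have "\<forall>x. \<exists>y. mult_op \<theta> (da_fun x) = da_fun y"
    using \<theta> unfolding multiplier_def mcarrier_drury_arveson by blast
  then obtain A where A: "\<And>x. mult_op \<theta> (da_fun x) = da_fun (A x)" by metis
  have A_ev: "deval (A x) z = blinfun_apply (\<theta> z) (deval x z)" if "z \<in> ball 0 1" for x z
    using fun_cong[OF A[of x], of z] that by (simp add: da_fun_def mult_op_def)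
  have A_eqI: "A x = y" if "\<And>z. z \<in> ball 0 1 \<Longrightarrow> deval y z = blinfun_apply (\<theta> z) (deval x z)" for x y
  proof (rule injD[OF inj_da_fun])
    show "da_fun (A x) = da_fun y" using that A_ev by (auto simp: da_fun_def fun_eq_iff)
  qed
  have A_add: "A (x + y) = A x + A y" for x y
    by (rule A_eqI) (simp only: deval_add A_ev blinfun.add_right)
  have A_scaleC: "A (c *\<^sub>C x) = c *\<^sub>C A x" for c x
    by (rule A_eqI) (simp only: deval_scaleC A_ev lin)
  have A_scaleR: "A (r *\<^sub>R x) = r *\<^sub>R A x" for r x
    using A_scaleC[of "complex_of_real r" x] by (simp add: scaleC_of_real)
  have A_shift: "A (fshift i x) = fshift i (A x)" for i x
    by (rule A_eqI) (simp only: deval_fshift A_ev lin)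
  define W where "W = {(x, y). y = A x}"
  have "subspace W"
    using A_scaleR[of 0 0] by (auto simp: W_def subspace_def A_add A_scaleR zero_prod_def)
  moreover have "closed W"
  proof -
    have "W = (\<Inter>z\<in>ball 0 1. {w. deval (snd w) z = blinfun_apply (\<theta> z) (deval (fst w) z)})"
    proof (intro equalityI subsetI)
      fix w assume "w \<in> W"
      then show "w \<in> (\<Inter>z\<in>ball 0 1. {w. deval (snd w) z = blinfun_apply (\<theta> z) (deval (fst w) z)})"
        by (auto simp: W_def A_ev simp del: mem_ball)
    next
      fix w assume "w \<in> (\<Inter>z\<in>ball 0 1. {w. deval (snd w) z = blinfun_apply (\<theta> z) (deval (fst w) z)})"
      then have "A (fst w) = snd w" by (intro A_eqI) blast
      then show "w \<in> W" unfolding W_def by (cases w) auto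
    qed
    also have "closed \<dots>"
      by (intro closed_INT ballI closed_Collect_eq
          bounded_linear.continuous_on[OF bounded_linear_deval] blinfun.continuous_on continuous_intros)
    finally show ?thesis .
  qed
  moreover have "\<exists>y. (x, y) \<in> W" for x unfolding W_def by blast
  ultimately obtain c where "\<And>x. \<exists>y. (x, y) \<in> W \<and> norm y \<le> c * norm x"
    using closed_relation_bounded_choice by metis
  then have "norm (A x) \<le> norm x * c" for x unfolding W_def by (simp add: mult.commute)
  then have "bounded_linear A" by (intro bounded_linear_intro A_add A_scaleR)
  then have "module_hom A" unfolding module_hom_def using A_scaleC A_shift by blast
  with A that show ?thesis by blast
qed

section \<open>Similarity of quotients\<close>

text \<open>
  \<open>R\<close> is the quotient map followed by the similarity; \<open>Q x\<close> is the coset of \<open>x\<close>.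
\<close>

lemma quotient_similarity_module_hom:
  fixes A :: "('m::finite, 'e::complex_hilbert_space) da \<Rightarrow> ('m, 'g::complex_hilbert_space) da"
  assumes A: "module_hom A"
    and sim: "similar_modules (quotient_module drury_arveson (da_fun ` range A))
      (drury_arveson :: ('m, complex ^ 'm \<Rightarrow> 'f::complex_hilbert_space) hilbert_module)"
  obtains R :: "('m, 'g) da \<Rightarrow> ('m, 'f::complex_hilbert_space) da"
    where "module_hom R" "surj R" "\<And>x. R x = 0 \<longleftrightarrow> x \<in> range A"
proof -
  interpret A: bounded_linear A using A by (simp add: module_hom_def)
  interpret fs: bounded_linear "fshift i" for i by (rule bounded_linear_fshift)
  have A_sc: "A (c *\<^sub>C x) = c *\<^sub>C A x" for c x using A by (simp add: module_hom_def)
  have A_fs: "A (fshift i x) = fshift i (A x)" for i x using A by (simp add: module_hom_def)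
  let ?H = "drury_arveson :: ('m, complex ^ 'm \<Rightarrow> 'g) hilbert_module"
  let ?F = "drury_arveson :: ('m, complex ^ 'm \<Rightarrow> 'f) hilbert_module"
  define M where "M = quotient_module ?H (da_fun ` range A)"
  define Q where "Q x = (\<lambda>u. da_fun (x + A u)) ` UNIV" for x
  have M_carrier: "mcarrier M = range Q"
    unfolding M_def quotient_module_def Q_def
    by (simp add: mcarrier_drury_arveson image_image madd_da_fun)
  have Q_mem: "da_fun y \<in> Q x \<longleftrightarrow> (\<exists>u. y = x + A u)" for x y
    unfolding Q_def using injD[OF inj_da_fun] by blast
  have Q_form: "\<exists>y. f = da_fun y \<and> (\<exists>u. y = x + A u)" if "f \<in> Q x" for f x
    using that unfolding Q_def by blast
  have M_add: "madd M (Q x) (Q y) = Q (x + y)" for x y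
  proof -
    have "madd M (Q x) (Q y) = {madd ?H f g | f g. f \<in> Q x \<and> g \<in> Q y}"
      by (simp add: M_def quotient_module_def)
    also have "\<dots> = {madd ?H (da_fun (x + A u)) (da_fun (y + A v)) | u v. True}"
      unfolding Q_def by blast
    also have "\<dots> = {da_fun (x + A u + (y + A v)) | u v. True}"
      by (simp only: madd_da_fun)
    also have "\<dots> = Q (x + y)"
    proof (intro equalityI subsetI)
      fix f assume "f \<in> {da_fun (x + A u + (y + A v)) | u v. True}"
      then obtain u v where "f = da_fun (x + A u + (y + A v))" by blast
      then have "f = da_fun (x + y + A (u + v))" by (simp add: A.add algebra_simps)
      then show "f \<in> Q (x + y)" unfolding Q_def by blast
    next
      fix f assume "f \<in> Q (x + y)"
      then obtain u where "f = da_fun (x + y + A u)" unfolding Q_def by blast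
      then have "f = da_fun (x + A u + (y + A 0))" by (simp add: A.zero algebra_simps)
      then show "f \<in> {da_fun (x + A u + (y + A v)) | u v. True}" by blast
    qed
    finally show ?thesis .
  qed
  \<comment> \<open>\<open>L\<close> is a scalar or a coordinate multiplication; both are additive and preserve the range of \<open>A\<close>\<close>
  have M_op: "{madd ?H (op f) s | f s. f \<in> Q x \<and> s \<in> da_fun ` range A} = Q (L x)"
    if op: "\<And>y. op (da_fun y) = da_fun (L y)" and L: "\<And>u v. L (u + v) = L u + L v" "\<And>u. L (A u) = A (L' u)"
    for op and L :: "('m, 'g) da \<Rightarrow> ('m, 'g) da" and L' x
  proof (intro equalityI subsetI)
    fix h assume "h \<in> {madd ?H (op f) s | f s. f \<in> Q x \<and> s \<in> da_fun ` range A}"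
    then obtain u v where "h = madd ?H (op (da_fun (x + A u))) (da_fun (A v))"
      unfolding Q_def by blast
    then have "h = da_fun (L x + A (L' u + v))" by (simp add: op L madd_da_fun A.add algebra_simps)
    then show "h \<in> Q (L x)" unfolding Q_def by blast
  next
    fix h assume "h \<in> Q (L x)"
    then obtain v where "h = da_fun (L x + A v)" unfolding Q_def by blast
    then have "h = madd ?H (op (da_fun (x + A 0))) (da_fun (A v))" by (simp add: op A.zero madd_da_fun)
    then show "h \<in> {madd ?H (op f) s | f s. f \<in> Q x \<and> s \<in> da_fun ` range A}"
      unfolding Q_def by blast
  qed
  have M_scale: "mscale M c (Q x) = Q (c *\<^sub>C x)" for c x
    unfolding M_def quotient_module_def
    using M_op[of "mscale ?H c" "\<lambda>x. c *\<^sub>C x" "\<lambda>x. c *\<^sub>C x" x] by (simp add: mscale_da_fun scaleC_add_right A_sc)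
  have M_act: "mact M i (Q x) = Q (fshift i x)" for i x
    unfolding M_def quotient_module_def
    using M_op[of "mact ?H i" "fshift i" "fshift i" x] by (simp add: mact_da_fun fs.add A_fs)
  have M_norm: "0 \<le> mnorm M (Q x)" "mnorm M (Q x) \<le> norm x" for x
  proof -
    have norm_form: "mnorm M (Q x) = (INF u. norm (x + A u))"
      by (simp add: M_def quotient_module_def Q_def image_image mnorm_da_fun)
    show "0 \<le> mnorm M (Q x)" unfolding norm_form by (rule cINF_greatest) auto
    have "bdd_below (range (\<lambda>u. norm (x + A u)))" by (rule bdd_belowI[of _ 0]) auto
    from cINF_lower[OF this, of 0] show "mnorm M (Q x) \<le> norm x" unfolding norm_form by (simp add: A.zero)
  qed
  obtain T T' where T: "module_map M ?F T"
    and T': "bounded_linear_map ?F M T'" "\<And>X. X \<in> mcarrier M \<Longrightarrow> T' (T X) = X" "\<And>f. f \<in> mcarrier ?F \<Longrightarrow> T (T' f) = f"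
    using sim[folded M_def] unfolding similar_modules_def by metis
  have T_mem: "T (Q x) \<in> range da_fun" for x
    using T unfolding module_map_def bounded_linear_map_def mcarrier_drury_arveson M_carrier by blast
  then have "\<forall>x. \<exists>y. T (Q x) = da_fun y" by blast
  then obtain R where R: "\<And>x. T (Q x) = da_fun (R x)" by metis
  have R_eqI: "R x = y" if "T (Q x) = da_fun y" for x y
    using that injD[OF inj_da_fun] R by metis
  have R_add: "R (x + y) = R x + R y" for x y
  proof (rule R_eqI)
    have "T (madd M (Q x) (Q y)) = madd ?F (T (Q x)) (T (Q y))"
      using T unfolding module_map_def bounded_linear_map_def M_carrier by blast
    then show "T (Q (x + y)) = da_fun (R x + R y)" by (simp add: M_add R madd_da_fun)
  qed
  have R_scaleC: "R (c *\<^sub>C x) = c *\<^sub>C R x" for c x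
  proof (rule R_eqI)
    have "T (mscale M c (Q x)) = mscale ?F c (T (Q x))"
      using T unfolding module_map_def bounded_linear_map_def M_carrier by blast
    then show "T (Q (c *\<^sub>C x)) = da_fun (c *\<^sub>C R x)" by (simp add: M_scale R mscale_da_fun)
  qed
  have R_shift: "R (fshift i x) = fshift i (R x)" for i x
  proof (rule R_eqI)
    have "T (mact M i (Q x)) = mact ?F i (T (Q x))"
      using T unfolding module_map_def M_carrier by blast
    then show "T (Q (fshift i x)) = da_fun (fshift i (R x))" by (simp add: M_act R mact_da_fun)
  qed
  obtain c where c: "\<And>X. X \<in> mcarrier M \<Longrightarrow> mnorm ?F (T X) \<le> c * mnorm M X"
    using T unfolding module_map_def bounded_linear_map_def by blast
  have R_bound: "norm (R x) \<le> norm x * \<bar>c\<bar>" for x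
  proof -
    have "norm (R x) \<le> c * mnorm M (Q x)"
      using c[of "Q x"] by (simp add: M_carrier R mnorm_da_fun)
    also have "\<dots> \<le> \<bar>c\<bar> * norm x" using M_norm[of x] by (intro mult_mono) auto
    finally show ?thesis by (simp add: mult.commute)
  qed
  have R_bl: "bounded_linear R"
  proof (rule bounded_linear_intro[OF R_add _ R_bound])
    show "R (r *\<^sub>R x) = r *\<^sub>R R x" for r x
      using R_scaleC[of "complex_of_real r" x] by (simp add: scaleC_of_real)
  qed
  then interpret R: bounded_linear R .
  show ?thesis
  proof
    show "module_hom R" unfolding module_hom_def using R_bl R_scaleC R_shift by blast
    show "surj R"
      unfolding surj_def
    proof
      fix y
      have y: "da_fun y \<in> mcarrier ?F" by (simp add: mcarrier_drury_arveson)
      then have "T' (da_fun y) \<in> mcarrier M"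
        using T'(1) unfolding bounded_linear_map_def by blast
      then obtain x where "T' (da_fun y) = Q x" unfolding M_carrier by blast
      then have "R x = y" using T'(3)[OF y] by (intro R_eqI) simp
      then show "\<exists>x. y = R x" by blast
    qed
    show "R x = 0 \<longleftrightarrow> x \<in> range A" for x
    proof
      assume "R x = 0"
      then have "T' (T (Q x)) = T' (T (Q 0))" by (simp add: R R.zero)
      then have "Q x = Q 0" by (simp add: T'(2) M_carrier)
      moreover have "da_fun x \<in> Q x" unfolding Q_mem by (rule exI[of _ 0]) (simp add: A.zero)
      ultimately have "da_fun x \<in> Q 0" by simp
      then show "x \<in> range A" by (auto simp: Q_mem)
    next
      assume "x \<in> range A"
      then obtain u where u: "x = A u" by blast
      have "Q x = Q 0"
      proof (intro equalityI subsetI)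
        fix f assume "f \<in> Q x"
        then obtain v where "f = da_fun (0 + A (u + v))" unfolding Q_def u by (auto simp: A.add)
        then show "f \<in> Q 0" unfolding Q_def by blast
      next
        fix f assume "f \<in> Q 0"
        then obtain v where "f = da_fun (x + A (v - u))" unfolding Q_def u by (auto simp: A.diff)
        then show "f \<in> Q x" unfolding Q_def by blast
      qed
      then have "da_fun (R x) = da_fun (R 0)" by (simp only: R[symmetric])
      then have "R x = R 0" by (rule injD[OF inj_da_fun])
      then show "R x = 0" by (simp add: R.zero)
    qed
  qed
qed

theorem corollary3p7:
  fixes \<theta> :: "complex ^ 'm::finite \<Rightarrow> 'e::complex_hilbert_space \<Rightarrow>\<^sub>L 'es::complex_hilbert_space"
  assumes "multiplier \<theta>"
    and "closedin (module_topology (drury_arveson :: ('m, complex ^ 'm \<Rightarrow> 'es) hilbert_module))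
          (mult_range \<theta>)"
    and "similar_modules
          (quotient_module drury_arveson (mult_range \<theta>))
          (drury_arveson :: ('m, complex ^ 'm \<Rightarrow> 'f::complex_hilbert_space) hilbert_module)"
  shows "\<exists>\<psi> :: complex ^ 'm \<Rightarrow> 'es \<Rightarrow>\<^sub>L 'e. multiplier \<psi> \<and>
    (\<forall>z\<in>ball 0 1. \<theta> z o\<^sub>L \<psi> z o\<^sub>L \<theta> z = \<theta> z)"
proof -
  obtain A where A: "module_hom A" "\<And>x. mult_op \<theta> (da_fun x) = da_fun (A x)"
    using module_hom_of_multiplier[OF assms(1)] by metis
  have "mult_range \<theta> = da_fun ` range A"
    unfolding mult_range_def mcarrier_drury_arveson by (simp add: image_image A(2))
  with assms(3) obtain R :: "('m, 'es) da \<Rightarrow> ('m, 'f) da"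
    where R: "module_hom R" "surj R" "\<And>x. R x = 0 \<longleftrightarrow> x \<in> range A"
    using quotient_similarity_module_hom[OF A(1)] by metis
  interpret R: bounded_linear R using R(1) by (simp add: module_hom_def)
  interpret fs: bounded_linear "fshift i" for i by (rule bounded_linear_fshift)
  have "module_hom (\<lambda>x :: ('m, 'f) da. x)" by (simp add: module_hom_def bounded_linear_ident)
  then obtain J where J: "module_hom J" "\<And>y. R (J y) = y"
    using module_hom_factorization[OF R(1), of "\<lambda>x. x"] R(2) by (metis subset_UNIV)
  interpret J: bounded_linear J using J(1) by (simp add: module_hom_def)
  \<comment> \<open>the idempotent module map onto \<open>ker R = ran M\<^sub>\<theta>\<close>\<close>
  define P where "P x = x - J (R x)" for x
  have "module_hom P"
    unfolding module_hom_def
  proof (intro conjI allI)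
    show "bounded_linear P" unfolding P_def
      by (intro bounded_linear_sub bounded_linear_ident bounded_linear_compose[OF J.bounded_linear_axioms] R.bounded_linear_axioms)
    show "P (c *\<^sub>C x) = c *\<^sub>C P x" for c x
      using J(1) R(1) unfolding module_hom_def P_def
      by (simp add: linear_diff[OF bounded_linear.linear[OF bounded_linear_scaleC]])
    show "P (fshift i x) = fshift i (P x)" for i x
      using J(1) R(1) unfolding module_hom_def P_def by (simp add: fs.diff)
  qed
  moreover have "range P \<subseteq> range A"
  proof
    fix y assume "y \<in> range P"
    then obtain x where "y = x - J (R x)" unfolding P_def by blast
    then have "R y = 0" by (simp add: R.diff J(2))
    then show "y \<in> range A" by (simp add: R(3))
  qed
  ultimately obtain C where C: "module_hom C" "\<And>x. A (C x) = P x"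
    using module_hom_factorization[OF A(1)] by metis
  obtain \<psi> :: "complex ^ 'm \<Rightarrow> 'es \<Rightarrow>\<^sub>L 'e" where \<psi>: "multiplier \<psi>" "\<And>x. mult_op \<psi> (da_fun x) = da_fun (C x)"
    using multiplier_of_module_hom[OF C(1)] by metis
  have ACA: "A (C (A x)) = A x" for x
    using R(3)[of "A x"] by (simp add: C(2) P_def J.zero)
  have "blinfun_apply (\<theta> z o\<^sub>L \<psi> z o\<^sub>L \<theta> z) e = blinfun_apply (\<theta> z) e" if z: "z \<in> ball 0 1" for z e
  proof -
    have fe: "da_fun (const_da e) z = e" using z by (simp add: da_fun_def deval_const)
    have "mult_op \<theta> (mult_op \<psi> (mult_op \<theta> (da_fun (const_da e)))) z = mult_op \<theta> (da_fun (const_da e)) z"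
      by (simp add: A(2) \<psi>(2) ACA)
    then show ?thesis unfolding mult_op_def fe by simp
  qed
  then have "\<theta> z o\<^sub>L \<psi> z o\<^sub>L \<theta> z = \<theta> z" if "z \<in> ball 0 1" for z
    using that by (intro blinfun_eqI)
  with \<psi>(1) show ?thesis by blast
qed

end
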